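(* Suppose $G$ is a countable left orderable group admitting a decomposition as an amalgamated free product of the form $G=H*_{h=[a,b]}F_2(a,b)$, where $H$ is a group, $h\in H$ with $h\neq \mathrm{id}$, $F_2(a,b)$ is the free group on $a,b$, and the cyclic subgroups $\langle h\rangle\subseteq H$ and $\langle [a,b]\rangle\subseteq F_2(a,b)$ are identified via $h\mapsto [a,b]$. Then the space $\mathcal{LO}(G)$ of left orders of $G$ has no isolated points.
   Context: $[a,b]=aba^{-1}b^{-1}$. A left order on a group $G$ is a total order $\preceq$ on $G$ such that $f\preceq h$ implies $gf\preceq gh$ for all $f,g,h\in G$; $G$ is left orderable if it admits a left order. $\mathcal{LO}(G)$ is the set of all left orders on $G$, with the topology in which a local base at $\preceq$ is given by the sets $V_{g_1,\dots,g_k}=\{\preceq'\in\mathcal{LO}(G)\mid \mathrm{id}\prec' g_i \text{ for } i=1,\dots,k\}$, where $\{g_1,\dots,g_k\}$ runs over finite subsets of $\preceq$-positive elements of $G$ (elements $g$ with $\mathrm{id}\prec g$). *)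

theory Defs
  imports "HOL-Analysis.Analysis" "HOL-Algebra.Generated_Groups"
begin

section \<open>Left orders and the space of left orders\<close>

definition left_orders :: "('a, 'm) monoid_scheme \<Rightarrow> 'a rel set" where
  "left_orders G =
    {r. linear_order_on (carrier G) r \<and>
        (\<forall>g\<in>carrier G. \<forall>(f, h)\<in>r. (g \<otimes>\<^bsub>G\<^esub> f, g \<otimes>\<^bsub>G\<^esub> h) \<in> r)}"

definition left_orderable :: "('a, 'm) monoid_scheme \<Rightarrow> bool" where
  "left_orderable G \<longleftrightarrow> left_orders G \<noteq> {}"

definition positive_elements :: "('a, 'm) monoid_scheme \<Rightarrow> 'a rel \<Rightarrow> 'a set" where
  "positive_elements G r = {g \<in> carrier G. (\<one>\<^bsub>G\<^esub>, g) \<in> r \<and> g \<noteq> \<one>\<^bsub>G\<^esub>}"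

definition LO_nbhd :: "('a, 'm) monoid_scheme \<Rightarrow> 'a set \<Rightarrow> 'a rel set" where
  "LO_nbhd G S = {r \<in> left_orders G. S \<subseteq> positive_elements G r}"

definition LO :: "('a, 'm) monoid_scheme \<Rightarrow> 'a rel topology" where
  "LO G = topology (\<lambda>U. U \<subseteq> left_orders G \<and>
     (\<forall>r\<in>U. \<exists>S. finite S \<and> S \<subseteq> positive_elements G r \<and> LO_nbhd G S \<subseteq> U))"

lemma istopology_LO:
  "istopology (\<lambda>U. U \<subseteq> left_orders G \<and>
     (\<forall>r\<in>U. \<exists>S. finite S \<and> S \<subseteq> positive_elements G r \<and> LO_nbhd G S \<subseteq> U))"
  unfolding istopology_def
proof (intro conjI allI impI)
  fix U V
  assume U: "U \<subseteq> left_orders G \<and>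
      (\<forall>r\<in>U. \<exists>S. finite S \<and> S \<subseteq> positive_elements G r \<and> LO_nbhd G S \<subseteq> U)"
    and V: "V \<subseteq> left_orders G \<and>
      (\<forall>r\<in>V. \<exists>S. finite S \<and> S \<subseteq> positive_elements G r \<and> LO_nbhd G S \<subseteq> V)"
  show "U \<inter> V \<subseteq> left_orders G" using U by blast
  show "\<forall>r\<in>U \<inter> V. \<exists>S. finite S \<and> S \<subseteq> positive_elements G r \<and> LO_nbhd G S \<subseteq> U \<inter> V"
  proof
    fix r assume r: "r \<in> U \<inter> V"
    obtain S where S: "finite S" "S \<subseteq> positive_elements G r" "LO_nbhd G S \<subseteq> U"
      using r U by blast
    obtain T where T: "finite T" "T \<subseteq> positive_elements G r" "LO_nbhd G T \<subseteq> V"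
      using r V by blast
    have "LO_nbhd G (S \<union> T) \<subseteq> LO_nbhd G S \<inter> LO_nbhd G T"
      unfolding LO_nbhd_def by auto
    then have "LO_nbhd G (S \<union> T) \<subseteq> U \<inter> V"
      using S(3) T(3) by blast
    then show "\<exists>S. finite S \<and> S \<subseteq> positive_elements G r \<and> LO_nbhd G S \<subseteq> U \<inter> V"
      using S T by (intro exI[of _ "S \<union> T"] conjI) simp_all
  qed
next
  fix K
  assume K: "\<forall>U\<in>K. U \<subseteq> left_orders G \<and>
      (\<forall>r\<in>U. \<exists>S. finite S \<and> S \<subseteq> positive_elements G r \<and> LO_nbhd G S \<subseteq> U)"
  show "\<Union>K \<subseteq> left_orders G" using K by (intro Union_least) blast
  show "\<forall>r\<in>\<Union>K. \<exists>S. finite S \<and> S \<subseteq> positive_elements G r \<and> LO_nbhd G S \<subseteq> \<Union>K"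
  proof
    fix r assume "r \<in> \<Union>K"
    then obtain U where U: "U \<in> K" "r \<in> U" by (rule UnionE)
    then obtain S where S: "finite S" "S \<subseteq> positive_elements G r" "LO_nbhd G S \<subseteq> U"
      using K by meson
    have "LO_nbhd G S \<subseteq> \<Union>K" using S(3) U(1) by (rule subset_trans[OF _ Union_upper])
    then show "\<exists>S. finite S \<and> S \<subseteq> positive_elements G r \<and> LO_nbhd G S \<subseteq> \<Union>K"
      using S by (intro exI[of _ S] conjI)
  qed
qed

lemma openin_LO:
  "openin (LO G) U \<longleftrightarrow> U \<subseteq> left_orders G \<and>
     (\<forall>r\<in>U. \<exists>S. finite S \<and> S \<subseteq> positive_elements G r \<and> LO_nbhd G S \<subseteq> U)"
  unfolding LO_def by (subst topology_inverse'[OF istopology_LO]) (rule HOL.refl)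

lemma openin_LO_nbhd:
  assumes "finite S"
  shows "openin (LO G) (LO_nbhd G S)"
  unfolding openin_LO
proof (intro conjI ballI)
  show "LO_nbhd G S \<subseteq> left_orders G" by (auto simp: LO_nbhd_def)
  fix r assume "r \<in> LO_nbhd G S"
  then show "\<exists>T. finite T \<and> T \<subseteq> positive_elements G r \<and> LO_nbhd G T \<subseteq> LO_nbhd G S"
    using assms by (intro exI[of _ S]) (simp add: LO_nbhd_def)
qed

lemma topspace_LO [simp]: "topspace (LO G) = left_orders G"
proof (rule subset_antisym)
  have "openin (LO G) (left_orders G)"
    using openin_LO_nbhd[of "{}" G] by (simp add: LO_nbhd_def)
  then show "left_orders G \<subseteq> topspace (LO G)"
    by (rule openin_subset)
  have "openin (LO G) (topspace (LO G))"
    by (rule openin_topspace)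
  then show "topspace (LO G) \<subseteq> left_orders G"
    unfolding openin_LO[of G "topspace (LO G)"] by (rule conjunct1)
qed


section \<open>Groups given by generators and relations\<close>

text \<open>Words over the alphabet \<open>A\<close> modulo the congruence generated by the pairs in \<open>R\<close>.\<close>

inductive_set word_cong :: "'l set \<Rightarrow> ('l list \<times> 'l list) set \<Rightarrow> 'l list rel"
  for A :: "'l set" and R :: "('l list \<times> 'l list) set" where
  refl: "w \<in> lists A \<Longrightarrow> (w, w) \<in> word_cong A R"
| sym: "(v, w) \<in> word_cong A R \<Longrightarrow> (w, v) \<in> word_cong A R"
| trans: "(u, v) \<in> word_cong A R \<Longrightarrow> (v, w) \<in> word_cong A R \<Longrightarrow> (u, w) \<in> word_cong A R"
| rel: "(l, r) \<in> R \<Longrightarrow> l \<in> lists A \<Longrightarrow> r \<in> lists A \<Longrightarrow> u \<in> lists A \<Longrightarrow> v \<in> lists A \<Longrightarrow>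
    (u @ l @ v, u @ r @ v) \<in> word_cong A R"

definition presented_monoid :: "'l set \<Rightarrow> ('l list \<times> 'l list) set \<Rightarrow> 'l list set monoid" where
  "presented_monoid A R =
    \<lparr>carrier = lists A // word_cong A R,
     mult = (\<lambda>X Y. \<Union>x\<in>X. \<Union>y\<in>Y. word_cong A R `` {x @ y}),
     one = word_cong A R `` {[]}\<rparr>"

lemma word_cong_lists: "(v, w) \<in> word_cong A R \<Longrightarrow> v \<in> lists A \<and> w \<in> lists A"
  by (induction rule: word_cong.induct) auto

lemma equiv_word_cong: "equiv (lists A) (word_cong A R)"
proof (rule equivI)
  show "word_cong A R \<subseteq> lists A \<times> lists A"
    by (rule subrelI) (simp only: mem_Times_iff fst_conv snd_conv word_cong_lists)
  show "refl_on (lists A) (word_cong A R)"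
    by (rule refl_onI) (rule word_cong.refl)
  show "sym (word_cong A R)"
    by (rule symI) (rule word_cong.sym)
  show "Relation.trans (word_cong A R)"
    by (rule transI) (rule word_cong.trans)
qed

lemma word_cong_context:
  assumes "(v, w) \<in> word_cong A R" "x \<in> lists A" "y \<in> lists A"
  shows "(x @ v @ y, x @ w @ y) \<in> word_cong A R"
  using assms(1)
proof (induction rule: word_cong.induct)
  case (refl w)
  then show ?case using assms(2,3) by (intro word_cong.refl) auto
next
  case (sym v w)
  then show ?case by (blast intro: word_cong.sym)
next
  case (trans u v w)
  then show ?case by (blast intro: word_cong.trans)
next
  case (rel l r u v)
  then have "((x @ u) @ l @ (v @ y), (x @ u) @ r @ (v @ y)) \<in> word_cong A R"
    using assms(2,3) by (intro word_cong.rel) auto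
  then show ?case by simp
qed

lemma word_cong_append:
  assumes v: "(v, v') \<in> word_cong A R" and w: "(w, w') \<in> word_cong A R"
  shows "(v @ w, v' @ w') \<in> word_cong A R"
proof (rule word_cong.trans)
  show "(v @ w, v' @ w) \<in> word_cong A R"
    using word_cong_context[OF v, of "[]" w] word_cong_lists[OF w] by simp
  show "(v' @ w, v' @ w') \<in> word_cong A R"
    using word_cong_context[OF w, of v' "[]"] word_cong_lists[OF v] by simp
qed

lemma presented_monoid_mult:
  assumes "v \<in> lists A" "w \<in> lists A"
  shows "(word_cong A R `` {v}) \<otimes>\<^bsub>presented_monoid A R\<^esub> (word_cong A R `` {w})
       = word_cong A R `` {v @ w}"
proof -
  let ?cl = "\<lambda>w. word_cong A R `` {w}"
  have eq: "?cl (x @ y) = ?cl (v @ w)" if "x \<in> ?cl v" "y \<in> ?cl w" for x y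
  proof -
    have "(v, x) \<in> word_cong A R" "(w, y) \<in> word_cong A R" using that by simp_all
    then have "(v @ w, x @ y) \<in> word_cong A R" by (rule word_cong_append)
    then show ?thesis by (rule equiv_class_eq[OF equiv_word_cong, symmetric])
  qed
  have "v \<in> ?cl v" "w \<in> ?cl w"
    using assms by (simp_all only: Image_singleton_iff word_cong.refl)
  then have ne: "?cl v \<noteq> {}" "?cl w \<noteq> {}" by (metis empty_iff)+
  have "(\<Union>x\<in>?cl v. \<Union>y\<in>?cl w. ?cl (x @ y)) = (\<Union>x\<in>?cl v. \<Union>y\<in>?cl w. ?cl (v @ w))"
    by (intro SUP_cong HOL.refl eq)
  also have "\<dots> = ?cl (v @ w)"
    by (simp only: UN_constant ne if_False)
  finally show ?thesis
    by (simp add: presented_monoid_def)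
qed

lemma monoid_presented_monoid: "monoid (presented_monoid A R)"
proof -
  let ?cl = "\<lambda>w. word_cong A R `` {w}"
  have one: "\<one>\<^bsub>presented_monoid A R\<^esub> = ?cl []"
    by (simp add: presented_monoid_def)
  have cls: "\<exists>w\<in>lists A. X = ?cl w" if "X \<in> carrier (presented_monoid A R)" for X
    using that by (auto simp: presented_monoid_def quotient_def)
  have clsI: "?cl w \<in> carrier (presented_monoid A R)" if "w \<in> lists A" for w
    using that by (simp add: presented_monoid_def quotientI)
  have app: "v @ w \<in> lists A" if "v \<in> lists A" "w \<in> lists A" for v w
    using that by simp
  have nil: "[] \<in> lists A" by simp
  note mult = presented_monoid_mult[of _ A _ R]
  show ?thesis
  proof (rule monoidI)
    fix X Y assume "X \<in> carrier (presented_monoid A R)" "Y \<in> carrier (presented_monoid A R)"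
    then obtain v w where vw: "v \<in> lists A" "w \<in> lists A" "X = ?cl v" "Y = ?cl w"
      using cls by metis
    show "X \<otimes>\<^bsub>presented_monoid A R\<^esub> Y \<in> carrier (presented_monoid A R)"
      unfolding vw(3,4) mult[OF vw(1,2)] by (rule clsI[OF app[OF vw(1,2)]])
  next
    show "\<one>\<^bsub>presented_monoid A R\<^esub> \<in> carrier (presented_monoid A R)"
      unfolding one by (rule clsI[OF nil])
  next
    fix X Y Z assume "X \<in> carrier (presented_monoid A R)" "Y \<in> carrier (presented_monoid A R)"
      "Z \<in> carrier (presented_monoid A R)"
    then obtain u v w where *: "u \<in> lists A" "v \<in> lists A" "w \<in> lists A"
        "X = ?cl u" "Y = ?cl v" "Z = ?cl w"
      using cls by metis
    show "X \<otimes>\<^bsub>presented_monoid A R\<^esub> Y \<otimes>\<^bsub>presented_monoid A R\<^esub> Z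
        = X \<otimes>\<^bsub>presented_monoid A R\<^esub> (Y \<otimes>\<^bsub>presented_monoid A R\<^esub> Z)"
      unfolding *(4-6) mult[OF *(1,2)] mult[OF *(2,3)] mult[OF app[OF *(1,2)] *(3)]
        mult[OF *(1) app[OF *(2,3)]] append_assoc by (rule HOL.refl)
  next
    fix X assume "X \<in> carrier (presented_monoid A R)"
    then obtain w where w: "w \<in> lists A" "X = ?cl w" using cls by blast
    show "\<one>\<^bsub>presented_monoid A R\<^esub> \<otimes>\<^bsub>presented_monoid A R\<^esub> X = X"
      unfolding one w(2) mult[OF nil w(1)] by simp
    show "X \<otimes>\<^bsub>presented_monoid A R\<^esub> \<one>\<^bsub>presented_monoid A R\<^esub> = X"
      unfolding one w(2) mult[OF w(1) nil] by simp
  qed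
qed

lemma group_presented_monoid:
  assumes inv: "\<And>x. x \<in> A \<Longrightarrow> \<exists>y\<in>A. ([y, x], []) \<in> word_cong A R"
  shows "group (presented_monoid A R)"
proof -
  have one: "\<one>\<^bsub>presented_monoid A R\<^esub> = word_cong A R `` {[]}"
    by (simp add: presented_monoid_def)
  have car: "carrier (presented_monoid A R) = (\<lambda>w. word_cong A R `` {w}) ` lists A"
    by (auto simp: presented_monoid_def quotient_def)
  have "\<exists>v\<in>lists A. (v @ w, []) \<in> word_cong A R" if "w \<in> lists A" for w
    using that
  proof (induction w)
    case Nil
    then show ?case by (auto intro!: bexI[of _ "[]"] word_cong.refl)
  next
    case (Cons x w)
    then obtain v where v: "v \<in> lists A" "(v @ w, []) \<in> word_cong A R" by auto
    obtain y where y: "y \<in> A" "([y, x], []) \<in> word_cong A R" using inv Cons.hyps by blast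
    have "(v @ [y, x] @ w, v @ [] @ w) \<in> word_cong A R"
      using y v Cons by (intro word_cong_context) auto
    then have "((v @ [y]) @ x # w, []) \<in> word_cong A R"
      using v(2) by (auto intro: word_cong.trans)
    then show ?case using v y by (intro bexI[of _ "v @ [y]"]) auto
  qed
  note ex = this
  interpret monoid "presented_monoid A R" by (rule monoid_presented_monoid)
  show ?thesis
  proof (rule groupI)
    fix X assume "X \<in> carrier (presented_monoid A R)"
    then obtain w where w: "w \<in> lists A" "X = word_cong A R `` {w}" by (auto simp: car)
    then obtain v where v: "v \<in> lists A" "(v @ w, []) \<in> word_cong A R" using ex by blast
    have "word_cong A R `` {v} \<otimes>\<^bsub>presented_monoid A R\<^esub> X = \<one>\<^bsub>presented_monoid A R\<^esub>"
      unfolding w(2) one presented_monoid_mult[OF v(1) w(1)]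
      by (rule equiv_class_eq[OF equiv_word_cong v(2)])
    then show "\<exists>Y\<in>carrier (presented_monoid A R). Y \<otimes>\<^bsub>presented_monoid A R\<^esub> X = \<one>\<^bsub>presented_monoid A R\<^esub>"
      using v(1) by (auto simp: car)
  qed (auto simp: m_assoc)
qed


section \<open>Free groups and amalgamated free products\<close>

text \<open>The letter \<open>(s, True)\<close> stands for the generator \<open>s\<close> and \<open>(s, False)\<close> for its inverse.\<close>

definition free_group_rels :: "'s set \<Rightarrow> (('s \<times> bool) list \<times> ('s \<times> bool) list) set" where
  "free_group_rels S = {([(s, e), (s, \<not> e)], []) | s e. s \<in> S}"

definition free_group :: "'s set \<Rightarrow> ('s \<times> bool) list set monoid" where
  "free_group S = presented_monoid (S \<times> UNIV) (free_group_rels S)"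

definition free_gen :: "'s set \<Rightarrow> 's \<Rightarrow> ('s \<times> bool) list set" where
  "free_gen S s = word_cong (S \<times> UNIV) (free_group_rels S) `` {[(s, True)]}"

text \<open>
  The amalgamated free product of \<open>A\<close> and \<open>B\<close> in which each \<open>c\<close> in the subgroup \<open>C\<close> of \<open>A\<close> is
  identified with \<open>\<phi> c\<close> in \<open>B\<close>: the free product of \<open>A\<close> and \<open>B\<close> (the first four families of
  relations) modulo \<open>c = \<phi> c\<close>.
\<close>

definition amalgam_rels ::
  "('a, 'm) monoid_scheme \<Rightarrow> ('b, 'n) monoid_scheme \<Rightarrow> 'a set \<Rightarrow> ('a \<Rightarrow> 'b) \<Rightarrow>
    (('a + 'b) list \<times> ('a + 'b) list) set" where
  "amalgam_rels A B C \<phi> =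
     {([Inl x, Inl y], [Inl (x \<otimes>\<^bsub>A\<^esub> y)]) | x y. x \<in> carrier A \<and> y \<in> carrier A} \<union>
     {([Inr x, Inr y], [Inr (x \<otimes>\<^bsub>B\<^esub> y)]) | x y. x \<in> carrier B \<and> y \<in> carrier B} \<union>
     {([Inl \<one>\<^bsub>A\<^esub>], [])} \<union>
     {([Inr \<one>\<^bsub>B\<^esub>], [])} \<union>
     {([Inl c], [Inr (\<phi> c)]) | c. c \<in> C}"

definition amalgamated_product ::
  "('a, 'm) monoid_scheme \<Rightarrow> ('b, 'n) monoid_scheme \<Rightarrow> 'a set \<Rightarrow> ('a \<Rightarrow> 'b) \<Rightarrow>
    ('a + 'b) list set monoid" where
  "amalgamated_product A B C \<phi> =
     presented_monoid (carrier A <+> carrier B) (amalgam_rels A B C \<phi>)"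

lemma group_free_group: "group (free_group S)"
  unfolding free_group_def
proof (rule group_presented_monoid)
  fix x assume "x \<in> S \<times> (UNIV :: bool set)"
  then obtain s e where x: "x = (s, e)" "s \<in> S" by auto
  have "([(s, \<not> e), (s, \<not> \<not> e)], []) \<in> free_group_rels S"
    unfolding free_group_rels_def using x(2) by blast
  then have "([] @ [(s, \<not> e), (s, e)] @ [], [] @ [] @ []) \<in> word_cong (S \<times> UNIV) (free_group_rels S)"
    using x by (intro word_cong.rel) auto
  then show "\<exists>y\<in>S \<times> UNIV. ([y, x], []) \<in> word_cong (S \<times> UNIV) (free_group_rels S)"
    using x by auto
qed

lemma free_gen_closed: "s \<in> S \<Longrightarrow> free_gen S s \<in> carrier (free_group S)"
  by (auto simp: free_gen_def free_group_def presented_monoid_def intro!: quotientI)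

lemma group_amalgamated_product:
  assumes "group A" "group B"
  shows "group (amalgamated_product A B C \<phi>)"
  unfolding amalgamated_product_def
proof (rule group_presented_monoid)
  interpret A: group A by fact
  interpret B: group B by fact
  let ?L = "carrier A <+> carrier B"
  let ?R = "amalgam_rels A B C \<phi>"
  have rel: "(l, r) \<in> word_cong ?L ?R" if "(l, r) \<in> ?R" "l \<in> lists ?L" "r \<in> lists ?L" for l r
    using word_cong.rel[OF that, of "[]" "[]"] by simp
  fix x assume "x \<in> ?L"
  then consider (L) g where "g \<in> carrier A" "x = Inl g" | (R) g where "g \<in> carrier B" "x = Inr g"
    by blast
  then show "\<exists>y\<in>?L. ([y, x], []) \<in> word_cong ?L ?R"
  proof cases
    case L
    have "([Inl (inv\<^bsub>A\<^esub> g), Inl g], [Inl (inv\<^bsub>A\<^esub> g \<otimes>\<^bsub>A\<^esub> g)]) \<in> word_cong ?L ?R"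
      using L by (intro rel) (auto simp: amalgam_rels_def simp del: A.l_inv)
    moreover have "([Inl \<one>\<^bsub>A\<^esub>], []) \<in> word_cong ?L ?R"
      by (intro rel) (auto simp: amalgam_rels_def)
    ultimately have "([Inl (inv\<^bsub>A\<^esub> g), x], []) \<in> word_cong ?L ?R"
      using L by (auto intro: word_cong.trans)
    then show ?thesis using L by (intro bexI[of _ "Inl (inv\<^bsub>A\<^esub> g)"]) auto
  next
    case R
    have "([Inr (inv\<^bsub>B\<^esub> g), Inr g], [Inr (inv\<^bsub>B\<^esub> g \<otimes>\<^bsub>B\<^esub> g)]) \<in> word_cong ?L ?R"
      using R by (intro rel) (auto simp: amalgam_rels_def simp del: B.l_inv)
    moreover have "([Inr \<one>\<^bsub>B\<^esub>], []) \<in> word_cong ?L ?R"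
      by (intro rel) (auto simp: amalgam_rels_def)
    ultimately have "([Inr (inv\<^bsub>B\<^esub> g), x], []) \<in> word_cong ?L ?R"
      using R by (auto intro: word_cong.trans)
    then show ?thesis using R by (intro bexI[of _ "Inr (inv\<^bsub>B\<^esub> g)"]) auto
  qed
qed

definition commutator :: "('a, 'm) monoid_scheme \<Rightarrow> 'a \<Rightarrow> 'a \<Rightarrow> 'a" where
  "commutator G a b = a \<otimes>\<^bsub>G\<^esub> b \<otimes>\<^bsub>G\<^esub> inv\<^bsub>G\<^esub> a \<otimes>\<^bsub>G\<^esub> inv\<^bsub>G\<^esub> b"

end

theory Submission
  imports Defs
begin

text \<open>
  The proof is dynamical. A countable left-ordered group acts on the real line by increasing
  bijections so that the order can be read off the orbit of one point \<open>x0\<close>, and this orbit is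
  unbounded above (\<open>dynamical_realization\<close>). Conversely every action \<open>\<rho>'\<close> and every point give a
  left order: compare \<open>f\<close> and \<open>g\<close> by \<open>\<rho>' f x0\<close> and \<open>\<rho>' g x0\<close>, and break ties by an order that
  is already there (\<open>orbit_order\<close>). If \<open>\<rho>'\<close> agrees with the realization \<open>\<rho>\<close> of an isolated order
  on \<open>H\<close>, and on the two free generators on a ray \<open>{..K}\<close> with \<open>K\<close> large, then the finitely many
  positive elements that isolate the order stay positive (\<open>local_dependence\<close>), so the order read
  off from \<open>\<rho>'\<close> is the original one.

  Hence it is enough to change the action near \<open>+\<infinity>\<close> so much that the order must change. By the
  universal property of the amalgam, this means: let \<open>a\<close>, \<open>b\<close>, \<open>h\<close> be increasing bijections of the
  line with \<open>[a, b] = h\<close>; find \<open>a'\<close>, \<open>b'\<close> with \<open>[a', b'] = h\<close> that agree with \<open>a\<close>, \<open>b\<close> on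
  \<open>{..K}\<close>. The order sees whether a map \<open>u\<close> escapes, that is \<open>u x > x\<close> for all large \<open>x\<close>,
  because this is a statement about the powers of \<open>u\<close> being cofinal (\<open>escapes_transfer\<close>). The
  theorem \<open>flexible\<close> produces \<open>a'\<close>, \<open>b'\<close> for which one of \<open>a'\<close>, \<open>b'\<close> or their inverses escapes while
  the corresponding old map does not.

  The relation \<open>[a', b'] = h\<close> says that \<open>a'\<close> conjugates \<open>b'\<close> to \<open>h b'\<close>, and two maps that move all
  points of a ray in the same direction, fixing its end point, are conjugate there. So \<open>b'\<close> can be
  prescribed far out as long as \<open>b'\<close> and \<open>h b'\<close> move points in the same pattern of directions, and
  \<open>a'\<close> is then found as a conjugacy. There are two cases.

    \<^item> If \<open>b\<close> escapes, let \<open>b'\<close> follow \<open>b\<close> for a while and then cross the graphs of the identity and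
      of \<open>h\<inverse>\<close> exactly once each, downwards (\<open>crossing\<close>). Far out, \<open>b'\<close> and \<open>h b'\<close> then both move
      points up, have one fixed point, and move points down afterwards. The inverse of \<open>b'\<close> escapes,
      that of \<open>b\<close> does not.
      The substitution \<open>(a, b) \<mapsto> (a b a\<inverse>, a\<inverse>)\<close> preserves the commutator and reduces to this the
      cases where one of \<open>b\<inverse>\<close>, \<open>a\<close>, \<open>a\<inverse>\<close> escapes.

    \<^item> Otherwise \<open>a\<close> and \<open>b\<close> have arbitrarily large fixed points. Take a fixed point \<open>q\<close> of \<open>a\<close>, and the
      last fixed point \<open>p \<le> q\<close> of \<open>b\<close>. On \<open>{p<..q}\<close> the map \<open>b\<close> moves points in one direction only, and
      after \<open>q\<close> the map \<open>b'\<close> is made to continue in that direction, so strongly that \<open>h b'\<close> does the same.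

  In both cases a common fixed point of \<open>a'\<close> and \<open>b'\<close> was one of \<open>a\<close> and \<open>b\<close>, so the new orbit of
  \<open>x0\<close> is unbounded above as well. Finally, \<open>h\<close> must act non-trivially far out, which needs
  that \<open>h\<close> survives in the amalgam: every element of a group becomes a commutator in a larger group.
\<close>


section \<open>Homeomorphisms of the line\<close>

definition line_homeo :: "(real \<Rightarrow> real) \<Rightarrow> bool" where
  "line_homeo f \<longleftrightarrow> strict_mono f \<and> surj f"

text \<open>
  The inverse homeomorphism, as a constant of its own so that \<open>inv\<close> can denote group inverses.
\<close>
definition bwd :: "(real \<Rightarrow> real) \<Rightarrow> real \<Rightarrow> real" where
  "bwd f = inv_into UNIV f"

lemma line_homeoI:
  assumes "\<And>x y. x < y \<Longrightarrow> f x < f y" and "\<And>y. \<exists>x. f x = y"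
  shows "line_homeo f"
  unfolding line_homeo_def strict_mono_def using assms by (metis surjI)

lemma homeo_less: "line_homeo f \<Longrightarrow> f x < f y \<longleftrightarrow> x < y"
  by (simp add: line_homeo_def strict_mono_less)

lemma homeo_le: "line_homeo f \<Longrightarrow> f x \<le> f y \<longleftrightarrow> x \<le> y"
  by (simp add: line_homeo_def strict_mono_less_eq)

lemma homeo_eq: "line_homeo f \<Longrightarrow> f x = f y \<longleftrightarrow> x = y"
  by (simp add: line_homeo_def strict_mono_eq)

lemma homeo_bwd: "line_homeo f \<Longrightarrow> f (bwd f x) = x"
  by (simp add: line_homeo_def bwd_def surj_f_inv_f)

lemma bwd_homeo: "line_homeo f \<Longrightarrow> bwd f (f x) = x"
  by (metis homeo_bwd homeo_eq)

lemma bwd_less: "line_homeo f \<Longrightarrow> bwd f x < y \<longleftrightarrow> x < f y"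
  by (metis homeo_bwd homeo_less)

lemma less_bwd: "line_homeo f \<Longrightarrow> x < bwd f y \<longleftrightarrow> f x < y"
  by (metis homeo_bwd homeo_less)

lemma bwd_le: "line_homeo f \<Longrightarrow> bwd f x \<le> y \<longleftrightarrow> x \<le> f y"
  by (metis homeo_bwd homeo_le)

lemma le_bwd: "line_homeo f \<Longrightarrow> x \<le> bwd f y \<longleftrightarrow> f x \<le> y"
  by (metis homeo_bwd homeo_le)

lemma bwd_eq_iff: "line_homeo f \<Longrightarrow> bwd f x = y \<longleftrightarrow> x = f y"
  by (metis homeo_bwd bwd_homeo)

lemma line_homeo_bwd: assumes f: "line_homeo f" shows "line_homeo (bwd f)"
proof (rule line_homeoI)
  show "bwd f x < bwd f y" if "x < y" for x y
    using that by (simp add: bwd_less[OF f] homeo_bwd[OF f])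
  show "\<exists>x. bwd f x = y" for y using bwd_homeo[OF f] by blast
qed

lemma bwd_bwd: assumes f: "line_homeo f" shows "bwd (bwd f) = f"
  by (rule ext) (simp add: bwd_eq_iff[OF line_homeo_bwd[OF f]] bwd_homeo[OF f])

lemma line_homeo_comp:
  assumes f: "line_homeo f" and g: "line_homeo g" shows "line_homeo (\<lambda>x. f (g x))"
proof (rule line_homeoI)
  show "\<exists>x. f (g x) = y" for y
    by (rule exI[of _ "bwd g (bwd f y)"]) (simp add: homeo_bwd[OF f] homeo_bwd[OF g])
qed (simp add: homeo_less[OF f] homeo_less[OF g])

lemma line_homeo_id: "line_homeo (\<lambda>x. x)"
  by (rule line_homeoI) auto

lemma line_homeo_scaled:
  assumes f: "line_homeo f" and k: "0 < k" shows "line_homeo (\<lambda>x. c + k * f x)"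
proof (rule line_homeoI)
  show "\<exists>x. c + k * f x = y" for y
    using k by (intro exI[of _ "bwd f ((y - c) / k)"]) (simp add: homeo_bwd[OF f])
qed (use k in \<open>simp add: homeo_less[OF f]\<close>)

lemma line_homeo_max:
  assumes f: "line_homeo f" and g: "line_homeo g" shows "line_homeo (\<lambda>x. max (f x) (g x))"
proof (rule line_homeoI)
  show "\<exists>x. max (f x) (g x) = y" for y
  proof (cases "bwd f y \<le> bwd g y")
    case True
    then have "g (bwd f y) \<le> y" by (simp add: le_bwd[OF g])
    then show ?thesis by (intro exI[of _ "bwd f y"]) (simp add: homeo_bwd[OF f])
  next
    case False
    then have "f (bwd g y) \<le> y" by (simp add: not_le less_bwd[OF f])
    then show ?thesis by (intro exI[of _ "bwd g y"]) (simp add: homeo_bwd[OF g])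
  qed
  show "max (f x) (g x) < max (f y) (g y)" if "x < y" for x y
  proof -
    have "f x < f y" "g x < g y" using that by (simp_all add: homeo_less[OF f] homeo_less[OF g])
    then show ?thesis by (auto simp: max_def)
  qed
qed

lemma line_homeo_min:
  assumes f: "line_homeo f" and g: "line_homeo g" shows "line_homeo (\<lambda>x. min (f x) (g x))"
proof (rule line_homeoI)
  show "\<exists>x. min (f x) (g x) = y" for y
  proof (cases "bwd f y \<le> bwd g y")
    case True
    then have "y \<le> f (bwd g y)" by (simp add: bwd_le[OF f])
    then show ?thesis by (intro exI[of _ "bwd g y"]) (simp add: homeo_bwd[OF g])
  next
    case False
    then have "y \<le> g (bwd f y)" by (simp add: not_le bwd_less[OF g])
    then show ?thesis by (intro exI[of _ "bwd f y"]) (simp add: homeo_bwd[OF f])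
  qed
  show "min (f x) (g x) < min (f y) (g y)" if "x < y" for x y
  proof -
    have "f x < f y" "g x < g y" using that by (simp_all add: homeo_less[OF f] homeo_less[OF g])
    then show ?thesis by (auto simp: min_def)
  qed
qed

lemma line_homeo_glue:
  assumes f: "line_homeo f" and g: "line_homeo g" and eq: "f p = g p"
  shows "line_homeo (\<lambda>x. if x \<le> p then f x else g x)"
proof (rule line_homeoI)
  show "(if x \<le> p then f x else g x) < (if y \<le> p then f y else g y)" if "x < y" for x y
  proof -
    have "f x < f y" "g x < g y" using that by (simp_all add: homeo_less[OF f] homeo_less[OF g])
    moreover have "f x \<le> f p" if "x \<le> p" using that by (simp add: homeo_le[OF f])
    moreover have "g p < g y" if "p < y" using that by (simp add: homeo_less[OF g])
    ultimately show ?thesis using \<open>x < y\<close> eq by auto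
  qed
  show "\<exists>x. (if x \<le> p then f x else g x) = y" for y
  proof (cases "y \<le> f p")
    case True
    then show ?thesis by (intro exI[of _ "bwd f y"]) (simp add: bwd_le[OF f] homeo_bwd[OF f])
  next
    case False
    then have "\<not> bwd g y \<le> p" using eq by (simp add: bwd_le[OF g])
    then show ?thesis by (intro exI[of _ "bwd g y"]) (simp add: homeo_bwd[OF g])
  qed
qed

lemma line_homeo_funpow: assumes f: "line_homeo f" shows "line_homeo (f ^^ n)"
proof (induction n)
  case 0 then show ?case using line_homeo_id by (simp add: id_def)
next
  case (Suc n) then show ?case using line_homeo_comp[OF f Suc] by (simp add: comp_def)
qed

text \<open>
  The largest point that is not moved down is fixed: the argument of Knaster and Tarski, which needs
  only that \<open>f\<close> is increasing.
\<close>
lemma fixed_point_between: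
  assumes f: "line_homeo f" and "x \<le> y" and "x \<le> f x" and "f y \<le> y"
  shows "\<exists>z. x \<le> z \<and> z \<le> y \<and> f z = z"
proof -
  define A where "A = {t. x \<le> t \<and> t \<le> y \<and> t \<le> f t}"
  have bdd: "bdd_above A" by (auto simp: A_def)
  have "x \<in> A" using assms by (simp add: A_def)
  define z where "z = Sup A"
  have xz: "x \<le> z" unfolding z_def by (rule cSup_upper[OF \<open>x \<in> A\<close> bdd])
  have zy: "z \<le> y" unfolding z_def using \<open>x \<in> A\<close> by (intro cSup_least) (auto simp: A_def)
  have "z \<le> f z"
    unfolding z_def
  proof (rule cSup_least)
    show "t \<le> f (Sup A)" if "t \<in> A" for t
    proof -
      have "f t \<le> f (Sup A)" using cSup_upper[OF that bdd] by (simp add: homeo_le[OF f])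
      then show ?thesis using that by (simp add: A_def)
    qed
  qed (use \<open>x \<in> A\<close> in auto)
  moreover have "f z \<in> A"
  proof -
    have "f z \<le> f y" using zy by (simp add: homeo_le[OF f])
    then have "f z \<le> y" using assms(4) by linarith
    then show ?thesis using xz \<open>z \<le> f z\<close> by (auto simp: A_def homeo_le[OF f])
  qed
  then have "f z \<le> z" unfolding z_def by (rule cSup_upper[OF _ bdd])
  ultimately show ?thesis using xz zy by (intro exI[of _ z]) simp
qed

lemma fixed_point_between':
  assumes f: "line_homeo f" and "x \<le> y" and "f x \<le> x" and "y \<le> f y"
  shows "\<exists>z. x \<le> z \<and> z \<le> y \<and> f z = z"
proof -
  have "\<exists>z. x \<le> z \<and> z \<le> y \<and> bwd f z = z"
    using assms by (intro fixed_point_between line_homeo_bwd) (simp_all add: bwd_le[OF f] le_bwd[OF f])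
  then show ?thesis by (metis bwd_eq_iff[OF f])
qed

text \<open>
  If the orbit stayed bounded, its supremum would be a fixed point.
\<close>
lemma orbit_passes:
  assumes f: "line_homeo f" and up: "\<And>x. p \<le> x \<Longrightarrow> x < r \<Longrightarrow> x < f x" and "y < r"
  shows "\<exists>n. y < (f ^^ n) p"
proof (rule ccontr)
  assume "\<not> ?thesis"
  then have le: "(f ^^ n) p \<le> y" for n by (simp add: not_less)
  define A where "A = range (\<lambda>n. (f ^^ n) p)"
  have bdd: "bdd_above A" unfolding A_def by (rule bdd_aboveI2[OF le])
  have mem: "(f ^^ n) p \<in> A" for n by (auto simp: A_def)
  have s1: "p \<le> Sup A" using cSup_upper[OF mem[of 0] bdd] by simp
  have s2: "Sup A \<le> y" using le by (auto simp: A_def intro!: cSup_least)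
  have "Sup A < f (Sup A)" using up s1 s2 assms(3) by simp
  then have "bwd f (Sup A) < Sup A" by (simp add: bwd_less[OF f])
  then obtain n where "bwd f (Sup A) < (f ^^ n) p"
    using less_cSupD[of A] by (auto simp: A_def)
  then have "Sup A < (f ^^ Suc n) p" by (simp add: bwd_less[OF f])
  then show False using cSup_upper[OF mem[of "Suc n"] bdd] by simp
qed

lemma funpow_bwd:
  assumes f: "line_homeo f"
  shows "(bwd f ^^ n) ((f ^^ n) x) = x" and "(f ^^ n) ((bwd f ^^ n) x) = x"
proof -
  show "(bwd f ^^ n) ((f ^^ n) x) = x"
  proof (induction n)
    case (Suc n)
    have "(bwd f ^^ Suc n) ((f ^^ Suc n) x) = (bwd f ^^ n) (bwd f (f ((f ^^ n) x)))"
      by (simp only: funpow_Suc_right[of n "bwd f"] funpow.simps(2)[of n f] comp_def)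
    then show ?case using Suc by (simp only: bwd_homeo[OF f])
  qed simp
  show "(f ^^ n) ((bwd f ^^ n) x) = x"
  proof (induction n)
    case (Suc n)
    have "(f ^^ Suc n) ((bwd f ^^ Suc n) x) = (f ^^ n) (f (bwd f ((bwd f ^^ n) x)))"
      by (simp only: funpow_Suc_right[of n f] funpow.simps(2)[of n "bwd f"] comp_def)
    then show ?case using Suc by (simp only: homeo_bwd[OF f])
  qed simp
qed

section \<open>Conjugacies and crossings\<close>

text \<open>
  Suppose \<open>a\<close> conjugates \<open>f\<close> to \<open>g\<close> on the ray \<open>{..p}\<close>, after which both maps move points up until they
  reach their fixed points \<open>r\<close> and \<open>s\<close>. The only candidate for a conjugacy on \<open>{..<r}\<close> that agrees
  with \<open>a\<close> on \<open>{..p}\<close> is the limit of the maps \<open>g\<^sup>n a f\<^sup>-\<^sup>n\<close>. The limit exists because \<open>f\<^sup>-\<^sup>n\<close> moves each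
  point below \<open>r\<close> into \<open>{..p}\<close>, after which the sequence is constant.
\<close>
lemma extend_conjugacy:
  assumes f: "line_homeo f" and g: "line_homeo g" and a: "line_homeo a"
    and rel: "\<And>x. x \<le> p \<Longrightarrow> a (f x) = g (a x)"
    and fup: "\<And>x. p \<le> x \<Longrightarrow> x < r \<Longrightarrow> x < f x" and gup: "\<And>x. a p \<le> x \<Longrightarrow> x < s \<Longrightarrow> x < g x"
    and pr: "p < r" and ps: "a p < s" and fr: "f r = r" and gs: "g s = s"
  shows "\<exists>c. strict_mono_on {..<r} c \<and> c ` {..<r} = {..<s} \<and> (\<forall>x<r. c (f x) = g (c x)) \<and>
    (\<forall>x\<le>p. c x = a x)"
proof -
  define an where "an n x = (g ^^ n) (a ((bwd f ^^ n) x))" for n x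
  have fn: "line_homeo (f ^^ n)" and gn: "line_homeo (g ^^ n)" and bfn: "line_homeo (bwd f ^^ n)" for n
    by (rule line_homeo_funpow f g line_homeo_bwd[OF f])+
  have an_homeo: "line_homeo (an n)" for n
    unfolding an_def by (rule line_homeo_comp[OF gn line_homeo_comp[OF a bfn]])
  note cancel = funpow_bwd[OF f]
  have back_le: "(bwd f ^^ n) x \<le> p \<longleftrightarrow> x \<le> (f ^^ n) p" for n x
    using homeo_le[OF fn[of n], of "(bwd f ^^ n) x" p] by (simp add: cancel)
  have fnr: "(f ^^ n) r = r" for n by (induction n) (simp_all add: fr)
  have gns: "(g ^^ n) s = s" for n by (induction n) (simp_all add: gs)
  have incr: "(f ^^ n) p \<le> (f ^^ Suc n) p" for n
  proof -
    have "(f ^^ n) p < (f ^^ n) (f p)" using fup[of p] pr by (simp add: homeo_less[OF fn])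
    then show ?thesis by (simp add: funpow_swap1)
  qed
  have mono_orbit: "(f ^^ m) p \<le> (f ^^ n) p" if "m \<le> n" for m n
    using lift_Suc_mono_le[of "\<lambda>n. (f ^^ n) p", OF incr that] .
  have step: "an (Suc n) x = an n x" if "x \<le> (f ^^ Suc n) p" for n x
  proof -
    define y where "y = (bwd f ^^ Suc n) x"
    have "y \<le> p" unfolding y_def using that by (simp only: back_le)
    moreover have "(bwd f ^^ n) x = f y" unfolding y_def by (simp add: homeo_bwd[OF f])
    ultimately show ?thesis
      unfolding an_def y_def[symmetric] using rel[of y] by (simp add: funpow_swap1)
  qed
  have stable: "an n x = an m x" if x: "x \<le> (f ^^ Suc m) p" and "m \<le> n" for m n x
    using that(2)
  proof (induction n rule: dec_induct)
    case (step k)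
    have "x \<le> (f ^^ Suc k) p" using x mono_orbit[of "Suc m" "Suc k"] step(1) by simp
    then show ?case using \<open>\<And>n x. x \<le> (f ^^ Suc n) p \<Longrightarrow> an (Suc n) x = an n x\<close> step.IH by simp
  qed simp
  define N where "N x = (LEAST n. x < (f ^^ n) p)" for x
  have N: "x < (f ^^ N x) p" if "x < r" for x
    unfolding N_def by (rule LeastI_ex, rule orbit_passes[OF f fup that])
  define c where "c x = an (N x) x" for x
  have c_eq: "c x = an n x" if "x < r" "x \<le> (f ^^ n) p" for n x
  proof -
    have 1: "x \<le> (f ^^ Suc n) p" using that(2) incr[of n] by linarith
    have 2: "x \<le> (f ^^ Suc (N x)) p" using N[OF that(1)] incr[of "N x"] by linarith
    show ?thesis unfolding c_def
      using stable[OF 1, of "max n (N x)"] stable[OF 2, of "max n (N x)"] by simp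
  qed
  have c_common: "\<exists>n. c x = an n x \<and> c y = an n y \<and> x \<le> (f ^^ n) p" if "x < r" "y < r" for x y
  proof -
    have "x \<le> (f ^^ max (N x) (N y)) p" "y \<le> (f ^^ max (N x) (N y)) p"
      using N[OF that(1)] N[OF that(2)]
        mono_orbit[of "N x" "max (N x) (N y)"] mono_orbit[of "N y" "max (N x) (N y)"] by simp_all
    then show ?thesis using c_eq that by blast
  qed
  have mono: "c x < c y" if "x < y" "y < r" for x y
  proof -
    have "x < r" using that by linarith
    then obtain n where "c x = an n x" "c y = an n y" using c_common[of x y] \<open>y < r\<close> by auto
    then show ?thesis using that homeo_less[OF an_homeo] by simp
  qed
  have into: "c x < s" if "x < r" for x
  proof -
    obtain n where n: "c x = an n x" "x \<le> (f ^^ n) p" using c_common[OF \<open>x < r\<close> \<open>x < r\<close>] by auto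
    have "(bwd f ^^ n) x \<le> p" using n(2) by (simp only: back_le)
    then have "a ((bwd f ^^ n) x) \<le> a p" by (simp add: homeo_le[OF a])
    then have "a ((bwd f ^^ n) x) < s" using ps by linarith
    then have "an n x < (g ^^ n) s" unfolding an_def by (simp add: homeo_less[OF gn])
    then show ?thesis using n gns by simp
  qed
  have onto: "\<exists>x<r. c x = y" if "y < s" for y
  proof -
    obtain n where n: "y < (g ^^ n) (a p)" using orbit_passes[OF g gup \<open>y < s\<close>] by blast
    define x where "x = bwd (an n) y"
    have x: "an n x = y" unfolding x_def by (rule homeo_bwd[OF an_homeo])
    have "an n ((f ^^ n) p) = (g ^^ n) (a p)" unfolding an_def by (simp add: cancel)
    then have "an n x < an n ((f ^^ n) p)" using x n by simp
    then have 1: "x < (f ^^ n) p" by (simp add: homeo_less[OF an_homeo])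
    have "(f ^^ n) p < (f ^^ n) r" using pr by (simp add: homeo_less[OF fn])
    then have "(f ^^ n) p < r" using fnr by simp
    then show ?thesis using c_eq[of x n] x 1 by (intro exI[of _ x]) auto
  qed
  have conj: "c (f x) = g (c x)" if "x < r" for x
  proof -
    obtain n where n: "c x = an n x" "x \<le> (f ^^ n) p" using c_common[OF \<open>x < r\<close> \<open>x < r\<close>] by auto
    have "f x < f r" using that by (simp add: homeo_less[OF f])
    then have fx: "f x < r" using fr by simp
    have "f x \<le> (f ^^ Suc n) p" using n(2) by (simp add: homeo_le[OF f])
    from c_eq[OF fx this] have "c (f x) = an (Suc n) (f x)" .
    also have "\<dots> = g (an n x)" 
      unfolding an_def by (simp only: funpow_Suc_right comp_def bwd_homeo[OF f]) (simp add: funpow_swap1)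
    finally show ?thesis using n by simp
  qed
  show ?thesis
  proof (intro exI[of _ c] conjI)
    show "strict_mono_on {..<r} c" using mono by (auto intro!: strict_mono_onI)
    show "c ` {..<r} = {..<s}" using into onto by force
    show "\<forall>x<r. c (f x) = g (c x)" using conj by blast
    show "\<forall>x\<le>p. c x = a x" using c_eq[of _ 0] pr by (auto simp: an_def)
  qed
qed

definition int_iterate :: "(real \<Rightarrow> real) \<Rightarrow> int \<Rightarrow> real \<Rightarrow> real" where
  "int_iterate f n = (if 0 \<le> n then f ^^ nat n else bwd f ^^ nat (- n))"

lemma line_homeo_int_iterate: "line_homeo f \<Longrightarrow> line_homeo (int_iterate f n)"
  by (simp add: int_iterate_def line_homeo_funpow line_homeo_bwd)

lemma int_iterate_add1:
  assumes f: "line_homeo f"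
  shows "int_iterate f (n + 1) x = f (int_iterate f n x)" and "int_iterate f n (f x) = int_iterate f (n + 1) x"
proof -
  consider "0 \<le> n" "nat (n + 1) = Suc (nat n)" | "n = - 1" | "n < 0" "n + 1 < 0" "nat (- n) = Suc (nat (- (n + 1)))"
    by linarith
  then have "int_iterate f (n + 1) x = f (int_iterate f n x) \<and> int_iterate f n (f x) = int_iterate f (n + 1) x"
  proof cases
    case 1 then show ?thesis by (simp add: int_iterate_def funpow_swap1)
  next
    case 2 then show ?thesis by (simp add: int_iterate_def homeo_bwd[OF f] bwd_homeo[OF f])
  next
    case 3
    let ?k = "nat (- (n + 1))"
    have n: "int_iterate f n = bwd f ^^ Suc ?k" and n1: "int_iterate f (n + 1) = bwd f ^^ ?k"
      using 3 by (simp_all only: int_iterate_def) simp_all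
    have "f (int_iterate f n x) = int_iterate f (n + 1) x"
      unfolding n n1 by (simp only: funpow.simps comp_def homeo_bwd[OF f])
    moreover have "int_iterate f n (f x) = int_iterate f (n + 1) x"
      unfolding n n1 by (simp only: funpow_Suc_right comp_def bwd_homeo[OF f])
    ultimately show ?thesis by simp
  qed
  then show "int_iterate f (n + 1) x = f (int_iterate f n x)" "int_iterate f n (f x) = int_iterate f (n + 1) x" by auto
qed

text \<open>
  A map that moves all points of \<open>{p<..}\<close> up is there a translation in a suitable coordinate \<open>\<tau>\<close>:
  choose \<open>\<tau>\<close> affine on \<open>[0, 1)\<close>, onto the fundamental domain between a point \<open>q\<close> and \<open>f q\<close>, and
  continue it by equivariance.
\<close>
lemma translation_coordinate:
  assumes f: "line_homeo f" and fp: "f p = p" and up: "\<And>x. p < x \<Longrightarrow> x < f x"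
  shows "\<exists>\<tau> :: real \<Rightarrow> real. strict_mono \<tau> \<and> range \<tau> = {p<..} \<and> (\<forall>s. \<tau> (s + 1) = f (\<tau> s))"
proof -
  define q where "q = p + 1"
  define d where "d = f q - q"
  have d: "0 < d" using up[of q] by (simp add: d_def q_def)
  define \<tau> where "\<tau> s = int_iterate f \<lfloor>s\<rfloor> (q + frac s * d)" for s
  note z = line_homeo_int_iterate[OF f]
  have step: "\<tau> (s + 1) = f (\<tau> s)" for s
    unfolding \<tau>_def using int_iterate_add1(1)[OF f, of "\<lfloor>s\<rfloor>"] by (simp add: frac_def)
  have lower: "int_iterate f \<lfloor>s\<rfloor> q \<le> \<tau> s" for s
    unfolding \<tau>_def using d frac_ge_0[of s] by (simp add: homeo_le[OF z])
  have upper: "\<tau> s < int_iterate f (\<lfloor>s\<rfloor> + 1) q" for s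
  proof -
    have "frac s * d < 1 * d" using d frac_lt_1[of s] by (intro mult_strict_right_mono)
    then have "q + frac s * d < f q" by (simp add: d_def)
    then show ?thesis unfolding \<tau>_def int_iterate_add1(2)[OF f, symmetric] by (simp add: homeo_less[OF z])
  qed
  have orbit_mono: "int_iterate f m q \<le> int_iterate f n q" if "m \<le> n" for m n
    using that
  proof (induction n rule: int_ge_induct)
    case (step n)
    have "int_iterate f n q \<le> int_iterate f n (f q)" using d by (simp add: homeo_le[OF z] d_def)
    then show ?case using step.IH by (simp add: int_iterate_add1(2)[OF f])
  qed simp
  have mono: "\<tau> s < \<tau> t" if "s < t" for s t
  proof (cases "\<lfloor>s\<rfloor> = \<lfloor>t\<rfloor>")
    case True
    then have "frac s < frac t" using that by (simp add: frac_def)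
    then show ?thesis unfolding \<tau>_def using True d by (simp add: homeo_less[OF z])
  next
    case False
    then have "\<lfloor>s\<rfloor> + 1 \<le> \<lfloor>t\<rfloor>" using that by linarith
    then show ?thesis using upper[of s] orbit_mono[of "\<lfloor>s\<rfloor> + 1" "\<lfloor>t\<rfloor>"] lower[of t] by linarith
  qed
  have zp: "(bwd f ^^ n) p = p" "(f ^^ n) p = p" for n
  proof -
    have "bwd f p = p" using fp by (simp add: bwd_eq_iff[OF f])
    then show "(bwd f ^^ n) p = p" by (induction n) simp_all
    show "(f ^^ n) p = p" using fp by (induction n) simp_all
  qed
  have above: "p < \<tau> s" for s
  proof -
    have "p < q + frac s * d" using d frac_ge_0[of s] by (simp add: q_def add_pos_nonneg)
    then have "int_iterate f \<lfloor>s\<rfloor> p < \<tau> s" unfolding \<tau>_def by (simp add: homeo_less[OF z])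
    then show ?thesis using zp by (simp add: int_iterate_def split: if_splits)
  qed
  have onto: "\<exists>s. \<tau> s = y" if "p < y" for y
  proof -
    have "\<exists>k. q < (f ^^ k) y"
      by (rule orbit_passes[OF f, of y "q + 1"]) (use up that in auto)
    then obtain k where k: "q < (f ^^ k) y" by blast
    have fk: "line_homeo (f ^^ k)" by (rule line_homeo_funpow[OF f])
    have "(f ^^ k) ((bwd f ^^ k) q) < (f ^^ k) y" using k by (simp only: funpow_bwd[OF f])
    then have "(bwd f ^^ k) q < y" by (simp add: homeo_less[OF fk])
    then have k: "int_iterate f (- int k) q < y" by (cases "k = 0") (simp_all add: int_iterate_def)
    have "\<exists>l. y < (f ^^ l) q"
      by (rule orbit_passes[OF f, of q "y + 1"]) (use up q_def in auto)
    then obtain l where "y < (f ^^ l) q" by blast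
    then have l: "y < int_iterate f (int (k + l) - int k) q" by (simp add: int_iterate_def)
    define j where "j = (LEAST j. y < int_iterate f (int j - int k) q)"
    have j: "y < int_iterate f (int j - int k) q" unfolding j_def
      using LeastI[of "\<lambda>j. y < int_iterate f (int j - int k) q" "k + l"] l by simp
    then have "j \<noteq> 0" using k by (intro notI) simp
    then obtain i where i: "j = Suc i" by (cases j) auto
    define n where "n = int i - int k"
    have "\<not> y < int_iterate f n q" unfolding n_def using not_less_Least[of i "\<lambda>j. y < int_iterate f (int j - int k) q"] i
      by (simp add: j_def)
    then have n1: "int_iterate f n q \<le> y" by simp
    have n2: "y < int_iterate f (n + 1) q" using j i by (simp add: n_def algebra_simps)
    define t where "t = bwd (int_iterate f n) y"
    have t: "int_iterate f n t = y" unfolding t_def by (rule homeo_bwd[OF z])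
    have t1: "q \<le> t" using n1 by (simp add: t_def le_bwd[OF z])
    have t2: "t < f q" using n2 by (simp add: t_def bwd_less[OF z] int_iterate_add1(2)[OF f])
    define s where "s = of_int n + (t - q) / d"
    have u: "0 \<le> (t - q) / d" "(t - q) / d < 1" using t1 t2 d by (simp_all add: d_def)
    have "\<lfloor>s\<rfloor> = n" unfolding s_def using u by (intro floor_unique) simp_all
    moreover have "frac s * d = t - q" using \<open>\<lfloor>s\<rfloor> = n\<close> d by (simp add: frac_def s_def)
    ultimately show ?thesis by (intro exI[of _ s]) (simp add: \<tau>_def t)
  qed
  show ?thesis
  proof (intro exI[of _ \<tau>] conjI allI step)
    show "strict_mono \<tau>" using mono by (rule strict_monoI)
    show "range \<tau> = {p<..}" using above onto by force
  qed
qed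

text \<open>
  Both maps are conjugate to the translation by one.
\<close>
lemma conjugate_rays_up:
  assumes f: "line_homeo f" and fp: "f p = p" and fup: "\<And>x. p < x \<Longrightarrow> x < f x"
    and g: "line_homeo g" and gq: "g q = q" and gup: "\<And>x. q < x \<Longrightarrow> x < g x"
  shows "\<exists>c. strict_mono_on {p<..} c \<and> c ` {p<..} = {q<..} \<and> (\<forall>x>p. c (f x) = g (c x))"
proof -
  obtain \<sigma> :: "real \<Rightarrow> real" where \<sigma>: "strict_mono \<sigma>" "range \<sigma> = {p<..}" "\<And>s. \<sigma> (s + 1) = f (\<sigma> s)"
    using translation_coordinate[OF f fp fup] by blast
  obtain \<tau> :: "real \<Rightarrow> real" where \<tau>: "strict_mono \<tau>" "range \<tau> = {q<..}" "\<And>s. \<tau> (s + 1) = g (\<tau> s)"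
    using translation_coordinate[OF g gq gup] by blast
  define c where "c x = \<tau> (inv_into UNIV \<sigma> x)" for x
  have c: "c (\<sigma> s) = \<tau> s" for s
    unfolding c_def using \<sigma>(1) by (simp add: strict_mono_imp_inj_on)
  have ex: "\<exists>s. x = \<sigma> s" if "p < x" for x using \<sigma>(2) that by (metis greaterThan_iff imageE)
  show ?thesis
  proof (intro exI[of _ c] conjI allI impI)
    show "strict_mono_on {p<..} c"
    proof (rule strict_mono_onI)
      fix x y assume "x \<in> {p<..}" "y \<in> {p<..}" "x < y"
      then obtain s t where "x = \<sigma> s" "y = \<sigma> t" using ex by (metis greaterThan_iff)
      then show "c x < c y" using \<open>x < y\<close> \<sigma>(1) \<tau>(1) by (simp add: c strict_mono_less)
    qed
    show "c ` {p<..} = {q<..}" unfolding \<sigma>(2)[symmetric] \<tau>(2)[symmetric] image_image c ..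
    show "c (f x) = g (c x)" if "p < x" for x
      using ex[OF that] \<sigma>(3)[symmetric] \<tau>(3)[symmetric] by (auto simp: c)
  qed
qed

lemma conjugate_rays_down:
  assumes f: "line_homeo f" and fp: "f p = p" and fdn: "\<And>x. p < x \<Longrightarrow> f x < x"
    and g: "line_homeo g" and gq: "g q = q" and gdn: "\<And>x. q < x \<Longrightarrow> g x < x"
  shows "\<exists>c. strict_mono_on {p<..} c \<and> c ` {p<..} = {q<..} \<and> (\<forall>x>p. c (f x) = g (c x))"
proof -
  have "\<exists>c. strict_mono_on {p<..} c \<and> c ` {p<..} = {q<..} \<and> (\<forall>x>p. c (bwd f x) = bwd g (c x))"
    using assms by (intro conjugate_rays_up line_homeo_bwd) (simp_all add: bwd_eq_iff less_bwd)
  then obtain c where c: "strict_mono_on {p<..} c" "c ` {p<..} = {q<..}"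
    "\<And>x. x > p \<Longrightarrow> c (bwd f x) = bwd g (c x)" by blast
  have "c (f x) = g (c x)" if "p < x" for x
  proof -
    have "f p < f x" using that by (simp add: homeo_less[OF f])
    then have "c x = bwd g (c (f x))" using c(3)[of "f x"] fp by (simp add: bwd_homeo[OF f])
    then show ?thesis by (simp add: homeo_bwd[OF g])
  qed
  then show ?thesis using c by blast
qed

lemma line_homeo_rays:
  assumes "strict_mono_on {..<r} c" "c ` {..<r} = {..<s}"
    and "strict_mono_on {r<..} d" "d ` {r<..} = {s<..}"
  shows "line_homeo (\<lambda>x. if x < r then c x else if x = r then s else d x)" (is "line_homeo ?e")
proof (rule line_homeoI)
  have c: "c x < s" if "x < r" for x using assms(2) that by blast
  have d: "s < d x" if "r < x" for x using assms(4) that by blast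
  show "?e x < ?e y" if "x < y" for x y
  proof -
    have "c x < c y" if "y < r" using assms(1) that \<open>x < y\<close> by (intro strict_mono_onD[of _ c]) auto
    moreover have "d x < d y" if "r < x" using assms(3) that \<open>x < y\<close> by (intro strict_mono_onD[of _ d]) auto
    ultimately show ?thesis using c[of x] d[of y] that by auto
  qed
  show "\<exists>x. ?e x = y" for y
  proof -
    consider "y < s" | "y = s" | "s < y" by linarith
    then show ?thesis
    proof cases
      case 1
      then obtain x where "x < r" "c x = y" using assms(2) by (metis imageE lessThan_iff)
      then show ?thesis by (intro exI[of _ x]) simp
    next
      case 2 then show ?thesis by (intro exI[of _ r]) simp
    next
      case 3
      then obtain x where "r < x" "d x = y" using assms(4) by (metis imageE greaterThan_iff)
      then show ?thesis by (intro exI[of _ x]) simp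
    qed
  qed
qed

text \<open>
  The map \<open>f\<close> has to start as \<open>f0\<close>, above the identity and above \<open>k = h\<inverse>\<close>, and then cross both
  graphs downwards once each. The difficulty is that \<open>k\<close> is arbitrary. At a point \<open>r\<close> with
  \<open>r < h r\<close> the graph of \<open>k\<close> is strictly below the diagonal, so that \<open>f\<close> can first cross the diagonal at
  \<open>r\<close> and then cross \<open>k\<close> at \<open>r2 = h s\<close>, where \<open>s\<close> lies between \<open>r\<close> and \<open>h r\<close>. Each piece of \<open>f\<close> is an
  average of a constant with a function whose graph must not be crossed on that piece; this puts
  it on the correct side of that graph.
\<close>
lemma crossing_at_expanded_point:
  assumes f0: "line_homeo f0" and h: "line_homeo h"
    and v1: "v < f0 v" and v2: "v < h (f0 v)" and r: "f0 v < r" and hr: "r < h r"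
  shows "\<exists>f r2. line_homeo f \<and> (\<forall>x\<le>v. f x = f0 x) \<and> r < r2 \<and> f r = r \<and> h (f r2) = r2 \<and>
    (\<forall>x. v \<le> x \<and> x < r \<longrightarrow> x < f x) \<and> (\<forall>x>r. f x < x) \<and>
    (\<forall>x. v \<le> x \<and> x < r2 \<longrightarrow> x < h (f x)) \<and> (\<forall>x>r2. h (f x) < x)"
proof -
  define k where "k = bwd h"
  have k: "line_homeo k" unfolding k_def by (rule line_homeo_bwd[OF h])
  have gt_k: "x < h y \<longleftrightarrow> k x < y" and lt_k: "h y < x \<longleftrightarrow> y < k x" for x y
    by (simp_all add: k_def bwd_less[OF h] less_bwd[OF h])
  define M where "M y = max y (k y)" for y
  define m where "m y = min y (k y)" for y
  have M: "line_homeo M" and m: "line_homeo m"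
    unfolding M_def m_def by (rule line_homeo_max line_homeo_min line_homeo_id k)+
  have kr: "k r < r" using hr by (simp add: gt_k[symmetric])
  define s where "s = (r + h r) / 2"
  define s1 where "s1 = (r + s) / 2"
  have s: "r < s1" "s1 < s" "s < h r" using hr by (simp_all add: s_def s1_def)
  define r2 where "r2 = h s"
  have r2: "h r < r2" using s by (simp add: r2_def homeo_less[OF h])
  have kr2: "k r2 = s" by (simp add: k_def r2_def bwd_homeo[OF h])
  have khr: "k (h r) = r" by (simp add: k_def bwd_homeo[OF h])
  have mr2: "m r2 = s" unfolding m_def kr2 using s r2 by simp
  have Mr: "M r = r" unfolding M_def using kr by simp
  have Mv: "M v < f0 v" unfolding M_def using v1 v2 by (simp add: gt_k)
  define \<alpha> where "\<alpha> = (r - f0 v) / (r - M v)"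
  have \<alpha>: "0 < \<alpha>" "\<alpha> < 1" and \<alpha>v: "\<alpha> * (r - M v) = r - f0 v"
    using Mv r by (simp_all add: \<alpha>_def)
  define \<beta> where "\<beta> = (s1 - r) / (h r - r)"
  have \<beta>: "0 < \<beta>" "\<beta> < 1" and \<beta>r: "\<beta> * (h r - r) = s1 - r" using s by (simp_all add: \<beta>_def)
  define \<gamma> where "\<gamma> = (s - s1) / (s - r)"
  have \<gamma>: "0 < \<gamma>" "\<gamma> < 1" and \<gamma>r: "\<gamma> * (s - r) = s - s1" using s by (simp_all add: \<gamma>_def)
  \<comment> \<open>Between \<open>v\<close> and \<open>r\<close>, average \<open>M\<close> with its value \<open>r\<close> at the right end, with the weight that matches
    \<open>f0 v\<close>; then \<open>f1\<close> stays above \<open>M\<close>. The piece \<open>f2\<close> has slope below 1, hence stays below the diagonal, and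
    its values are above \<open>r\<close>, the largest value of \<open>k\<close> there. The piece \<open>f3\<close> averages \<open>k\<close> with its value
    \<open>s\<close> at \<open>r2\<close>, and \<open>f4\<close> does the same with \<open>m\<close>, now to the right of \<open>r2\<close> and hence below \<open>m\<close>.\<close>
  define f1 where "f1 y = (r - \<alpha> * r) + \<alpha> * M y" for y
  define f2 where "f2 y = (r - \<beta> * r) + \<beta> * y" for y
  define f3 where "f3 y = (s - \<gamma> * s) + \<gamma> * k y" for y
  define f4 where "f4 y = s / 2 + (1 / 2) * m y" for y
  have homeos: "line_homeo f1" "line_homeo f2" "line_homeo f3" "line_homeo f4"
    unfolding f1_def f2_def f3_def f4_def
    by (rule line_homeo_scaled M line_homeo_id k m \<alpha> \<beta> \<gamma> | simp)+
  define F3 where "F3 y = (if y \<le> r2 then f3 y else f4 y)" for y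
  define F2 where "F2 y = (if y \<le> h r then f2 y else F3 y)" for y
  define F1 where "F1 y = (if y \<le> r then f1 y else F2 y)" for y
  define f where "f y = (if y \<le> v then f0 y else F1 y)" for y
  have F3: "line_homeo F3"
    unfolding F3_def by (rule line_homeo_glue[OF homeos(3,4)]) (simp add: f3_def f4_def kr2 mr2)
  have F2: "line_homeo F2"
    unfolding F2_def
    by (rule line_homeo_glue[OF homeos(2) F3])
       (use r2 \<beta>r \<gamma>r in \<open>simp add: f2_def F3_def f3_def khr algebra_simps\<close>)
  have F1: "line_homeo F1"
    unfolding F1_def
    by (rule line_homeo_glue[OF homeos(1) F2]) (use hr in \<open>simp add: f1_def F2_def f2_def Mr\<close>)
  have f: "line_homeo f"
    unfolding f_def
    by (rule line_homeo_glue[OF f0 F1]) (use v1 r \<alpha>v in \<open>simp add: f1_def F1_def algebra_simps\<close>)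
  have vr: "v < r" using v1 r by linarith
  have below: "M x < f x" if x: "v \<le> x" "x < r" for x
  proof (cases "x = v")
    case True then show ?thesis using Mv by (simp add: f_def)
  next
    case False
    have "M x < M r" using x by (simp add: homeo_less[OF M])
    then have "0 < (1 - \<alpha>) * (r - M x)" using Mr \<alpha> by simp
    then show ?thesis using x False by (simp add: f_def F1_def f1_def algebra_simps)
  qed
  have fr: "f r = r" using vr by (simp add: f_def F1_def f1_def Mr)
  have mid: "f x < x \<and> k x < f x" if x: "r < x" "x \<le> h r" for x
  proof -
    have fx: "f x = r + \<beta> * (x - r)" using x vr by (simp add: f_def F1_def F2_def f2_def algebra_simps)
    have "\<beta> * (x - r) < 1 * (x - r)" using x \<beta> by (intro mult_strict_right_mono) simp_all
    moreover have "0 < \<beta> * (x - r)" using x \<beta> by simp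
    moreover have "k x \<le> k (h r)" using x by (simp add: homeo_le[OF k])
    ultimately show ?thesis using fx khr by simp
  qed
  have mid': "f x < x \<and> k x < f x" if x: "h r < x" "x < r2" for x
  proof -
    have fx: "f x = s - \<gamma> * (s - k x)"
      using x vr hr by (simp add: f_def F1_def F2_def F3_def f3_def algebra_simps)
    have "k x < k r2" using x by (simp add: homeo_less[OF k])
    then have kx: "0 < s - k x" using kr2 by simp
    then have "\<gamma> * (s - k x) < 1 * (s - k x)" using \<gamma> by (intro mult_strict_right_mono) simp_all
    moreover have "0 < \<gamma> * (s - k x)" using kx \<gamma> by simp
    ultimately show ?thesis using fx x s by simp
  qed
  have fr2: "f r2 = s" using vr hr r2 by (simp add: f_def F1_def F2_def F3_def f3_def kr2)
  have above: "f x < m x" if x: "r2 < x" for x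
  proof -
    have fx: "f x = s / 2 + m x / 2"
      using x vr hr r2 by (simp add: f_def F1_def F2_def F3_def f4_def)
    have "m r2 < m x" using x by (simp add: homeo_less[OF m])
    then show ?thesis using fx mr2 by simp
  qed
  show ?thesis
  proof (intro exI[of _ f] exI[of _ r2] conjI allI impI)
    show "line_homeo f" by (rule f)
    show "f x = f0 x" if "x \<le> v" for x using that by (simp add: f_def)
    show "r < r2" using hr r2 by linarith
    show "f r = r" by (rule fr)
    show "h (f r2) = r2" unfolding fr2 by (simp add: r2_def)
    show "x < f x" if "v \<le> x \<and> x < r" for x using below[of x] that by (simp add: M_def)
    show "f x < x" if "r < x" for x
    proof -
      consider "x \<le> h r" | "h r < x" "x < r2" | "x = r2" | "r2 < x" by linarith
      then show ?thesis
        using mid[of x] mid'[of x] above[of x] that s r2 by cases (auto simp: fr2 m_def)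
    qed
    show "x < h (f x)" if x: "v \<le> x \<and> x < r2" for x
    proof -
      consider "x < r" | "x = r" | "r < x" "x \<le> h r" | "h r < x" by linarith
      then have "k x < f x"
        using below[of x] mid[of x] mid'[of x] fr kr x by cases (auto simp: M_def)
      then show ?thesis by (simp add: gt_k)
    qed
    show "h (f x) < x" if "r2 < x" for x using above[OF that] by (simp add: lt_k m_def)
  qed
qed

text \<open>
  If \<open>h\<close> moves the chosen point down instead, exchange the roles of \<open>f\<close> and \<open>h f\<close>, replacing \<open>h\<close> by
  its inverse. The two fixed points come out different because \<open>h\<close> moves the chosen point.
\<close>
lemma crossing:
  assumes f0: "line_homeo f0" and h: "line_homeo h"
    and v1: "v < f0 v" and v2: "v < h (f0 v)" and mv: "\<And>K. \<exists>r>K. h r \<noteq> r"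
  shows "\<exists>f r1 r2. line_homeo f \<and> (\<forall>x\<le>v. f x = f0 x) \<and> v < r1 \<and> v < r2 \<and> r1 \<noteq> r2 \<and>
    f r1 = r1 \<and> h (f r2) = r2 \<and>
    (\<forall>x. v \<le> x \<and> x < r1 \<longrightarrow> x < f x) \<and> (\<forall>x>r1. f x < x) \<and>
    (\<forall>x. v \<le> x \<and> x < r2 \<longrightarrow> x < h (f x)) \<and> (\<forall>x>r2. h (f x) < x)"
proof -
  obtain r where r: "max (f0 v) (h (f0 v)) < r" "h r \<noteq> r" using mv by blast
  consider "r < h r" | "h r < r" using r(2) by linarith
  then show ?thesis
  proof cases
    case 1
    have "f0 v < r" using r by simp
    obtain f r2 where *: "line_homeo f" "\<forall>x\<le>v. f x = f0 x" "r < r2" "f r = r" "h (f r2) = r2"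
      "\<forall>x. v \<le> x \<and> x < r \<longrightarrow> x < f x" "\<forall>x>r. f x < x"
      "\<forall>x. v \<le> x \<and> x < r2 \<longrightarrow> x < h (f x)" "\<forall>x>r2. h (f x) < x"
      using crossing_at_expanded_point[OF f0 h v1 v2 \<open>f0 v < r\<close> 1] by (elim exE conjE) (rule that; assumption)
    have "v < r" "v < r2" "r \<noteq> r2" using \<open>f0 v < r\<close> v1 *(3) by auto
    with * show ?thesis by (intro exI[of _ f] exI[of _ r] exI[of _ r2] conjI)
  next
    case 2
    define k where "k = bwd h"
    have k: "line_homeo k" unfolding k_def by (rule line_homeo_bwd[OF h])
    have kh: "k (h x) = x" and hk: "h (k x) = x" for x
      by (simp_all add: k_def bwd_homeo[OF h] homeo_bwd[OF h])
    have kr: "r < k r" using 2 by (simp add: k_def less_bwd[OF h])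
    have hf0: "line_homeo (\<lambda>x. h (f0 x))" by (rule line_homeo_comp[OF h f0])
    have "v < k (h (f0 v))" "h (f0 v) < r" using v1 r by (simp_all add: kh)
    note crossing_at_expanded_point[OF hf0 k v2 this(1,2) kr]
    then obtain g r2 where *: "line_homeo g" "\<forall>x\<le>v. g x = h (f0 x)" "r < r2" "g r = r" "k (g r2) = r2"
      "\<forall>x. v \<le> x \<and> x < r \<longrightarrow> x < g x" "\<forall>x>r. g x < x"
      "\<forall>x. v \<le> x \<and> x < r2 \<longrightarrow> x < k (g x)" "\<forall>x>r2. k (g x) < x"
      by (elim exE conjE) (rule that; assumption)
    have "v < r" "v < r2" "r \<noteq> r2" using \<open>h (f0 v) < r\<close> v2 *(3) by auto
    moreover have "line_homeo (\<lambda>x. k (g x))" by (rule line_homeo_comp[OF k *(1)])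
    ultimately show ?thesis
      using * by (intro exI[of _ "\<lambda>x. k (g x)"] exI[of _ r2] exI[of _ r]) (simp add: kh hk)
  qed
qed

section \<open>Flexibility of a commutator relation\<close>

definition escapes :: "(real \<Rightarrow> real) \<Rightarrow> bool" where
  "escapes f \<longleftrightarrow> (\<exists>x0. \<forall>x\<ge>x0. x < f x)"

definition changes_drift :: "(real \<Rightarrow> real) \<Rightarrow> (real \<Rightarrow> real) \<Rightarrow> bool" where
  "changes_drift f f' \<longleftrightarrow> escapes f' \<and> \<not> escapes f \<or> escapes (bwd f') \<and> \<not> escapes (bwd f)"

text \<open>
  The relation \<open>[a', b'] = h\<close> is written without inverses. The condition on common fixed points
  will rule out that the perturbed action has a bounded orbit.
\<close>
definition flexible :: "(real \<Rightarrow> real) \<Rightarrow> (real \<Rightarrow> real) \<Rightarrow> (real \<Rightarrow> real) \<Rightarrow> bool" where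
  "flexible h a b \<longleftrightarrow> (\<forall>K. \<exists>a' b'. line_homeo a' \<and> line_homeo b' \<and>
     (\<forall>x. a' (b' x) = h (b' (a' x))) \<and> (\<forall>x\<le>K. a' x = a x \<and> b' x = b x) \<and>
     (\<forall>P. a' P = P \<and> b' P = P \<longrightarrow> a P = P \<and> b P = P) \<and>
     (changes_drift a a' \<or> changes_drift b b'))"

lemma escapes_bwd: "line_homeo f \<Longrightarrow> escapes (bwd f) \<longleftrightarrow> (\<exists>x0. \<forall>x\<ge>x0. f x < x)"
  unfolding escapes_def by (simp only: less_bwd)

lemma not_escapes_both: "escapes f \<Longrightarrow> line_homeo f \<Longrightarrow> \<not> escapes (bwd f)"
  unfolding escapes_bwd unfolding escapes_def by (metis linear not_less_iff_gr_or_eq)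

lemma escapes_conj:
  assumes \<phi>: "line_homeo \<phi>"
  shows "escapes (\<lambda>x. \<phi> (f (bwd \<phi> x))) \<longleftrightarrow> escapes f"
proof
  assume "escapes f"
  then obtain x0 where x0: "\<And>x. x0 \<le> x \<Longrightarrow> x < f x" by (auto simp: escapes_def)
  have "x < \<phi> (f (bwd \<phi> x))" if "\<phi> x0 \<le> x" for x
    using x0[of "bwd \<phi> x"] that by (simp add: le_bwd[OF \<phi>] bwd_less[OF \<phi>])
  then show "escapes (\<lambda>x. \<phi> (f (bwd \<phi> x)))" by (auto simp: escapes_def)
next
  assume "escapes (\<lambda>x. \<phi> (f (bwd \<phi> x)))"
  then obtain x0 where x0: "\<And>x. x0 \<le> x \<Longrightarrow> x < \<phi> (f (bwd \<phi> x))" by (auto simp: escapes_def)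
  have "x < f x" if "bwd \<phi> x0 \<le> x" for x
    using x0[of "\<phi> x"] that by (simp add: bwd_le[OF \<phi>] bwd_homeo[OF \<phi>] homeo_less[OF \<phi>])
  then show "escapes f" by (auto simp: escapes_def)
qed

lemma bwd_conj:
  assumes \<phi>: "line_homeo \<phi>" and f: "line_homeo f"
  shows "bwd (\<lambda>x. \<phi> (f (bwd \<phi> x))) = (\<lambda>x. \<phi> (bwd f (bwd \<phi> x)))"
proof
  have "line_homeo (\<lambda>x. \<phi> (f (bwd \<phi> x)))"
    by (rule line_homeo_comp[OF \<phi> line_homeo_comp[OF f line_homeo_bwd[OF \<phi>]]])
  then show "bwd (\<lambda>x. \<phi> (f (bwd \<phi> x))) x = \<phi> (bwd f (bwd \<phi> x))" for x
    by (simp add: bwd_eq_iff bwd_homeo[OF \<phi>] homeo_bwd[OF \<phi>] homeo_bwd[OF f])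
qed

lemma changes_drift_conj:
  assumes "line_homeo \<phi>" "line_homeo \<psi>" "line_homeo f" "line_homeo g"
  shows "changes_drift (\<lambda>x. \<phi> (f (bwd \<phi> x))) (\<lambda>x. \<psi> (g (bwd \<psi> x))) \<longleftrightarrow> changes_drift f g"
  using assms by (simp add: changes_drift_def bwd_conj escapes_conj)

lemma fixed_points_unbounded:
  assumes f: "line_homeo f" and "\<not> escapes f" "\<not> escapes (bwd f)"
  shows "\<exists>x\<ge>K. f x = x"
proof -
  obtain x y where "K \<le> x" "f x \<le> x" "K \<le> y" "y \<le> f y"
    using assms(2,3) unfolding escapes_bwd[OF f] unfolding escapes_def by (metis not_le)
  then show ?thesis
    using fixed_point_between[OF f, of y x] fixed_point_between'[OF f, of x y]
    by (metis linear order_trans)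
qed

text \<open>
  The set of fixed points is closed.
\<close>
lemma last_fixed_point:
  assumes f: "line_homeo f" and "f u = u" "u \<le> q"
  shows "\<exists>p. u \<le> p \<and> p \<le> q \<and> f p = p \<and> (\<forall>x. p < x \<and> x \<le> q \<longrightarrow> f x \<noteq> x)"
proof -
  define A where "A = {x. x \<le> q \<and> f x = x}"
  have bdd: "bdd_above A" by (auto simp: A_def)
  have u: "u \<in> A" using assms by (simp add: A_def)
  have 1: "Sup A \<le> f (Sup A)"
  proof (rule cSup_least)
    show "x \<le> f (Sup A)" if "x \<in> A" for x
      using cSup_upper[OF that bdd] homeo_le[OF f, of x "Sup A"] that by (simp add: A_def)
  qed (use u in auto)
  have "Sup A \<le> bwd f (Sup A)"
  proof (rule cSup_least)
    show "x \<le> bwd f (Sup A)" if "x \<in> A" for x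
      using cSup_upper[OF that bdd] that by (simp add: A_def le_bwd[OF f])
  qed (use u in auto)
  then have "f (Sup A) = Sup A" using 1 by (simp add: le_bwd[OF f])
  moreover have "Sup A \<le> q" using u by (intro cSup_least) (auto simp: A_def)
  moreover have "f x \<noteq> x" if "Sup A < x" "x \<le> q" for x
    using cSup_upper[OF _ bdd, of x] that by (auto simp: A_def)
  ultimately show ?thesis using cSup_upper[OF u bdd] by blast
qed

text \<open>
  The substitution \<open>(a, b) \<mapsto> (a b a\<inverse>, a\<inverse>)\<close> preserves the commutator, and a perturbation of the new
  pair \<open>(c, d)\<close> can be translated back by \<open>a = d\<inverse>\<close>, \<open>b = d c d\<inverse>\<close>. Its fourth power is a conjugation, so
  iterating it brings \<open>b\<close>, \<open>b\<inverse>\<close>, \<open>a\<close> and \<open>a\<inverse>\<close>, up to conjugation, into the second position.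
\<close>
lemma flexible_rotate:
  assumes a: "line_homeo a" and b: "line_homeo b"
    and flex: "flexible h (\<lambda>x. a (b (bwd a x))) (bwd a)"
  shows "flexible h a b"
  unfolding flexible_def
proof
  fix K
  define K1 where "K1 = max (a K) (a (b K))"
  obtain c d where c: "line_homeo c" and d: "line_homeo d"
    and rel: "\<forall>x. c (d x) = h (d (c x))"
    and agree: "\<forall>x\<le>K1. c x = a (b (bwd a x)) \<and> d x = bwd a x"
    and fixed: "\<forall>P. c P = P \<and> d P = P \<longrightarrow> a (b (bwd a P)) = P \<and> bwd a P = P"
    and drift: "changes_drift (\<lambda>x. a (b (bwd a x))) c \<or> changes_drift (bwd a) d"
    using flex[unfolded flexible_def, THEN spec, of K1] by (elim exE conjE) (rule that; assumption)
  note agree = agree[rule_format] and rel = spec[OF rel] and fixed = fixed[rule_format, OF conjI]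
  define a' where "a' = bwd d"
  define b' where "b' x = d (c (bwd d x))" for x
  note dd = line_homeo_bwd[OF d]
  have agree': "a' x = a x \<and> b' x = b x" if "x \<le> K" for x
  proof -
    have 1: "a x \<le> K1" "a (b x) \<le> K1"
      using that homeo_le[OF a, of x K] homeo_le[OF a, of "b x" "b K"] homeo_le[OF b, of x K]
      by (simp_all add: K1_def)
    have "d (a x) = x" using agree[OF 1(1)] by (simp add: bwd_homeo[OF a])
    then have 2: "bwd d x = a x" by (simp add: bwd_eq_iff[OF d])
    moreover have "d (c (a x)) = b x" using agree[OF 1(1)] agree[OF 1(2)] by (simp add: bwd_homeo[OF a])
    ultimately show ?thesis by (simp add: a'_def b'_def)
  qed
  show "\<exists>a' b'. line_homeo a' \<and> line_homeo b' \<and>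
     (\<forall>x. a' (b' x) = h (b' (a' x))) \<and> (\<forall>x\<le>K. a' x = a x \<and> b' x = b x) \<and>
     (\<forall>P. a' P = P \<and> b' P = P \<longrightarrow> a P = P \<and> b P = P) \<and>
     (changes_drift a a' \<or> changes_drift b b')"
  proof (rule exI[of _ a'], rule exI[of _ b'], intro conjI allI impI)
    show "line_homeo a'" unfolding a'_def by (rule dd)
    show "line_homeo b'" unfolding b'_def by (rule line_homeo_comp[OF d line_homeo_comp[OF c dd]])
    show "a' (b' x) = h (b' (a' x))" for x
      using rel[of "bwd d (bwd d x)"] by (simp add: a'_def b'_def bwd_homeo[OF d] homeo_bwd[OF d])
    show "a' x = a x" "b' x = b x" if "x \<le> K" for x using agree'[OF that] by auto
    have P: "a P = P \<and> b P = P" if "a' P = P \<and> b' P = P" for P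
    proof -
      have dP: "d P = P" using that by (simp add: a'_def bwd_eq_iff[OF d])
      have "d (c (bwd d P)) = P" using conjunct2[OF that] by (simp only: b'_def)
      then have "d (c P) = d P" using dP conjunct1[OF that] by (simp only: a'_def)
      then have cP: "c P = P" by (simp only: homeo_eq[OF d])
      note * = conjunct1[OF fixed[OF cP dP]] conjunct2[OF fixed[OF cP dP]]
      then have "a P = P" by (simp only: bwd_eq_iff[OF a])
      have "a (b P) = a P" using *(1) unfolding *(2) \<open>a P = P\<close> .
      then have "b P = P" by (simp only: homeo_eq[OF a])
      then show ?thesis using \<open>a P = P\<close> by simp
    qed
    show "a P = P" "b P = P" if "a' P = P \<and> b' P = P" for P using P[OF that] by auto
    have "changes_drift b b'" if "changes_drift (\<lambda>x. a (b (bwd a x))) c"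
      unfolding b'_def using that changes_drift_conj[OF a line_homeo_id b c] changes_drift_conj[OF line_homeo_id d b c]
      by (simp add: bwd_def inv_into_def)
    moreover have "changes_drift a a'" if "changes_drift (bwd a) d"
      using that by (auto simp: changes_drift_def a'_def bwd_bwd[OF d] bwd_bwd[OF a])
    ultimately show "changes_drift a a' \<or> changes_drift b b'" using drift by blast
  qed
qed

locale commutator_relation =
  fixes h a b :: "real \<Rightarrow> real"
  assumes h: "line_homeo h" and a: "line_homeo a" and b: "line_homeo b"
    and rel: "\<And>x. a (b x) = h (b (a x))"
    and moves: "\<And>K. \<exists>r>K. h r \<noteq> r"
begin

lemma rotate: "commutator_relation h (\<lambda>x. a (b (bwd a x))) (bwd a)"
proof
  show "line_homeo (\<lambda>x. a (b (bwd a x)))"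
    by (rule line_homeo_comp[OF a line_homeo_comp[OF b line_homeo_bwd[OF a]]])
  show "a (b (bwd a (bwd a x))) = h (bwd a (a (b (bwd a x))))" for x
    using rel[of "bwd a (bwd a x)"] by (simp add: bwd_homeo[OF a] homeo_bwd[OF a])
qed (use h moves line_homeo_bwd[OF a] in auto)

text \<open>
  Here \<open>b\<close> has no large fixed points, so that \<open>a\<close> on \<open>{..p}\<close> determines \<open>a'\<close> up to the first fixed
  point \<open>r1\<close> of the new map \<open>f\<close>, by \<open>extend_conjugacy\<close>; beyond \<open>r1\<close> any conjugacy from \<open>f\<close> to \<open>h f\<close>
  will do. As \<open>a'\<close> sends \<open>r1\<close> to the different point \<open>r2\<close>, no new common fixed point arises.
\<close>
lemma flexible_if_escapes:
  assumes "escapes b" shows "flexible h a b"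
  unfolding flexible_def
proof
  fix K
  obtain K0 where K0: "\<And>x. K0 \<le> x \<Longrightarrow> x < b x" using assms by (auto simp: escapes_def)
  define p where "p = max K K0"
  define v where "v = max p (a p)"
  have hb: "x < h (b x)" if "a p \<le> x" for x
  proof -
    define y where "y = bwd a x"
    have y: "a y = x" and "p \<le> y" using that by (simp_all add: y_def homeo_bwd[OF a] le_bwd[OF a])
    then have "y < b y" using K0[of y] by (simp add: p_def)
    then have "a y < a (b y)" by (simp only: homeo_less[OF a])
    then show ?thesis using rel[of y] y by simp
  qed
  have "v < b v" using K0[of v] by (simp add: v_def p_def)
  have "v < h (b v)" using hb[of v] by (simp add: v_def)
  from crossing[OF b h \<open>v < b v\<close> \<open>v < h (b v)\<close> moves]
  obtain f r1 r2 where f: "line_homeo f" and fb: "\<forall>x\<le>v. f x = b x"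
    and r: "v < r1" "v < r2" "r1 \<noteq> r2" and fr: "f r1 = r1" and hr: "h (f r2) = r2"
    and fup: "\<forall>x. v \<le> x \<and> x < r1 \<longrightarrow> x < f x" and fdn: "\<forall>x>r1. f x < x"
    and gup: "\<forall>x. v \<le> x \<and> x < r2 \<longrightarrow> x < h (f x)" and gdn: "\<forall>x>r2. h (f x) < x"
    by (elim exE conjE) (rule that; assumption)
  define g where "g x = h (f x)" for x
  have g: "line_homeo g" unfolding g_def by (rule line_homeo_comp[OF h f])
  have pv: "p \<le> v" "a p \<le> v" by (simp_all add: v_def)
  have rel': "a (f x) = g (a x)" if "x \<le> p" for x
  proof -
    have "a x \<le> a p" using that by (simp add: homeo_le[OF a])
    then show ?thesis using fb pv that rel[of x] by (simp add: g_def)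
  qed
  have fup': "x < f x" if "p \<le> x" "x < r1" for x
    using fup fb K0[of x] that by (cases "x \<le> v") (auto simp: p_def)
  have gup': "x < g x" if "a p \<le> x" "x < r2" for x
    using gup fb hb[OF that(1)] that by (cases "x \<le> v") (auto simp: g_def)
  have "p < r1" "a p < r2" "g r2 = r2" using pv r hr by (simp_all add: g_def)
  then have "\<exists>c. strict_mono_on {..<r1} c \<and> c ` {..<r1} = {..<r2} \<and> (\<forall>x<r1. c (f x) = g (c x)) \<and>
      (\<forall>x\<le>p. c x = a x)"
    using extend_conjugacy[OF f g a rel' fup' gup' _ _ fr] by blast
  then obtain c where c: "strict_mono_on {..<r1} c" "c ` {..<r1} = {..<r2}"
    and cf: "\<forall>x<r1. c (f x) = g (c x)" and ca: "\<forall>x\<le>p. c x = a x"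
    by (elim exE conjE) (rule that; assumption)
  note cf = cf[rule_format] and ca = ca[rule_format]
  from conjugate_rays_down[OF f fr _ g \<open>g r2 = r2\<close>] fdn gdn
  obtain d where d: "strict_mono_on {r1<..} d" "d ` {r1<..} = {r2<..}"
    and df: "\<And>x. r1 < x \<Longrightarrow> d (f x) = g (d x)"
    unfolding g_def by blast
  define a' where "a' x = (if x < r1 then c x else if x = r1 then r2 else d x)" for x
  have a': "line_homeo a'" unfolding a'_def by (rule line_homeo_rays[OF c d])
  have agree: "a' x = a x \<and> f x = b x" if "x \<le> p" for x
    using that pv r fb ca by (simp add: a'_def)
  show "\<exists>a' b'. line_homeo a' \<and> line_homeo b' \<and>
     (\<forall>x. a' (b' x) = h (b' (a' x))) \<and> (\<forall>x\<le>K. a' x = a x \<and> b' x = b x) \<and>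
     (\<forall>P. a' P = P \<and> b' P = P \<longrightarrow> a P = P \<and> b P = P) \<and>
     (changes_drift a a' \<or> changes_drift b b')"
  proof (rule exI[of _ a'], rule exI[of _ f], intro conjI allI impI disjI2)
    show "a' (f x) = h (f (a' x))" for x
    proof -
      have "f x < r1 \<longleftrightarrow> x < r1" "f x = r1 \<longleftrightarrow> x = r1"
        using homeo_less[OF f, of x r1] homeo_eq[OF f, of x r1] fr by auto
      then show ?thesis using cf[of x] df[of x] hr by (simp add: a'_def g_def)
    qed
    show "a' x = a x" "f x = b x" if "x \<le> K" for x using agree[of x] that by (simp_all add: p_def)
    have no_new: "P \<le> p" if "a' P = P \<and> f P = P" for P
    proof (rule ccontr)
      assume "\<not> P \<le> p"
      then have "P = r1" using that fup'[of P] fdn by (metis less_eq_real_def linorder_less_linear not_le order_less_irrefl)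
      then show False using that r by (simp add: a'_def)
    qed
    show "a P = P" "b P = P" if "a' P = P \<and> f P = P" for P
      using agree[OF no_new[OF that]] that by auto
    have "escapes (bwd f)" unfolding escapes_bwd[OF f] using fdn by (meson gt_ex less_le_trans)
    then show "changes_drift b f"
      using not_escapes_both[OF assms b] by (simp add: changes_drift_def)
  qed (rule a' f)+
qed

text \<open>
  At a fixed point \<open>p\<close> of \<open>b\<close> the map \<open>a'\<close> may start afresh: it only has to send \<open>p\<close> to \<open>a p\<close>, which is
  fixed by \<open>h b\<close>, and to conjugate \<open>f\<close> to \<open>h f\<close> on the rays to the right of these points. The fixed point \<open>q\<close> of
  \<open>a\<close> guarantees that \<open>f\<close> is still equal to \<open>b\<close> at all points \<open>a x\<close> with \<open>x \<le> p\<close>.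
\<close>
lemma conjugator_from_fixed_point:
  assumes f: "line_homeo f" and fb: "\<And>x. x \<le> q \<Longrightarrow> f x = b x"
    and q: "a q = q" and p: "b p = p" "p \<le> q"
    and drift: "(\<forall>x>p. x < f x) \<and> (\<forall>x>a p. x < h (f x)) \<or> (\<forall>x>p. f x < x) \<and> (\<forall>x>a p. h (f x) < x)"
  shows "\<exists>a'. line_homeo a' \<and> (\<forall>x. a' (f x) = h (f (a' x))) \<and> (\<forall>x\<le>p. a' x = a x)"
proof -
  define g where "g x = h (f x)" for x
  have g: "line_homeo g" unfolding g_def by (rule line_homeo_comp[OF h f])
  have ap: "a p \<le> q" using p(2) homeo_le[OF a, of p q] q by simp
  have fp: "f p = p" using fb p by simp
  have gp: "g (a p) = a p" unfolding g_def using fb[OF ap] rel[of p] p by simp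
  have "\<exists>c. strict_mono_on {p<..} c \<and> c ` {p<..} = {a p<..} \<and> (\<forall>x>p. c (f x) = g (c x))"
    using drift
  proof
    assume "(\<forall>x>p. x < f x) \<and> (\<forall>x>a p. x < h (f x))"
    then show ?thesis by (intro conjugate_rays_up[OF f fp _ g gp]) (simp_all add: g_def)
  next
    assume "(\<forall>x>p. f x < x) \<and> (\<forall>x>a p. h (f x) < x)"
    then show ?thesis by (intro conjugate_rays_down[OF f fp _ g gp]) (simp_all add: g_def)
  qed
  then obtain c where c: "strict_mono_on {p<..} c" "c ` {p<..} = {a p<..}"
    and cf: "\<And>x. p < x \<Longrightarrow> c (f x) = g (c x)" by blast
  have a1: "strict_mono_on {..<p} a" by (rule strict_mono_onI) (simp add: homeo_less[OF a])
  have a2: "a ` {..<p} = {..<a p}"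
  proof -
    have "y \<in> a ` {..<p}" if "y < a p" for y
      using that homeo_bwd[OF a, of y] by (intro image_eqI[of _ _ "bwd a y"]) (simp_all add: bwd_less[OF a])
    then show ?thesis by (auto simp: homeo_less[OF a])
  qed
  define a' where "a' x = (if x < p then a x else if x = p then a p else c x)" for x
  have "line_homeo a'" unfolding a'_def by (rule line_homeo_rays[OF a1 a2 c])
  moreover have "a' (f x) = h (f (a' x))" for x
  proof -
    have fx: "f x < p \<longleftrightarrow> x < p" "f x = p \<longleftrightarrow> x = p"
      using homeo_less[OF f, of x p] homeo_eq[OF f, of x p] fp by auto
    consider "x < p" | "x = p" | "p < x" by linarith
    then show ?thesis
    proof cases
      case 1
      then have "a x \<le> q" using ap homeo_less[OF a, of x p] by simp
      then show ?thesis using 1 fx fb[of x] fb[of "a x"] p(2) rel[of x] by (simp add: a'_def)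
    next
      case 2 then show ?thesis using fp gp by (simp add: a'_def g_def)
    next
      case 3 then show ?thesis using fx cf by (simp add: a'_def g_def)
    qed
  qed
  moreover have "\<forall>x\<le>p. a' x = a x" by (simp add: a'_def)
  ultimately show ?thesis by blast
qed

text \<open>
  As \<open>p\<close> is the last fixed point of \<open>b\<close> before \<open>q\<close>, \<open>b\<close> moves points in one direction on \<open>{p<..q}\<close>, and so
  does its conjugate \<open>h b\<close> on \<open>{a p<..q}\<close>, the image of \<open>{p<..q}\<close> under \<open>a\<close>. Continuing in the same
  direction after \<open>q\<close> means to stay above \<open>M = max id h\<inverse>\<close> or below \<open>m = min id h\<inverse>\<close>.
\<close>
lemma flexible_if_recurrent:
  assumes na: "\<not> escapes a" "\<not> escapes (bwd a)" and nb: "\<not> escapes b" "\<not> escapes (bwd b)"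
  shows "flexible h a b"
  unfolding flexible_def
proof
  fix K
  obtain u where u: "K \<le> u" "b u = u" using fixed_points_unbounded[OF b nb] by blast
  obtain q where q: "u \<le> q" "a q = q" using fixed_points_unbounded[OF a na] by blast
  obtain p where p: "u \<le> p" "p \<le> q" "b p = p" and free: "\<And>x. p < x \<Longrightarrow> x \<le> q \<Longrightarrow> b x \<noteq> x"
    using last_fixed_point[OF b u(2) q(1)] by blast
  have sign: "(\<forall>x. p < x \<and> x \<le> q \<longrightarrow> x < b x) \<or> (\<forall>x. p < x \<and> x \<le> q \<longrightarrow> b x < x)"
  proof (rule ccontr)
    assume "\<not> ?thesis"
    then obtain x y where "p < x" "x \<le> q" "b x \<le> x" "p < y" "y \<le> q" "y \<le> b y" by (auto simp: not_less)
    then have "\<exists>z. p < z \<and> z \<le> q \<and> b z = z"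
      using fixed_point_between[OF b, of y x] fixed_point_between'[OF b, of x y]
      by (metis linear order_trans order_less_le_trans)
    then show False using free by blast
  qed
  define k where "k = bwd h"
  have k: "line_homeo k" unfolding k_def by (rule line_homeo_bwd[OF h])
  have gt_k: "x < h y \<longleftrightarrow> k x < y" and lt_k: "h y < x \<longleftrightarrow> y < k x"
    and ge_k: "x \<le> h y \<longleftrightarrow> k x \<le> y" and le_k: "h y \<le> x \<longleftrightarrow> y \<le> k x" for x y
    by (simp_all add: k_def bwd_less[OF h] less_bwd[OF h] bwd_le[OF h] le_bwd[OF h])
  have hbq: "h (b q) = a (b q)" using rel[of q] q by simp
  have pull: "\<exists>y. x = a y \<and> p < y \<and> y \<le> q \<and> h (b x) = a (b y)" if "a p < x" "x \<le> q" for x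
  proof (intro exI[of _ "bwd a x"] conjI)
    show "x = a (bwd a x)" by (simp add: homeo_bwd[OF a])
    show "p < bwd a x" "bwd a x \<le> q" using that q by (simp_all add: less_bwd[OF a] bwd_le[OF a])
    show "h (b x) = a (b (bwd a x))" using rel[of "bwd a x"] by (simp add: homeo_bwd[OF a])
  qed
  have "\<exists>f. line_homeo f \<and> (\<forall>x\<le>q. f x = b x) \<and>
    ((\<forall>x>p. x < f x) \<and> (\<forall>x>a p. x < h (f x)) \<or> (\<forall>x>p. f x < x) \<and> (\<forall>x>a p. h (f x) < x))"
    using sign
  proof
    assume up: "\<forall>x. p < x \<and> x \<le> q \<longrightarrow> x < b x"
    define M where "M y = max y (k y)" for y
    have M: "line_homeo M" unfolding M_def by (rule line_homeo_max line_homeo_id k)+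
    have bq: "q \<le> b q" using up p by (cases "p = q") (auto simp: less_imp_le)
    then have "a q \<le> a (b q)" by (simp add: homeo_le[OF a])
    then have Mq: "M q \<le> b q" using bq hbq q by (simp add: M_def ge_k[symmetric])
    \<comment> \<open>The increments of \<open>f\<close> after \<open>q\<close> are twice those of \<open>M\<close>, and \<open>f q = b q\<close> is at least \<open>M q\<close>.\<close>
    define f where "f y = (if y \<le> q then b y else (b q - 2 * M q) + 2 * M y)" for y
    have f: "line_homeo f"
      unfolding f_def by (rule line_homeo_glue[OF b line_homeo_scaled[OF M]]) simp_all
    have high: "M x < f x" if "q < x" for x
      using that Mq homeo_less[OF M, of q x] by (simp add: f_def)
    have "x < f x" if "p < x" for x
      using up high[of x] that by (cases "x \<le> q") (auto simp: f_def M_def)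
    moreover have "x < h (f x)" if "a p < x" for x
    proof (cases "x \<le> q")
      case True
      then obtain y where y: "x = a y" "p < y" "y \<le> q" "h (b x) = a (b y)" using pull[OF \<open>a p < x\<close> True] by blast
      then have "a y < a (b y)" using up by (simp add: homeo_less[OF a])
      then show ?thesis using y True by (simp add: f_def)
    next
      case False
      then show ?thesis using high[of x] by (simp add: M_def gt_k)
    qed
    ultimately show ?thesis using f by (intro exI[of _ f]) (simp add: f_def)
  next
    assume dn: "\<forall>x. p < x \<and> x \<le> q \<longrightarrow> b x < x"
    define m where "m y = min y (k y)" for y
    have m: "line_homeo m" unfolding m_def by (rule line_homeo_min line_homeo_id k)+
    have bq: "b q \<le> q" using dn p by (cases "p = q") (auto simp: less_imp_le)
    then have "a (b q) \<le> a q" by (simp add: homeo_le[OF a])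
    then have mq: "b q \<le> m q" using bq hbq q by (simp add: m_def le_k[symmetric])
    \<comment> \<open>The increments of \<open>f\<close> after \<open>q\<close> are half of those of \<open>m\<close>, and \<open>f q = b q\<close> is at most \<open>m q\<close>.\<close>
    define f where "f y = (if y \<le> q then b y else (b q - m q / 2) + (1 / 2) * m y)" for y
    have f: "line_homeo f"
      unfolding f_def by (rule line_homeo_glue[OF b line_homeo_scaled[OF m]]) simp_all
    have low: "f x < m x" if "q < x" for x
      using that mq homeo_less[OF m, of q x] by (simp add: f_def)
    have "f x < x" if "p < x" for x
      using dn low[of x] that by (cases "x \<le> q") (auto simp: f_def m_def)
    moreover have "h (f x) < x" if "a p < x" for x
    proof (cases "x \<le> q")
      case True
      then obtain y where y: "x = a y" "p < y" "y \<le> q" "h (b x) = a (b y)" using pull[OF \<open>a p < x\<close> True] by blast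
      then have "a (b y) < a y" using dn by (simp add: homeo_less[OF a])
      then show ?thesis using y True by (simp add: f_def)
    next
      case False
      then show ?thesis using low[of x] by (simp add: m_def lt_k)
    qed
    ultimately show ?thesis using f by (intro exI[of _ f]) (simp add: f_def)
  qed
  then obtain f where f: "line_homeo f" and fb: "\<And>x. x \<le> q \<Longrightarrow> f x = b x"
    and drift: "(\<forall>x>p. x < f x) \<and> (\<forall>x>a p. x < h (f x)) \<or> (\<forall>x>p. f x < x) \<and> (\<forall>x>a p. h (f x) < x)"
    by blast
  obtain a' where a': "line_homeo a'" "\<And>x. a' (f x) = h (f (a' x))" "\<And>x. x \<le> p \<Longrightarrow> a' x = a x"
    using conjugator_from_fixed_point[OF f fb q(2) p(3,2) drift] by blast
  show "\<exists>a' b'. line_homeo a' \<and> line_homeo b' \<and>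
     (\<forall>x. a' (b' x) = h (b' (a' x))) \<and> (\<forall>x\<le>K. a' x = a x \<and> b' x = b x) \<and>
     (\<forall>P. a' P = P \<and> b' P = P \<longrightarrow> a P = P \<and> b P = P) \<and>
     (changes_drift a a' \<or> changes_drift b b')"
  proof (rule exI[of _ a'], rule exI[of _ f], intro conjI allI impI disjI2)
    show "a' x = a x" "f x = b x" if "x \<le> K" for x using that a'(3)[of x] fb[of x] u p by simp_all
    have "P \<le> p" if "a' P = P \<and> f P = P" for P
      using drift that by (metis not_le order_less_irrefl)
    then show "a P = P" "b P = P" if "a' P = P \<and> f P = P" for P
      using a'(3)[of P] fb[of P] p(2) that by (metis, metis order_trans)
    have "escapes f \<or> escapes (bwd f)"
      using drift unfolding escapes_bwd[OF f] unfolding escapes_def by (meson gt_ex less_le_trans)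
    then show "changes_drift b f" using nb by (auto simp: changes_drift_def)
  qed (rule a' f)+
qed

lemma flexible_if_escapes_bwd_left:
  assumes "escapes (bwd a)" shows "flexible h a b"
  using flexible_rotate[OF a b] commutator_relation.flexible_if_escapes[OF rotate assms] by blast

lemma flexible_if_escapes_bwd:
  assumes "escapes (bwd b)" shows "flexible h a b"
proof (rule flexible_rotate[OF a b], rule commutator_relation.flexible_if_escapes_bwd_left[OF rotate])
  show "escapes (bwd (\<lambda>x. a (b (bwd a x))))"
    unfolding bwd_conj[OF a b] by (subst escapes_conj[OF a]) (rule assms)
qed

lemma flexible_if_escapes_left:
  assumes "escapes a" shows "flexible h a b"
proof (rule flexible_rotate[OF a b], rule commutator_relation.flexible_if_escapes_bwd[OF rotate])
  show "escapes (bwd (bwd a))" unfolding bwd_bwd[OF a] by (rule assms)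
qed

theorem flexible: "flexible h a b"
  using flexible_if_escapes flexible_if_escapes_bwd flexible_if_escapes_left
    flexible_if_escapes_bwd_left flexible_if_recurrent by blast

end

section \<open>Homomorphisms out of the amalgam\<close>

definition word_value :: "('a, 'm) monoid_scheme \<Rightarrow> ('l \<Rightarrow> 'a) \<Rightarrow> 'l list \<Rightarrow> 'a" where
  "word_value K e w = foldr (\<lambda>x y. e x \<otimes>\<^bsub>K\<^esub> y) w \<one>\<^bsub>K\<^esub>"

lemma word_value_simps [simp]:
  "word_value K e [] = \<one>\<^bsub>K\<^esub>"
  "word_value K e (x # w) = e x \<otimes>\<^bsub>K\<^esub> word_value K e w"
  by (simp_all add: word_value_def)

context monoid begin

lemma word_value_closed: "e \<in> A \<rightarrow> carrier G \<Longrightarrow> w \<in> lists A \<Longrightarrow> word_value G e w \<in> carrier G"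
  by (induction w) auto

lemma word_value_append:
  assumes "e \<in> A \<rightarrow> carrier G" "v \<in> lists A" "w \<in> lists A"
  shows "word_value G e (v @ w) = word_value G e v \<otimes> word_value G e w"
  using assms(2)
proof (induction v)
  case (Cons x v)
  then show ?case
    using assms word_value_closed[OF assms(1)] by (auto simp: m_assoc Pi_iff)
next
  case Nil
  show ?case using word_value_closed[OF assms(1,3)] by simp
qed

lemma presented_monoid_hom:
  assumes e: "e \<in> A \<rightarrow> carrier G"
    and rel: "\<And>l r. (l, r) \<in> R \<Longrightarrow> l \<in> lists A \<Longrightarrow> r \<in> lists A \<Longrightarrow> word_value G e l = word_value G e r"
  obtains \<psi> where "\<psi> \<in> hom (presented_monoid A R) G"
    and "\<And>w. w \<in> lists A \<Longrightarrow> \<psi> (word_cong A R `` {w}) = word_value G e w"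
proof -
  have inv: "word_value G e v = word_value G e w" if "(v, w) \<in> word_cong A R" for v w
    using that
  proof (induction rule: word_cong.induct)
    case (rel l r u v)
    then have "l @ v \<in> lists A" "r @ v \<in> lists A" by auto
    then show ?case
      using rel assms(2)[OF rel(1-3)] by (simp only: word_value_append[OF e])
  qed auto
  define \<psi> where "\<psi> X = word_value G e (SOME w. w \<in> X)" for X
  have cls: "\<psi> (word_cong A R `` {w}) = word_value G e w" if "w \<in> lists A" for w
  proof -
    have "w \<in> word_cong A R `` {w}" using that by (simp add: word_cong.refl)
    then have "(SOME v. v \<in> word_cong A R `` {w}) \<in> word_cong A R `` {w}" by (rule someI)
    then show ?thesis unfolding \<psi>_def using inv by simp
  qed
  have "\<psi> \<in> hom (presented_monoid A R) G"
  proof (rule homI)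
    fix X assume "X \<in> carrier (presented_monoid A R)"
    then obtain v where v: "v \<in> lists A" "X = word_cong A R `` {v}"
      by (auto simp: presented_monoid_def quotient_def)
    show "\<psi> X \<in> carrier G" unfolding v(2) cls[OF v(1)] by (rule word_value_closed[OF e v(1)])
    fix Y assume "Y \<in> carrier (presented_monoid A R)"
    then obtain w where w: "w \<in> lists A" "Y = word_cong A R `` {w}"
      by (auto simp: presented_monoid_def quotient_def)
    have vw: "v @ w \<in> lists A" using v w by simp
    show "\<psi> (X \<otimes>\<^bsub>presented_monoid A R\<^esub> Y) = \<psi> X \<otimes> \<psi> Y"
      unfolding v(2) w(2) presented_monoid_mult[OF v(1) w(1)] cls[OF v(1)] cls[OF w(1)] cls[OF vw]
      by (rule word_value_append[OF e v(1) w(1)])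
  qed
  then show ?thesis using cls that by blast
qed

end

lemma (in group) free_group_hom:
  assumes e: "e \<in> S \<rightarrow> carrier G"
  obtains \<theta> where "\<theta> \<in> hom (free_group S) G" and "\<And>s. s \<in> S \<Longrightarrow> \<theta> (free_gen S s) = e s"
proof -
  define \<epsilon> where "\<epsilon> = (\<lambda>(s, pos). if pos then e s else inv (e s))"
  have \<epsilon>: "\<epsilon> \<in> S \<times> UNIV \<rightarrow> carrier G" using funcset_mem[OF e] by (auto simp: \<epsilon>_def)
  obtain \<theta> where \<theta>: "\<theta> \<in> hom (presented_monoid (S \<times> UNIV) (free_group_rels S)) G"
    "\<And>w. w \<in> lists (S \<times> UNIV) \<Longrightarrow>
      \<theta> (word_cong (S \<times> UNIV) (free_group_rels S) `` {w}) = word_value G \<epsilon> w"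
  proof (rule presented_monoid_hom[OF \<epsilon>, where R = "free_group_rels S"], goal_cases)
    case (1 l r)
    then show ?case using funcset_mem[OF e] by (auto simp: free_group_rels_def \<epsilon>_def)
  next
    case 2
    show ?case by (rule 2(1)[OF 2(2,3)])
  qed
  have "\<theta> (free_gen S s) = e s" if "s \<in> S" for s
    using \<theta>(2)[of "[(s, True)]"] that e by (auto simp: free_gen_def \<epsilon>_def Pi_iff)
  then show ?thesis using that \<theta>(1) by (simp add: free_group_def)
qed

definition amalgam_inl ::
  "('a, 'm) monoid_scheme \<Rightarrow> ('b, 'n) monoid_scheme \<Rightarrow> 'a set \<Rightarrow> ('a \<Rightarrow> 'b) \<Rightarrow> 'a \<Rightarrow> ('a + 'b) list set" where
  "amalgam_inl A B C \<phi> x = word_cong (carrier A <+> carrier B) (amalgam_rels A B C \<phi>) `` {[Inl x]}"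

definition amalgam_inr ::
  "('a, 'm) monoid_scheme \<Rightarrow> ('b, 'n) monoid_scheme \<Rightarrow> 'a set \<Rightarrow> ('a \<Rightarrow> 'b) \<Rightarrow> 'b \<Rightarrow> ('a + 'b) list set" where
  "amalgam_inr A B C \<phi> y = word_cong (carrier A <+> carrier B) (amalgam_rels A B C \<phi>) `` {[Inr y]}"

lemma (in group) amalgam_hom:
  assumes \<sigma>: "\<sigma> \<in> hom A G" and \<theta>: "\<theta> \<in> hom B G" and "group A" "group B"
    and agree: "\<And>c. c \<in> C \<Longrightarrow> \<sigma> c = \<theta> (\<phi> c)" and C: "C \<subseteq> carrier A" "\<phi> ` C \<subseteq> carrier B"
  obtains \<tau> where "\<tau> \<in> hom (amalgamated_product A B C \<phi>) G"
    and "\<And>x. x \<in> carrier A \<Longrightarrow> \<tau> (amalgam_inl A B C \<phi> x) = \<sigma> x"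
    and "\<And>y. y \<in> carrier B \<Longrightarrow> \<tau> (amalgam_inr A B C \<phi> y) = \<theta> y"
proof -
  interpret A: group A by fact
  interpret B: group B by fact
  interpret \<sigma>: group_hom A G \<sigma> using \<sigma> by unfold_locales
  interpret \<theta>: group_hom B G \<theta> using \<theta> by unfold_locales
  define e where "e = case_sum \<sigma> \<theta>"
  have e: "e \<in> carrier A <+> carrier B \<rightarrow> carrier G" by (auto simp: e_def)
  obtain \<tau> where \<tau>: "\<tau> \<in> hom (presented_monoid (carrier A <+> carrier B) (amalgam_rels A B C \<phi>)) G"
    "\<And>w. w \<in> lists (carrier A <+> carrier B) \<Longrightarrow>
      \<tau> (word_cong (carrier A <+> carrier B) (amalgam_rels A B C \<phi>) `` {w}) = word_value G e w"
  proof (rule presented_monoid_hom[OF e, where R = "amalgam_rels A B C \<phi>"], goal_cases)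
    case (1 l r)
    then have "(l, r) \<in> amalgam_rels A B C \<phi>" by simp
    moreover have "\<sigma> c \<in> carrier G" "\<theta> (\<phi> c) \<in> carrier G" if "c \<in> C" for c using C that by auto
    ultimately show ?case using agree by (auto simp: amalgam_rels_def e_def)
  next
    case 2
    show ?case by (rule 2(1)[OF 2(2,3)])
  qed
  have "\<tau> (amalgam_inl A B C \<phi> x) = \<sigma> x" if "x \<in> carrier A" for x
    using \<tau>(2)[of "[Inl x]"] that by (simp add: amalgam_inl_def e_def InlI)
  moreover have "\<tau> (amalgam_inr A B C \<phi> y) = \<theta> y" if "y \<in> carrier B" for y
    using \<tau>(2)[of "[Inr y]"] that by (simp add: amalgam_inr_def e_def InrI)
  ultimately show ?thesis using that \<tau>(1) by (simp add: amalgamated_product_def)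
qed

lemma presented_class_eq:
  assumes "(l, r) \<in> R" "l \<in> lists A" "r \<in> lists A"
  shows "word_cong A R `` {l} = word_cong A R `` {r}"
proof -
  have "([] @ l @ [], [] @ r @ []) \<in> word_cong A R" using assms by (intro word_cong.rel) auto
  then show ?thesis by (intro equiv_class_eq[OF equiv_word_cong]) simp
qed

lemma amalgam_inl_hom: "amalgam_inl A B C \<phi> \<in> hom A (amalgamated_product A B C \<phi>)" if "group A"
proof (rule homI)
  interpret A: group A by fact
  fix x assume x: "x \<in> carrier A"
  then show "amalgam_inl A B C \<phi> x \<in> carrier (amalgamated_product A B C \<phi>)"
    by (auto simp: amalgam_inl_def amalgamated_product_def presented_monoid_def intro!: quotientI)
  fix y assume y: "y \<in> carrier A"
  have l: "[Inl x] \<in> lists (carrier A <+> carrier B)" "[Inl y] \<in> lists (carrier A <+> carrier B)"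
    "[Inl x, Inl y] \<in> lists (carrier A <+> carrier B)" "[Inl (x \<otimes>\<^bsub>A\<^esub> y)] \<in> lists (carrier A <+> carrier B)"
    using x y by auto
  have r: "([Inl x, Inl y], [Inl (x \<otimes>\<^bsub>A\<^esub> y)]) \<in> amalgam_rels A B C \<phi>"
    using x y by (auto simp: amalgam_rels_def)
  show "amalgam_inl A B C \<phi> (x \<otimes>\<^bsub>A\<^esub> y)
      = amalgam_inl A B C \<phi> x \<otimes>\<^bsub>amalgamated_product A B C \<phi>\<^esub> amalgam_inl A B C \<phi> y"
    unfolding amalgam_inl_def amalgamated_product_def presented_monoid_mult[OF l(1,2)]
      presented_class_eq[OF r l(3,4), symmetric] by simp
qed

lemma amalgam_inr_hom: "amalgam_inr A B C \<phi> \<in> hom B (amalgamated_product A B C \<phi>)" if "group B"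
proof (rule homI)
  interpret B: group B by fact
  fix x assume x: "x \<in> carrier B"
  then show "amalgam_inr A B C \<phi> x \<in> carrier (amalgamated_product A B C \<phi>)"
    by (auto simp: amalgam_inr_def amalgamated_product_def presented_monoid_def intro!: quotientI)
  fix y assume y: "y \<in> carrier B"
  have l: "[Inr x] \<in> lists (carrier A <+> carrier B)" "[Inr y] \<in> lists (carrier A <+> carrier B)"
    "[Inr x, Inr y] \<in> lists (carrier A <+> carrier B)" "[Inr (x \<otimes>\<^bsub>B\<^esub> y)] \<in> lists (carrier A <+> carrier B)"
    using x y by auto
  have r: "([Inr x, Inr y], [Inr (x \<otimes>\<^bsub>B\<^esub> y)]) \<in> amalgam_rels A B C \<phi>"
    using x y by (auto simp: amalgam_rels_def)
  show "amalgam_inr A B C \<phi> (x \<otimes>\<^bsub>B\<^esub> y)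
      = amalgam_inr A B C \<phi> x \<otimes>\<^bsub>amalgamated_product A B C \<phi>\<^esub> amalgam_inr A B C \<phi> y"
    unfolding amalgam_inr_def amalgamated_product_def presented_monoid_mult[OF l(1,2)]
      presented_class_eq[OF r l(3,4), symmetric] by simp
qed

lemma amalgam_identify:
  assumes "c \<in> C" "c \<in> carrier A" "\<phi> c \<in> carrier B"
  shows "amalgam_inl A B C \<phi> c = amalgam_inr A B C \<phi> (\<phi> c)"
  unfolding amalgam_inl_def amalgam_inr_def
  using assms by (intro presented_class_eq) (auto simp: amalgam_rels_def)

lemma presented_group_generated:
  assumes grp: "group (presented_monoid A R)"
    and gen: "\<And>x. x \<in> A \<Longrightarrow> word_cong A R `` {[x]} \<in> generate (presented_monoid A R) T"
  shows "carrier (presented_monoid A R) \<subseteq> generate (presented_monoid A R) T"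
proof
  fix X assume "X \<in> carrier (presented_monoid A R)"
  then obtain w where w: "w \<in> lists A" "X = word_cong A R `` {w}"
    by (auto simp: presented_monoid_def quotient_def)
  have "word_cong A R `` {w} \<in> generate (presented_monoid A R) T"
    using w(1)
  proof (induction w)
    case Nil
    have "word_cong A R `` {[]} = \<one>\<^bsub>presented_monoid A R\<^esub>" by (simp add: presented_monoid_def)
    then show ?case by (simp add: generate.one)
  next
    case (Cons x w)
    have "word_cong A R `` {x # w}
        = word_cong A R `` {[x]} \<otimes>\<^bsub>presented_monoid A R\<^esub> word_cong A R `` {w}"
      using Cons presented_monoid_mult[of "[x]" A w R] by simp
    then show ?case using Cons gen by (simp add: generate.eng)
  qed
  then show "X \<in> generate (presented_monoid A R) T" using w by simp
qed

lemma free_group_generated: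
  "carrier (free_group S) = generate (free_group S) (free_gen S ` S)"
proof
  interpret F: group "free_group S" by (rule group_free_group)
  let ?A = "S \<times> (UNIV :: bool set)" and ?R = "free_group_rels S"
  show "generate (free_group S) (free_gen S ` S) \<subseteq> carrier (free_group S)"
    by (rule F.generate_incl) (auto intro: free_gen_closed)
  have "word_cong ?A ?R `` {[x]} \<in> generate (free_group S) (free_gen S ` S)" if "x \<in> ?A" for x
  proof -
    obtain s e where x: "x = (s, e)" "s \<in> S" using \<open>x \<in> ?A\<close> by auto
    show ?thesis
    proof (cases e)
      case True
      then show ?thesis using x by (auto simp: free_gen_def intro!: generate.incl)
    next
      case False
      have l: "[(s, False)] \<in> lists ?A" "[(s, True)] \<in> lists ?A" "[(s, False), (s, True)] \<in> lists ?A"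
        "[] \<in> lists ?A" using x by auto
      have r: "([(s, False), (s, True)], []) \<in> ?R"
        using x(2) by (force simp: free_group_rels_def)
      have "word_cong ?A ?R `` {[x]} \<otimes>\<^bsub>free_group S\<^esub> free_gen S s = \<one>\<^bsub>free_group S\<^esub>"
        using presented_monoid_mult[OF l(1,2), of ?R] presented_class_eq[OF r l(3,4)] x False
        by (simp add: free_gen_def free_group_def presented_monoid_def)
      moreover have "word_cong ?A ?R `` {[x]} \<in> carrier (free_group S)"
        using x by (auto simp: free_group_def presented_monoid_def intro!: quotientI)
      ultimately have "word_cong ?A ?R `` {[x]} = inv\<^bsub>free_group S\<^esub> (free_gen S s)"
        using F.inv_equality free_gen_closed[OF x(2)] by metis
      then show ?thesis using x(2) by (auto intro: generate.inv)
    qed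
  qed
  then show "carrier (free_group S) \<subseteq> generate (free_group S) (free_gen S ` S)"
    using presented_group_generated[of ?A ?R] group_free_group[of S] by (simp add: free_group_def)
qed

lemma hom_eq_on_generate:
  assumes "group A" "group B" "f \<in> hom A B" "g \<in> hom A B" "S \<subseteq> carrier A"
    and "\<And>s. s \<in> S \<Longrightarrow> f s = g s" and "x \<in> generate A S"
  shows "f x = g x"
proof -
  interpret A: group A by fact
  interpret f: group_hom A B f using assms by (simp add: group_hom_def group_hom_axioms_def)
  interpret g: group_hom A B g using assms by (simp add: group_hom_def group_hom_axioms_def)
  show ?thesis using assms(7)
  proof (induction rule: generate.induct)
    case (eng h1 h2)
    have "h1 \<in> carrier A" "h2 \<in> carrier A" using eng A.generate_in_carrier assms(5) by blast+
    then show ?case using eng by simp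
  qed (use assms in auto)
qed

definition permutation_group :: "('x \<Rightarrow> 'x) monoid" where
  "permutation_group = \<lparr>carrier = {f. bij f}, mult = (\<circ>), one = id\<rparr>"

lemma group_permutation_group: "group permutation_group"
proof (rule groupI)
  fix f :: "'x \<Rightarrow> 'x" assume "f \<in> carrier permutation_group"
  then have f: "bij f" by (simp add: permutation_group_def)
  show "\<exists>g\<in>carrier permutation_group. g \<otimes>\<^bsub>permutation_group\<^esub> f = \<one>\<^bsub>permutation_group\<^esub>"
    by (rule bexI[of _ "inv_into UNIV f"])
       (use f in \<open>auto simp: permutation_group_def bij_imp_bij_inv bij_is_inj\<close>)
qed (auto simp: permutation_group_def bij_comp comp_assoc)

lemma permutation_group_inv:
  assumes "bij f" "\<And>x. g (f x) = x"
  shows "inv\<^bsub>permutation_group\<^esub> f = g"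
proof -
  interpret P: group "permutation_group :: ('x \<Rightarrow> 'x) monoid" by (rule group_permutation_group)
  have "g = inv_into UNIV f" using assms by (metis bij_inv_eq_iff ext)
  then have "bij g" using assms(1) bij_imp_bij_inv by blast
  then show ?thesis using assms by (intro P.inv_equality) (auto simp: permutation_group_def)
qed

text \<open>
  Take \<open>\<int>\<close> many copies of \<open>H\<close>, and let \<open>H\<close> act by left translation on the copy with index \<open>0\<close>. Let \<open>\<alpha>\<close>
  translate all copies with index \<open>n \<ge> 0\<close> by \<open>h\<close>, and let \<open>\<beta>\<close> be the shift. Then \<open>\<beta> \<alpha>\<inverse> \<beta>\<inverse>\<close>
  translates the copies with index \<open>n \<ge> 1\<close> by \<open>h\<inverse>\<close>, and the product with \<open>\<alpha>\<close> leaves only the translation by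
  \<open>h\<close> of the copy with index \<open>0\<close>.
\<close>
lemma element_is_commutator_in_overgroup:
  assumes "group H" and h: "h \<in> carrier H" "h \<noteq> \<one>\<^bsub>H\<^esub>"
  obtains \<sigma> and \<alpha> \<beta> :: "'h \<times> int \<Rightarrow> 'h \<times> int"
  where "\<sigma> \<in> hom (H :: ('h, 'n) monoid_scheme) permutation_group"
    and "\<alpha> \<in> carrier permutation_group" "\<beta> \<in> carrier permutation_group"
    and "commutator permutation_group \<alpha> \<beta> = \<sigma> h" and "\<sigma> h \<noteq> \<one>\<^bsub>permutation_group\<^esub>"
proof -
  interpret H: group H by fact
  define act where "act P x = (\<lambda>(g, n). if g \<in> carrier H \<and> P n then (x \<otimes>\<^bsub>H\<^esub> g, n) else (g, n))"
    for P :: "int \<Rightarrow> bool" and x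
  have act_mult: "act P x (act P y z) = act P (x \<otimes>\<^bsub>H\<^esub> y) z"
    if "x \<in> carrier H" "y \<in> carrier H" for P x y z
    using that by (cases z) (simp add: act_def H.m_assoc)
  have act_one: "act P \<one>\<^bsub>H\<^esub> z = z" for P z by (cases z) (simp add: act_def)
  have act_inv: "act P (inv\<^bsub>H\<^esub> x) (act P x z) = z" "act P x (act P (inv\<^bsub>H\<^esub> x) z) = z"
    if "x \<in> carrier H" for P x z
    using that by (simp_all add: act_mult act_one)
  have act_bij: "bij (act P x)" if "x \<in> carrier H" for P x
    by (rule bijI') (metis act_inv[OF that])+
  define \<sigma> where "\<sigma> = act (\<lambda>n. n = 0)"
  define \<alpha> where "\<alpha> = act (\<lambda>n. 0 \<le> n) h"
  define \<beta> :: "'h \<times> int \<Rightarrow> 'h \<times> int" where "\<beta> = (\<lambda>(g, n). (g, n + 1))"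
  have \<beta>: "bij \<beta>" by (rule bijI') (auto simp: \<beta>_def, metis diff_add_cancel)
  have 1: "inv\<^bsub>permutation_group\<^esub> \<alpha> = act (\<lambda>n. 0 \<le> n) (inv\<^bsub>H\<^esub> h)"
    unfolding \<alpha>_def using act_bij[OF h(1)] act_inv(1)[OF h(1)] by (rule permutation_group_inv)
  have 2: "inv\<^bsub>permutation_group\<^esub> \<beta> = (\<lambda>(g, n). (g, n - 1))"
    by (rule permutation_group_inv[OF \<beta>]) (auto simp: \<beta>_def)
  show ?thesis
  proof (rule that[of \<sigma> \<alpha> \<beta>])
    show "\<sigma> \<in> hom H permutation_group"
      by (rule homI) (auto simp: permutation_group_def \<sigma>_def act_bij act_mult)
    show "\<alpha> \<in> carrier permutation_group" "\<beta> \<in> carrier permutation_group"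
      using \<beta> act_bij[OF h(1)] by (simp_all add: permutation_group_def \<alpha>_def)
    show "commutator permutation_group \<alpha> \<beta> = \<sigma> h"
    proof
      fix z :: "'h \<times> int"
      obtain g n where z: "z = (g, n)" by (cases z)
      have "commutator permutation_group \<alpha> \<beta> z = \<alpha> (\<beta> (act (\<lambda>n. 0 \<le> n) (inv\<^bsub>H\<^esub> h) (g, n - 1)))"
        unfolding commutator_def 1 2 by (simp add: permutation_group_def z)
      also have "\<dots> = \<sigma> h z"
        using h(1) by (simp add: z \<sigma>_def \<alpha>_def \<beta>_def act_def H.m_assoc[symmetric])
      finally show "commutator permutation_group \<alpha> \<beta> z = \<sigma> h z" .
    qed
    have "\<sigma> h (\<one>\<^bsub>H\<^esub>, 0) \<noteq> (\<one>\<^bsub>H\<^esub>, 0)" using h by (simp add: \<sigma>_def act_def)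
    then show "\<sigma> h \<noteq> \<one>\<^bsub>permutation_group\<^esub>" by (auto simp: permutation_group_def)
  qed
qed

lemma hom_commutator:
  assumes "group A" "group B" "f \<in> hom A B" "x \<in> carrier A" "y \<in> carrier A"
  shows "f (commutator A x y) = commutator B (f x) (f y)"
proof -
  interpret A: group A by fact
  interpret f: group_hom A B f using assms by (simp add: group_hom_def group_hom_axioms_def)
  show ?thesis using assms by (simp add: commutator_def)
qed

text \<open>
  A group \<open>G\<close> with an isomorphism \<open>\<psi>\<close> from the amalgam. The maps \<open>\<iota>\<close> and \<open>\<kappa>\<close> below are the canonical
  homomorphisms of the two factors to \<open>G\<close>, and \<open>\<a>\<close>, \<open>\<b>\<close> are the images of the free generators.
\<close>
locale commutator_amalgam =
  G: group G + H: group H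
  for G :: "('g, 'm) monoid_scheme" and H :: "('h, 'n) monoid_scheme" +
  fixes h :: 'h and a b :: 's and F c \<phi> \<psi>
  assumes F_def: "F = free_group {a, b}"
    and c_def: "c = commutator (free_group {a, b}) (free_gen {a, b} a) (free_gen {a, b} b)"
    and h: "h \<in> carrier H" "h \<noteq> \<one>\<^bsub>H\<^esub>" and ab: "a \<noteq> b"
    and \<phi>: "\<phi> \<in> hom (subgroup_generated H {h}) (subgroup_generated F {c})" and \<phi>h: "\<phi> h = c"
    and \<psi>: "\<psi> \<in> iso (amalgamated_product H F (generate H {h}) \<phi>) G"
begin

abbreviation P where "P \<equiv> amalgamated_product H F (generate H {h}) \<phi>"

definition \<iota> where "\<iota> x = \<psi> (amalgam_inl H F (generate H {h}) \<phi> x)"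
definition \<kappa> where "\<kappa> y = \<psi> (amalgam_inr H F (generate H {h}) \<phi> y)"
definition \<a> where "\<a> = \<kappa> (free_gen {a, b} a)"
definition \<b> where "\<b> = \<kappa> (free_gen {a, b} b)"

sublocale F: group F unfolding F_def by (rule group_free_group)
sublocale P: group P by (rule group_amalgamated_product) unfold_locales

lemma \<psi>_hom: "\<psi> \<in> hom P G" and \<psi>_bij: "bij_betw \<psi> (carrier P) (carrier G)"
  using \<psi> by (auto simp: iso_def)

lemma \<iota>_hom: "\<iota> \<in> hom H G"
  using hom_compose[OF amalgam_inl_hom[OF H.group_axioms] \<psi>_hom] by (simp add: \<iota>_def[abs_def] comp_def)

lemma \<kappa>_hom: "\<kappa> \<in> hom F G"
  using hom_compose[OF amalgam_inr_hom[OF F.group_axioms] \<psi>_hom] by (simp add: \<kappa>_def[abs_def] comp_def)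

lemma gens_closed: "free_gen {a, b} a \<in> carrier F" "free_gen {a, b} b \<in> carrier F"
  by (auto simp: F_def intro: free_gen_closed)

lemma c_eq: "c = commutator F (free_gen {a, b} a) (free_gen {a, b} b)"
  by (simp only: c_def F_def)

lemma c_closed: "c \<in> carrier F"
  unfolding c_eq commutator_def using gens_closed by simp

lemma ab_closed: "\<a> \<in> carrier G" "\<b> \<in> carrier G"
  using gens_closed \<kappa>_hom by (auto simp: \<a>_def \<b>_def hom_def)

lemma \<phi>_closed: "x \<in> generate H {h} \<Longrightarrow> \<phi> x \<in> carrier F"
  using hom_carrier[OF \<phi>] h(1) c_closed F.generate_incl[of "{c}"]
  by (auto simp: carrier_subgroup_generated)

lemma commutator_ab: "commutator G \<a> \<b> = \<iota> h"
proof -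
  have "commutator G \<a> \<b> = \<kappa> c"
    using hom_commutator[OF F.group_axioms G.group_axioms \<kappa>_hom gens_closed]
    by (simp add: \<a>_def \<b>_def c_eq)
  also have "\<dots> = \<iota> h"
    unfolding \<iota>_def \<kappa>_def
    using amalgam_identify[of h "generate H {h}" H \<phi> F] h(1) \<phi>h c_closed by (simp add: generate.incl)
  finally show ?thesis .
qed

lemma generated: "carrier G = generate G (\<iota> ` carrier H \<union> {\<a>, \<b>})"
proof
  let ?C = "generate H {h}"
  let ?T = "amalgam_inl H F ?C \<phi> ` carrier H \<union>
    {amalgam_inr H F ?C \<phi> (free_gen {a, b} a), amalgam_inr H F ?C \<phi> (free_gen {a, b} b)}"
  have T: "?T \<subseteq> carrier P"
    using amalgam_inl_hom[OF H.group_axioms, of F ?C \<phi>] amalgam_inr_hom[OF F.group_axioms, of H ?C \<phi>] gens_closed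
    by (auto simp: hom_def)
  have "carrier P \<subseteq> generate P ?T"
    unfolding amalgamated_product_def
  proof (rule presented_group_generated)
    show "group (presented_monoid (carrier H <+> carrier F) (amalgam_rels H F ?C \<phi>))"
      using P.group_axioms by (simp add: amalgamated_product_def)
    fix x assume "x \<in> carrier H <+> carrier F"
    then show "word_cong (carrier H <+> carrier F) (amalgam_rels H F ?C \<phi>) `` {[x]}
      \<in> generate (presented_monoid (carrier H <+> carrier F) (amalgam_rels H F ?C \<phi>)) ?T"
    proof
      fix y assume "x = Inl y" "y \<in> carrier H"
      then show ?thesis by (intro generate.incl) (auto simp: amalgam_inl_def)
    next
      fix y assume y: "x = Inr y" "y \<in> carrier F"
      interpret r: group_hom F P "amalgam_inr H F ?C \<phi>"
        using amalgam_inr_hom[OF F.group_axioms, of H ?C \<phi>] by unfold_locales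
      have "y \<in> generate F {free_gen {a, b} a, free_gen {a, b} b}"
        using y(2) free_group_generated[of "{a, b}"] by (simp add: F_def)
      then have "amalgam_inr H F ?C \<phi> y
          \<in> generate P (amalgam_inr H F ?C \<phi> ` {free_gen {a, b} a, free_gen {a, b} b})"
        using r.generate_img[of "{free_gen {a, b} a, free_gen {a, b} b}"] gens_closed by blast
      then have "amalgam_inr H F ?C \<phi> y \<in> generate P ?T"
        by (rule set_mp[OF P.mono_generate, rotated]) auto
      then show ?thesis using y(1) by (simp add: amalgam_inr_def amalgamated_product_def)
    qed
  qed
  then have "generate P ?T = carrier P" using P.generate_incl[OF T] by blast
  moreover interpret \<psi>: group_hom P G \<psi> using \<psi>_hom by unfold_locales
  have "\<psi> ` generate P ?T = generate G (\<psi> ` ?T)" by (rule \<psi>.generate_img[OF T, symmetric])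
  moreover have "\<psi> ` ?T = \<iota> ` carrier H \<union> {\<a>, \<b>}"
    by (auto simp: \<iota>_def \<kappa>_def \<a>_def \<b>_def)
  ultimately show "carrier G \<subseteq> generate G (\<iota> ` carrier H \<union> {\<a>, \<b>})"
    "generate G (\<iota> ` carrier H \<union> {\<a>, \<b>}) \<subseteq> carrier G"
    using \<psi>_bij by (simp_all add: bij_betw_def)
qed

text \<open>
  The universal properties of the free group and of the amalgam combined. The two homomorphisms that
  they involve agree on the amalgamated cyclic subgroup because they agree on its generator \<open>h\<close>.
\<close>
theorem universal:
  assumes "group K" and \<sigma>: "\<sigma> \<in> hom H K" and \<alpha>: "\<alpha> \<in> carrier K" and \<beta>: "\<beta> \<in> carrier K"
    and comm: "commutator K \<alpha> \<beta> = \<sigma> h"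
  obtains \<tau> where "\<tau> \<in> hom G K" and "\<And>x. x \<in> carrier H \<Longrightarrow> \<tau> (\<iota> x) = \<sigma> x"
    and "\<tau> \<a> = \<alpha>" and "\<tau> \<b> = \<beta>"
proof -
  interpret K: group K by fact
  obtain \<theta> where \<theta>: "\<theta> \<in> hom F K" "\<theta> (free_gen {a, b} a) = \<alpha>" "\<theta> (free_gen {a, b} b) = \<beta>"
    unfolding F_def
    by (rule K.free_group_hom[of "\<lambda>s. if s = a then \<alpha> else \<beta>" "{a, b}"]) (use \<alpha> \<beta> ab in auto)
  let ?HS = "subgroup_generated H {h}"
  have gHS: "group ?HS" by (rule H.group_subgroup_generated)
  have cHS: "carrier ?HS = generate H {h}" using h by (simp add: carrier_subgroup_generated)
  have "generate ?HS {h} = generate H {h}"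
    using H.subgroup_generated2[of "{h}"] h cHS generate.incl[of h "{h}" H]
    by (metis Int_insert_right_if1 Int_empty_right carrier_subgroup_generated insertI1)
  moreover have "\<theta> c = \<sigma> h"
    using hom_commutator[OF F.group_axioms K.group_axioms \<theta>(1) gens_closed] comm \<theta>(2,3)
    by (simp add: c_def F_def)
  moreover have "\<sigma> \<in> hom ?HS K"
    using \<sigma> H.generate_incl[of "{h}"] h by (auto simp: hom_def cHS)
  moreover have "\<theta> \<circ> \<phi> \<in> hom ?HS K"
  proof (rule homI)
    fix x y assume "x \<in> carrier ?HS" "y \<in> carrier ?HS"
    then show "(\<theta> \<circ> \<phi>) x \<in> carrier K" "(\<theta> \<circ> \<phi>) (x \<otimes>\<^bsub>?HS\<^esub> y) = (\<theta> \<circ> \<phi>) x \<otimes>\<^bsub>K\<^esub> (\<theta> \<circ> \<phi>) y"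
      using \<theta>(1) hom_mult[OF \<phi>, of x y] \<phi>_closed cHS by (auto simp: hom_def)
  qed
  ultimately have agree: "\<sigma> x = \<theta> (\<phi> x)" if "x \<in> generate H {h}" for x
    using hom_eq_on_generate[OF gHS K.group_axioms, of \<sigma> "\<theta> \<circ> \<phi>" "{h}" x] that cHS \<phi>h
    by (auto simp: generate.incl)
  obtain \<tau> where \<tau>: "\<tau> \<in> hom P K"
    "\<And>x. x \<in> carrier H \<Longrightarrow> \<tau> (amalgam_inl H F (generate H {h}) \<phi> x) = \<sigma> x"
    "\<And>y. y \<in> carrier F \<Longrightarrow> \<tau> (amalgam_inr H F (generate H {h}) \<phi> y) = \<theta> y"
    using K.amalgam_hom[OF \<sigma> \<theta>(1) H.group_axioms F.group_axioms agree] H.generate_incl[of "{h}"] h \<phi>_closed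
    by (metis empty_subsetI image_subsetI insert_subset)
  let ?inv = "inv_into (carrier P) \<psi>"
  have inv: "?inv \<in> hom G P" using P.iso_set_sym[OF \<psi>] by (simp add: iso_def)
  have inv\<psi>: "?inv (\<psi> X) = X" if "X \<in> carrier P" for X
    using \<psi>_bij that by (simp add: bij_betw_def)
  show ?thesis
  proof (rule that[of "\<tau> \<circ> ?inv"])
    show "\<tau> \<circ> ?inv \<in> hom G K" by (rule hom_compose[OF inv \<tau>(1)])
    show "(\<tau> \<circ> ?inv) (\<iota> x) = \<sigma> x" if "x \<in> carrier H" for x
      using that \<tau>(2) hom_in_carrier[OF amalgam_inl_hom[OF H.group_axioms] that, of F "generate H {h}" \<phi>]
      by (simp add: \<iota>_def inv\<psi>)
    have "(\<tau> \<circ> ?inv) (\<kappa> y) = \<theta> y" if "y \<in> carrier F" for y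
      using that \<tau>(3) hom_in_carrier[OF amalgam_inr_hom[OF F.group_axioms] that, of H "generate H {h}" \<phi>]
      by (simp add: \<kappa>_def inv\<psi>)
    then show "(\<tau> \<circ> ?inv) \<a> = \<alpha>" "(\<tau> \<circ> ?inv) \<b> = \<beta>" using gens_closed \<theta> by (simp_all add: \<a>_def \<b>_def)
  qed
qed

text \<open>
  By the universal property, a group in which the image of \<open>h\<close> is a non-trivial commutator detects
  \<open>\<iota> h\<close>. This takes the place of the normal form theorem for amalgams.
\<close>
theorem \<iota>_h_nontrivial: "\<iota> h \<noteq> \<one>\<^bsub>G\<^esub>"
proof
  assume triv: "\<iota> h = \<one>\<^bsub>G\<^esub>"
  interpret S: group "permutation_group :: ('h \<times> int \<Rightarrow> 'h \<times> int) monoid" by (rule group_permutation_group)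
  obtain \<sigma> and \<alpha> \<beta> :: "'h \<times> int \<Rightarrow> 'h \<times> int" where \<sigma>: "\<sigma> \<in> hom H permutation_group"
    and \<alpha>\<beta>: "\<alpha> \<in> carrier permutation_group" "\<beta> \<in> carrier permutation_group"
    and comm: "commutator permutation_group \<alpha> \<beta> = \<sigma> h" and ne: "\<sigma> h \<noteq> \<one>\<^bsub>permutation_group\<^esub>"
    by (rule element_is_commutator_in_overgroup[OF H.group_axioms h])
  obtain \<tau> where "\<tau> \<in> hom G permutation_group" "\<tau> (\<iota> h) = \<sigma> h"
    using universal[OF S.group_axioms \<sigma> \<alpha>\<beta> comm] h(1) by metis
  then show False using ne triv hom_one[OF _ G.group_axioms S.group_axioms] by metis
qed

end

section \<open>Dynamical realization of a left order\<close>

definition line_group :: "(real \<Rightarrow> real) monoid" where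
  "line_group = \<lparr>carrier = Collect line_homeo, mult = (\<circ>), one = id\<rparr>"

lemma line_group_simps [simp]:
  "carrier line_group = Collect line_homeo" "mult line_group = (\<circ>)" "one line_group = id"
  by (simp_all add: line_group_def)

lemma group_line_group: "group line_group"
proof (rule groupI)
  fix f g assume "f \<in> carrier line_group" "g \<in> carrier line_group"
  then show "f \<otimes>\<^bsub>line_group\<^esub> g \<in> carrier line_group"
    using line_homeo_comp[of f g] by (simp add: comp_def)
next
  fix f assume "f \<in> carrier line_group"
  then have f: "line_homeo f" by simp
  show "\<exists>g\<in>carrier line_group. g \<otimes>\<^bsub>line_group\<^esub> f = \<one>\<^bsub>line_group\<^esub>"
    by (rule bexI[of _ "bwd f"]) (auto simp: bwd_homeo[OF f] line_homeo_bwd[OF f])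
next
  show "\<one>\<^bsub>line_group\<^esub> \<in> carrier line_group" using line_homeo_id by (simp add: id_def)
qed (simp_all add: comp_assoc)

lemma line_group_inv: "line_homeo f \<Longrightarrow> inv\<^bsub>line_group\<^esub> f = bwd f"
proof -
  assume f: "line_homeo f"
  interpret group line_group by (rule group_line_group)
  show ?thesis
    by (rule inv_equality) (use f in \<open>auto simp: line_homeo_bwd bwd_homeo\<close>)
qed

text \<open>
  The extension is \<open>x \<mapsto> Sup (\<pi> ` {d \<in> D. d \<le> x})\<close>; density of the image is what makes it surjective.
\<close>
lemma extend_from_dense:
  assumes dense: "\<And>x y. x < y \<Longrightarrow> \<exists>d\<in>D. x < d \<and> d < y"
    and mono: "\<And>x y. x \<in> D \<Longrightarrow> y \<in> D \<Longrightarrow> x < y \<Longrightarrow> \<pi> x < \<pi> y" and onto: "\<pi> ` D = D"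
  shows "\<exists>f. line_homeo f \<and> (\<forall>d\<in>D. f d = (\<pi> d :: real))"
proof -
  define f where "f x = Sup (\<pi> ` {d \<in> D. d \<le> x})" for x
  have mono': "\<pi> c \<le> \<pi> d" if "c \<in> D" "d \<in> D" "c \<le> d" for c d
    using mono[OF that(1,2)] that(3) by (cases "c = d") auto
  have ne: "\<pi> ` {d \<in> D. d \<le> x} \<noteq> {}" for x using dense[of "x - 1" x] by auto
  have upper: "y \<le> \<pi> d" if "d \<in> D" "x \<le> d" "y \<in> \<pi> ` {d \<in> D. d \<le> x}" for d x y
    using that mono'[of _ d] by auto
  have bdd: "bdd_above (\<pi> ` {d \<in> D. d \<le> x})" for x
  proof -
    obtain d where d: "d \<in> D" "x < d" using dense[of x "x + 1"] by auto
    show ?thesis by (rule bdd_aboveI[of _ "\<pi> d"]) (rule upper[OF d(1) less_imp_le[OF d(2)]])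
  qed
  have f_ge: "\<pi> d \<le> f x" if "d \<in> D" "d \<le> x" for d x
    unfolding f_def using that by (intro cSup_upper[OF _ bdd]) auto
  have f_le: "f x \<le> \<pi> d" if "d \<in> D" "x \<le> d" for d x
    unfolding f_def by (rule cSup_least[OF ne upper[OF that]])
  have f_eq: "f d = \<pi> d" if "d \<in> D" for d
    using f_ge[OF that, of d] f_le[OF that, of d] by simp
  have "line_homeo f"
  proof (rule line_homeoI)
    fix x y :: real assume "x < y"
    obtain c where c: "c \<in> D" "x < c" "c < y" using dense[OF \<open>x < y\<close>] by auto
    obtain d where d: "d \<in> D" "c < d" "d < y" using dense[OF c(3)] by auto
    show "f x < f y"
      using f_le[OF c(1), of x] mono[OF c(1) d(1,2)] f_ge[OF d(1), of y] c d by linarith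
  next
    fix y :: real
    define B where "B = {d \<in> D. \<pi> d \<le> y}"
    have pick: "\<exists>d\<in>D. u < \<pi> d \<and> \<pi> d < v" if uv: "u < v" for u v
    proof -
      obtain e where e: "e \<in> D" "u < e" "e < v" using dense[OF uv] by auto
      then obtain d where "d \<in> D" "e = \<pi> d" using onto by (metis imageE)
      then show ?thesis using e by blast
    qed
    obtain d0 where d0: "d0 \<in> D" "\<pi> d0 < y" using pick[of "y - 1" y] by auto
    obtain d1 where d1: "d1 \<in> D" "y < \<pi> d1" using pick[of y "y + 1"] by auto
    have below: "b \<le> d" if "b \<in> B" "d \<in> D" "y < \<pi> d" for b d
      using mono'[of d b] that by (auto simp: B_def not_le[symmetric] intro: ccontr)
    have bddB: "bdd_above B" using below[OF _ d1] by (rule bdd_aboveI)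
    have neB: "B \<noteq> {}" using d0 by (auto simp: B_def)
    define x where "x = Sup B"
    have "\<not> f x < y"
    proof
      assume "f x < y"
      then obtain d where d: "d \<in> D" "f x < \<pi> d" "\<pi> d < y" using pick by blast
      then have "d \<le> x" unfolding x_def by (intro cSup_upper[OF _ bddB]) (simp add: B_def)
      then show False using f_ge[OF d(1)] d(2) by (simp add: not_le[symmetric])
    qed
    moreover have "\<not> y < f x"
    proof
      assume "y < f x"
      then obtain d where d: "d \<in> D" "y < \<pi> d" "\<pi> d < f x" using pick by blast
      have "x \<le> d" unfolding x_def by (rule cSup_least[OF neB]) (rule below[OF _ d(1,2)])
      then show False using f_le[OF d(1)] d(3) by (simp add: not_le[symmetric])
    qed
    ultimately show "\<exists>x. f x = y" by (intro exI[of _ x]) simp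
  qed
  then show ?thesis using f_eq by blast
qed

lemma homeo_eq_on_dense:
  assumes dense: "\<And>x y :: real. x < y \<Longrightarrow> \<exists>d\<in>D. x < d \<and> d < y"
    and f: "line_homeo f" and g: "line_homeo g" and eq: "\<And>d. d \<in> D \<Longrightarrow> f d = g d"
  shows "f = g"
proof -
  have "\<not> u x < v x" if u: "line_homeo u" and v: "line_homeo v" and uv: "\<And>d. d \<in> D \<Longrightarrow> u d = v d" for u v x
  proof
    assume "u x < v x"
    then have "bwd v (u x) < x" by (simp add: bwd_less[OF v])
    then obtain d where d: "d \<in> D" "bwd v (u x) < d" "d < x" using dense by blast
    then have "u x < v d" "u d < u x" by (simp_all add: bwd_less[OF v] homeo_less[OF u])
    then show False using uv[OF d(1)] by simp
  qed
  from this[OF f g eq] this[OF g f eq[symmetric]] show ?thesis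
    by (intro ext) (meson linorder_neqE)
qed

lemma finite_linear_order_max:
  assumes r: "linear_order_on C r" and "finite F" "F \<noteq> {}" "F \<subseteq> C"
  shows "\<exists>g\<in>F. \<forall>k\<in>F. (k, g) \<in> r"
  using assms(2-4)
proof (induction rule: finite_ne_induct)
  case (singleton x)
  then show ?case using r by (auto simp: order_on_defs refl_on_def)
next
  case (insert x F)
  then obtain g where g: "g \<in> F" "\<And>k. k \<in> F \<Longrightarrow> (k, g) \<in> r" by auto
  then have "g \<in> C" "x \<in> C" using insert.prems by auto
  moreover have "x \<noteq> g" using insert.hyps g(1) by auto
  moreover have "total_on C r" "refl_on C r" using r by (simp_all add: order_on_defs)
  ultimately have *: "(x, x) \<in> r" "(x, g) \<in> r \<or> (g, x) \<in> r"
    unfolding total_on_def refl_on_def by blast+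
  have "trans r" using r by (auto simp: order_on_defs)
  show ?case
  proof (cases "(x, g) \<in> r")
    case True
    then show ?thesis using g by (intro bexI[of _ g]) auto
  next
    case False
    then have "(g, x) \<in> r" using * by blast
    then have "(k, x) \<in> r" if "k \<in> F" for k using transD[OF \<open>trans r\<close> g(2)[OF that]] by blast
    then show ?thesis using * by (intro bexI[of _ x]) auto
  qed
qed

text \<open>
  Give the elements of \<open>C\<close> positive weights \<open>w\<close> of finite total mass \<open>T\<close>, and place them one after the other,
  in the order \<open>r\<close>, as open intervals of these lengths: the interval of \<open>g\<close> starts at \<open>L g\<close>, the
  total weight of the elements below \<open>g\<close>. The intervals are disjoint subsets of \<open>{0<..<T}\<close> of total length \<open>T\<close>, so their
  union is dense. Finally \<open>{0<..<T}\<close> is identified with the whole line by the logistic function \<open>\<Lambda>\<close>.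
\<close>
lemma dense_embedding:
  assumes r: "linear_order_on C r" and "countable C" "C \<noteq> {}"
  obtains e :: "'g \<Rightarrow> real \<Rightarrow> real"
  where "\<And>g s t. g \<in> C \<Longrightarrow> 0 < s \<Longrightarrow> s < t \<Longrightarrow> t < 1 \<Longrightarrow> e g s < e g t"
    and "\<And>k g s t. (k, g) \<in> r \<Longrightarrow> k \<noteq> g \<Longrightarrow> 0 < s \<Longrightarrow> s < 1 \<Longrightarrow> 0 < t \<Longrightarrow> t < 1 \<Longrightarrow> e k s < e g t"
    and "\<And>x y. x < y \<Longrightarrow> \<exists>g\<in>C. \<exists>s. 0 < s \<and> s < 1 \<and> x < e g s \<and> e g s < y"
proof -
  have rC: "r \<subseteq> C \<times> C" and refl: "\<And>x. x \<in> C \<Longrightarrow> (x, x) \<in> r" and "trans r" and "antisym r"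
    and total: "\<And>x y. x \<in> C \<Longrightarrow> y \<in> C \<Longrightarrow> x \<noteq> y \<Longrightarrow> (x, y) \<in> r \<or> (y, x) \<in> r"
    using r by (auto simp: order_on_defs refl_on_def total_on_def)
  define w :: "'g \<Rightarrow> real" where "w g = (1 / 2) ^ to_nat_on C g" for g
  have w: "0 < w g" for g by (simp add: w_def)
  have "(\<lambda>n. (1 / 2 :: real) ^ n) summable_on to_nat_on C ` C"
    by (rule summable_on_subset_banach[OF _ subset_UNIV])
       (simp add: summable_on_UNIV_nonneg_real_iff)
  then have "w summable_on C"
    using summable_on_reindex[OF inj_on_to_nat_on[OF \<open>countable C\<close>], of "\<lambda>n. (1 / 2 :: real) ^ n"]
    by (simp add: w_def[abs_def] comp_def)
  then have summ: "w summable_on A" if "A \<subseteq> C" for A using summable_on_subset_banach that by blast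
  have mono: "infsum w A \<le> infsum w B" if "A \<subseteq> B" "B \<subseteq> C" for A B
    using that w by (intro infsum_mono2 summ) (auto simp: less_imp_le)
  define below where "below g = {k. (k, g) \<in> r \<and> k \<noteq> g}" for g
  have below: "below g \<subseteq> C" for g using rC by (auto simp: below_def)
  define L where "L g = infsum w (below g)" for g
  define T where "T = infsum w C"
  have L_add: "infsum w (insert g (below g)) = L g + w g" if "g \<in> C" for g
    using infsum_Un_disjoint[of w "{g}" "below g"] that summ[OF below[of g]] summ[of "{g}"]
    by (simp add: L_def below_def)
  have L_less: "L k + w k \<le> L g" if "(k, g) \<in> r" "k \<noteq> g" for k g
  proof -
    have "k \<in> C" using that rC by auto
    have "insert k (below k) \<subseteq> below g"
      using that transD[OF \<open>trans r\<close>] antisymD[OF \<open>antisym r\<close>] by (auto simp: below_def)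
    from mono[OF this below] show ?thesis using L_add[OF \<open>k \<in> C\<close>] by (simp add: L_def)
  qed
  have L_T: "L g + w g \<le> T" if "g \<in> C" for g
    unfolding L_add[OF that, symmetric] T_def using that below by (intro mono) auto
  have L_0: "0 \<le> L g" for g unfolding L_def using w by (intro infsum_nonneg) (simp add: less_imp_le)
  have sum_upper: "sum w F \<le> L g + w g"
    if "finite F" "g \<in> C" "\<And>k. k \<in> F \<Longrightarrow> (k, g) \<in> r" for F g
  proof -
    have "F \<subseteq> insert g (below g)" using that by (auto simp: below_def)
    then have "sum w F \<le> infsum w (insert g (below g))"
      using that below w by (intro finite_sum_le_infsum summ) (auto simp: less_imp_le)
    then show ?thesis using L_add that by simp
  qed
  have sum_lower: "sum w F \<le> T - L g"
    if "finite F" "g \<in> C" "F \<subseteq> C" "\<And>k. k \<in> F \<Longrightarrow> (g, k) \<in> r" for F g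
  proof -
    have "F \<subseteq> C - below g" using that antisymD[OF \<open>antisym r\<close>] by (auto simp: below_def)
    then have "sum w F \<le> infsum w (C - below g)"
      using that w by (intro finite_sum_le_infsum summ) (auto simp: less_imp_le)
    moreover have "T = L g + infsum w (C - below g)"
      using infsum_Un_disjoint[of w "below g" "C - below g"] summ[OF below[of g]] summ[of "C - below g"] below[of g]
      by (simp add: T_def L_def Un_absorb1)
    ultimately show ?thesis by simp
  qed
  define E where "E g s = L g + s * w g" for g s
  \<comment> \<open>An interval \<open>{x<..<y}\<close> that misses all intervals splits \<open>C\<close> into elements to its left, of total
    weight at most \<open>x\<close>, and elements to its right, of total weight at most \<open>T - y\<close>.\<close>
  have E_dense: "\<exists>g\<in>C. \<exists>s. 0 < s \<and> s < 1 \<and> x < E g s \<and> E g s < y" if xy: "0 \<le> x" "x < y" "y \<le> T" for x y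
  proof (rule ccontr)
    assume no: "\<not> ?thesis"
    have dich: "L g + w g \<le> x \<or> y \<le> L g" if g: "g \<in> C" for g
    proof (rule ccontr)
      assume "\<not> ?thesis"
      then have "max x (L g) < min y (L g + w g)" using xy w[of g] by auto
      then obtain z where z: "max x (L g) < z" "z < min y (L g + w g)" using dense by blast
      define s where "s = (z - L g) / w g"
      have "E g s = z" "0 < s" "s < 1" using z w[of g] by (simp_all add: s_def E_def)
      then show False using no g z by (metis max_less_iff_conj min_less_iff_conj)
    qed
    define A where "A = {g \<in> C. L g + w g \<le> x}"
    define B where "B = C - A"
    have "infsum w A \<le> x"
    proof (rule infsum_le_finite_sums)
      show "w summable_on A" by (rule summ) (auto simp: A_def)
      show "sum w F \<le> x" if F: "finite F" "F \<subseteq> A" for F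
      proof (cases "F = {}")
        case False
        then obtain g where g: "g \<in> F" "\<forall>k\<in>F. (k, g) \<in> r"
          using finite_linear_order_max[OF r F(1)] F(2) by (auto simp: A_def)
        then have "sum w F \<le> L g + w g" using F by (intro sum_upper) (auto simp: A_def)
        then show ?thesis using g F by (auto simp: A_def)
      qed (use xy in simp)
    qed
    moreover have "infsum w B \<le> T - y"
    proof (rule infsum_le_finite_sums)
      show "w summable_on B" by (rule summ) (auto simp: B_def)
      show "sum w F \<le> T - y" if F: "finite F" "F \<subseteq> B" for F
      proof (cases "F = {}")
        case False
        have "linear_order_on C (r\<inverse>)" using r by simp
        from finite_linear_order_max[OF this F(1) False] F(2)
        obtain g where g: "g \<in> F" "\<forall>k\<in>F. (g, k) \<in> r" by (auto simp: B_def)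
        then have "sum w F \<le> T - L g" using F by (intro sum_lower) (auto simp: B_def)
        moreover have "y \<le> L g" using dich[of g] g F by (auto simp: A_def B_def)
        ultimately show ?thesis by simp
      qed (use xy in simp)
    qed
    moreover have "T = infsum w A + infsum w B"
    proof -
      have "A \<union> B = C" by (auto simp: A_def B_def)
      then show ?thesis using infsum_Un_disjoint[of w A B] summ[of A] summ[of B]
        by (auto simp: T_def A_def B_def)
    qed
    ultimately show False using xy by simp
  qed
  obtain g0 where "g0 \<in> C" using \<open>C \<noteq> {}\<close> by auto
  have T: "0 < T" using L_T[OF \<open>g0 \<in> C\<close>] L_0[of g0] w[of g0] by linarith
  define \<Lambda> where "\<Lambda> x = T / (1 + exp (- x))" for x :: real
  have \<Lambda>_less: "\<Lambda> x < \<Lambda> y \<longleftrightarrow> x < y" for x y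
  proof -
    have "0 < 1 + exp (- x)" "0 < 1 + exp (- y)" by (simp_all add: add_pos_pos)
    then show ?thesis using T by (simp add: \<Lambda>_def divide_less_cancel frac_less2 field_simps)
  qed
  have \<Lambda>_range: "0 < \<Lambda> x" "\<Lambda> x < T" for x
    using T by (simp_all add: \<Lambda>_def add_pos_pos field_simps)
  define logit where "logit z = ln (z / (T - z))" for z
  have \<Lambda>_logit: "\<Lambda> (logit z) = z" if "0 < z" "z < T" for z
    using that by (simp add: \<Lambda>_def logit_def exp_minus field_simps)
  define e where "e g s = logit (E g s)" for g s
  have \<Lambda>_e: "\<Lambda> (e g s) = E g s" if "g \<in> C" "0 < s" "s < 1" for g s
  proof -
    have "0 < s * w g" "s * w g < 1 * w g" using that w[of g] by (simp, intro mult_strict_right_mono)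
    then show ?thesis unfolding e_def using L_0[of g] L_T[OF that(1)]
      by (intro \<Lambda>_logit) (simp_all add: E_def)
  qed
  show ?thesis
  proof (rule that[of e])
    show "e g s < e g t" if "g \<in> C" "0 < s" "s < t" "t < 1" for g s t
    proof -
      have "E g s < E g t" using that w[of g] by (simp add: E_def)
      then have "\<Lambda> (e g s) < \<Lambda> (e g t)" using that \<Lambda>_e by simp
      then show ?thesis by (simp only: \<Lambda>_less)
    qed
    show "e k s < e g t" if kg: "(k, g) \<in> r" "k \<noteq> g" and st: "0 < s" "s < 1" "0 < t" "t < 1" for k g s t
    proof -
      have "k \<in> C" "g \<in> C" using kg rC by auto
      have "s * w k < 1 * w k" using st w[of k] by (intro mult_strict_right_mono) auto
      moreover have "0 < t * w g" using st w[of g] by simp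
      ultimately have "E k s < E g t" using L_less[OF kg] by (simp add: E_def)
      then have "\<Lambda> (e k s) < \<Lambda> (e g t)" using \<open>k \<in> C\<close> \<open>g \<in> C\<close> st \<Lambda>_e by simp
      then show ?thesis by (simp only: \<Lambda>_less)
    qed
    show "\<exists>g\<in>C. \<exists>s. 0 < s \<and> s < 1 \<and> x < e g s \<and> e g s < y" if "x < y" for x y
    proof -
      have "0 \<le> \<Lambda> x" "\<Lambda> x < \<Lambda> y" "\<Lambda> y \<le> T"
        using that \<Lambda>_range[of x] \<Lambda>_range[of y] by (simp_all add: \<Lambda>_less)
      from E_dense[OF this] obtain g s where gs: "g \<in> C" "0 < s" "s < 1" "\<Lambda> x < E g s" "E g s < \<Lambda> y"
        by blast
      then have "\<Lambda> x < \<Lambda> (e g s)" "\<Lambda> (e g s) < \<Lambda> y" using \<Lambda>_e[OF gs(1-3)] by simp_all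
      then have "x < e g s" "e g s < y" by (simp_all only: \<Lambda>_less)
      then show ?thesis using gs by blast
    qed
  qed
qed

lemma left_orderD:
  assumes "r \<in> left_orders G"
  shows "linear_order_on (carrier G) r" and "r \<subseteq> carrier G \<times> carrier G"
    and "\<And>g f h. g \<in> carrier G \<Longrightarrow> (f, h) \<in> r \<Longrightarrow> (g \<otimes>\<^bsub>G\<^esub> f, g \<otimes>\<^bsub>G\<^esub> h) \<in> r"
    and "\<And>f. f \<in> carrier G \<Longrightarrow> (f, f) \<in> r" and "trans r" and "antisym r"
    and "\<And>f h. f \<in> carrier G \<Longrightarrow> h \<in> carrier G \<Longrightarrow> (f, h) \<in> r \<or> (h, f) \<in> r"
proof -
  show "linear_order_on (carrier G) r" "\<And>g f h. g \<in> carrier G \<Longrightarrow> (f, h) \<in> r \<Longrightarrow> (g \<otimes>\<^bsub>G\<^esub> f, g \<otimes>\<^bsub>G\<^esub> h) \<in> r"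
    using assms by (auto simp: left_orders_def)
  then show "r \<subseteq> carrier G \<times> carrier G" "\<And>f. f \<in> carrier G \<Longrightarrow> (f, f) \<in> r" "trans r" "antisym r"
    by (auto simp: order_on_defs refl_on_def)
  have "total_on (carrier G) r" "refl_on (carrier G) r" using \<open>linear_order_on (carrier G) r\<close> by (auto simp: order_on_defs)
  then show "(f, h) \<in> r \<or> (h, f) \<in> r" if "f \<in> carrier G" "h \<in> carrier G" for f h
    using that by (cases "f = h") (auto simp: refl_on_def total_on_def)
qed

text \<open>
  Left multiplication permutes the densely embedded copies of \<open>{0<..<1}\<close>, preserving their order, and
  therefore extends to the line. Extensions from a dense set are unique, which makes this an action.
  The base point is the midpoint of the copy that belongs to the identity.
\<close>
theorem (in group) dynamical_realization:
  assumes "countable (carrier G)" and r: "r \<in> left_orders G" and z: "z \<in> carrier G" "z \<noteq> \<one>"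
  obtains \<rho> x0 where "\<rho> \<in> hom G line_group"
    and "\<And>f g. f \<in> carrier G \<Longrightarrow> g \<in> carrier G \<Longrightarrow> \<rho> f x0 < \<rho> g x0 \<longleftrightarrow> (f, g) \<in> r \<and> f \<noteq> g"
    and "\<And>y. \<exists>g\<in>carrier G. y < \<rho> g x0"
proof -
  let ?C = "carrier G"
  let ?I = "{0<..<1 :: real}"
  note r = left_orderD[OF r]
  obtain e :: "'a \<Rightarrow> real \<Rightarrow> real" where e_mono: "\<And>g s t. g \<in> ?C \<Longrightarrow> 0 < s \<Longrightarrow> s < t \<Longrightarrow> t < 1 \<Longrightarrow> e g s < e g t"
    and e_less: "\<And>k g s t. (k, g) \<in> r \<Longrightarrow> k \<noteq> g \<Longrightarrow> 0 < s \<Longrightarrow> s < 1 \<Longrightarrow> 0 < t \<Longrightarrow> t < 1 \<Longrightarrow> e k s < e g t"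
    and e_dense: "\<And>x y. x < y \<Longrightarrow> \<exists>g\<in>?C. \<exists>s. 0 < s \<and> s < 1 \<and> x < e g s \<and> e g s < y"
  proof (rule dense_embedding[OF r(1) assms(1) carrier_not_empty], goal_cases)
    case (1 e)
    show ?case by (rule 1(1)[of e]) (rule 1(2-4); assumption)+
  qed
  have e_iff: "e k s < e g t \<longleftrightarrow> (k, g) \<in> r \<and> k \<noteq> g \<or> k = g \<and> s < t"
    if "k \<in> ?C" "g \<in> ?C" "s \<in> ?I" "t \<in> ?I" for k g s t
  proof -
    consider "(k, g) \<in> r" "k \<noteq> g" | "(g, k) \<in> r" "k \<noteq> g" "(k, g) \<notin> r" | "k = g" "s < t" | "k = g" "t \<le> s"
      using r(7)[OF \<open>k \<in> ?C\<close> \<open>g \<in> ?C\<close>] by fastforce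
    then show ?thesis
    proof cases
      case 1 then show ?thesis using e_less that by auto
    next
      case 2 then show ?thesis using e_less[of g k t s] that by auto
    next
      case 3 then show ?thesis using e_mono that by auto
    next
      case 4 then show ?thesis using e_mono[of k t s] that by (cases "s = t") auto
    qed
  qed
  have e_inj: "k = g \<and> s = t" if "k \<in> ?C" "g \<in> ?C" "s \<in> ?I" "t \<in> ?I" "e k s = e g t" for k g s t
    using e_iff[OF that(1-4)] e_iff[OF that(2,1,4,3)] that(5) r(7)[OF that(1,2)]
    by (metis linorder_neqE order_less_irrefl)
  define D where "D = (\<lambda>(g, s). e g s) ` (?C \<times> ?I)"
  have inj: "inj_on (\<lambda>(g, s). e g s) (?C \<times> ?I)" using e_inj by (intro inj_onI) auto
  have D_dense: "\<exists>d\<in>D. x < d \<and> d < y" if "x < y" for x y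
    using e_dense[OF that] by (force simp: D_def)
  have DI: "e g s \<in> D" if "g \<in> ?C" "s \<in> ?I" for g s using that by (force simp: D_def)
  have DE: "\<exists>g\<in>?C. \<exists>s\<in>?I. d = e g s" if "d \<in> D" for d using that by (auto simp: D_def)
  define \<pi> where "\<pi> x d = (case inv_into (?C \<times> ?I) (\<lambda>(g, s). e g s) d of (g, s) \<Rightarrow> e (x \<otimes> g) s)" for x d
  have \<pi>_e: "\<pi> x (e g s) = e (x \<otimes> g) s" if "g \<in> ?C" "s \<in> ?I" for x g s
    using inv_into_f_f[OF inj, of "(g, s)"] that by (simp add: \<pi>_def)
  have left: "(x \<otimes> k, x \<otimes> g) \<in> r \<longleftrightarrow> (k, g) \<in> r" if "x \<in> ?C" "k \<in> ?C" "g \<in> ?C" for x k g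
    using r(3)[of x k g] r(3)[of "inv x" "x \<otimes> k" "x \<otimes> g"] that by (auto simp: m_assoc[symmetric])
  have \<pi>_mono: "\<pi> x d < \<pi> x d'" if x: "x \<in> ?C" and d: "d \<in> D" "d' \<in> D" and dd: "d < d'" for x d d'
  proof -
    obtain k s where k: "k \<in> ?C" "s \<in> ?I" "d = e k s" using DE[OF d(1)] by blast
    obtain g t where g: "g \<in> ?C" "t \<in> ?I" "d' = e g t" using DE[OF d(2)] by blast
    show ?thesis
      using dd k g x by (simp add: \<pi>_e e_iff left del: greaterThanLessThan_iff)
  qed
  have \<pi>_onto: "\<pi> x ` D = D" if x: "x \<in> ?C" for x
  proof
    show "\<pi> x ` D \<subseteq> D" using DE DI x \<pi>_e by fastforce
    show "D \<subseteq> \<pi> x ` D"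
    proof
      fix d assume "d \<in> D"
      then obtain g s where g: "g \<in> ?C" "s \<in> ?I" "d = e g s" using DE by blast
      then have "d = \<pi> x (e (inv x \<otimes> g) s)" using x by (simp add: \<pi>_e m_assoc[symmetric] del: greaterThanLessThan_iff)
      then show "d \<in> \<pi> x ` D" using DI g x by blast
    qed
  qed
  have "\<exists>f. line_homeo f \<and> (\<forall>d\<in>D. f d = \<pi> x d)" if "x \<in> ?C" for x
    using extend_from_dense[OF D_dense \<pi>_mono[OF that] \<pi>_onto[OF that]] by blast
  then obtain \<rho> where \<rho>: "\<And>x. x \<in> ?C \<Longrightarrow> line_homeo (\<rho> x)" "\<And>x d. x \<in> ?C \<Longrightarrow> d \<in> D \<Longrightarrow> \<rho> x d = \<pi> x d"
    by metis
  have \<rho>_e: "\<rho> x (e g s) = e (x \<otimes> g) s" if "x \<in> ?C" "g \<in> ?C" "s \<in> ?I" for x g s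
    using \<rho>(2)[OF that(1) DI[OF that(2,3)]] \<pi>_e[OF that(2,3)] by simp
  have half: "1 / 2 \<in> ?I" by simp
  show ?thesis
  proof (rule that[of \<rho> "e \<one> (1 / 2)"])
    show "\<rho> \<in> hom G line_group"
    proof (rule homI)
      fix x y assume xy: "x \<in> ?C" "y \<in> ?C"
      then show "\<rho> x \<in> carrier line_group" using \<rho>(1) by simp
      have xy': "x \<otimes> y \<in> ?C" using xy by simp
      have "\<rho> (x \<otimes> y) = (\<lambda>t. \<rho> x (\<rho> y t))"
      proof (rule homeo_eq_on_dense[OF D_dense \<rho>(1)[OF xy'] line_homeo_comp[OF \<rho>(1)[OF xy(1)] \<rho>(1)[OF xy(2)]]])
        fix d assume "d \<in> D"
        then obtain g s where g: "g \<in> ?C" "s \<in> ?I" "d = e g s" using DE by blast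
        then show "\<rho> (x \<otimes> y) d = \<rho> x (\<rho> y d)"
          using xy by (simp add: \<rho>_e m_assoc del: greaterThanLessThan_iff)
      qed
      then show "\<rho> (x \<otimes> y) = \<rho> x \<otimes>\<^bsub>line_group\<^esub> \<rho> y" by (simp add: comp_def)
    qed
    have orb: "\<rho> f (e \<one> (1 / 2)) = e f (1 / 2)" if "f \<in> ?C" for f
      using \<rho>_e[OF that one_closed half] that by simp
    show "\<rho> f (e \<one> (1 / 2)) < \<rho> g (e \<one> (1 / 2)) \<longleftrightarrow> (f, g) \<in> r \<and> f \<noteq> g" if "f \<in> ?C" "g \<in> ?C" for f g
      unfolding orb[OF that(1)] orb[OF that(2)] using e_iff[OF that half half] by simp
    show "\<exists>g\<in>?C. y < \<rho> g (e \<one> (1 / 2))" for y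
    proof -
      obtain k s where k: "k \<in> ?C" "s \<in> ?I" "y < e k s" using e_dense[of y "y + 1"] by auto
      \<comment> \<open>One of \<open>z\<close> and its inverse is positive, so there is no largest element.\<close>
      obtain p where p: "p \<in> ?C" "p \<noteq> \<one>" "(\<one>, p) \<in> r"
      proof (cases "(\<one>, z) \<in> r")
        case False
        then have "(z, \<one>) \<in> r" using r(7)[of z \<one>] z by simp
        then have "(\<one>, inv z) \<in> r" using r(3)[of "inv z" z \<one>] z by simp
        then show ?thesis using that[of "inv z"] z by simp
      qed (use that z in blast)
      have "(k \<otimes> \<one>, k \<otimes> p) \<in> r" "k \<noteq> k \<otimes> p" using r(3)[OF k(1) p(3)] k p by auto
      then have "e k s < e (k \<otimes> p) (1 / 2)" using e_less[of k "k \<otimes> p" s "1 / 2"] k by simp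
      then show ?thesis using k p orb[of "k \<otimes> p"] by (intro bexI[of _ "k \<otimes> p"]) auto
    qed
  qed
qed

section \<open>Perturbing an action perturbs the order\<close>

locale line_action = group G for G :: "('g, 'm) monoid_scheme" (structure) +
  fixes \<rho> :: "'g \<Rightarrow> real \<Rightarrow> real"
  assumes hom: "\<rho> \<in> hom G line_group"
begin

sublocale act: group_hom G line_group \<rho>
  using hom group_line_group by (simp add: group_hom_def group_hom_axioms_def group_axioms)

lemma act_homeo: "g \<in> carrier G \<Longrightarrow> line_homeo (\<rho> g)"
  using act.hom_closed by simp

lemma act_mult: "g \<in> carrier G \<Longrightarrow> k \<in> carrier G \<Longrightarrow> \<rho> (g \<otimes> k) x = \<rho> g (\<rho> k x)"
  by simp

lemma act_inv: "g \<in> carrier G \<Longrightarrow> \<rho> (inv g) = bwd (\<rho> g)"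
  by (simp only: act.hom_inv line_group_inv[OF act_homeo])

lemma act_pow: "g \<in> carrier G \<Longrightarrow> \<rho> (g [^] (n :: nat)) x = (\<rho> g ^^ n) x"
proof (induction n arbitrary: x)
  case (Suc n)
  then show ?case by (simp only: nat_pow_Suc act_mult nat_pow_closed funpow_Suc_right comp_def)
qed simp

lemma orbit_order:
  assumes r: "r \<in> left_orders G"
  shows "{(f, g) \<in> carrier G \<times> carrier G. \<rho> f x < \<rho> g x \<or> \<rho> f x = \<rho> g x \<and> (f, g) \<in> r} \<in> left_orders G"
    (is "?r' \<in> _")
proof -
  note r = left_orderD[OF r]
  have "trans ?r'"
  proof (rule transI)
    fix f g k assume "(f, g) \<in> ?r'" "(g, k) \<in> ?r'"
    then show "(f, k) \<in> ?r'" using transD[OF r(5), of f g k] by auto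
  qed
  moreover have "antisym ?r'" by (rule antisymI) (auto dest: antisymD[OF r(6)])
  moreover have "refl_on (carrier G) ?r'" using r(4) by (auto simp: refl_on_def)
  moreover have "total_on (carrier G) ?r'"
    unfolding total_on_def using r(7) by (auto simp: not_less_iff_gr_or_eq)
  moreover have "(k \<otimes> f, k \<otimes> g) \<in> ?r'" if "k \<in> carrier G" "(f, g) \<in> ?r'" for k f g
  proof -
    have fg: "f \<in> carrier G" "g \<in> carrier G" using that by auto
    have "\<rho> (k \<otimes> f) x < \<rho> (k \<otimes> g) x \<longleftrightarrow> \<rho> f x < \<rho> g x"
      "\<rho> (k \<otimes> f) x = \<rho> (k \<otimes> g) x \<longleftrightarrow> \<rho> f x = \<rho> g x"
      unfolding act_mult[OF that(1) fg(1)] act_mult[OF that(1) fg(2)]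
      by (rule homeo_less[OF act_homeo[OF that(1)]] homeo_eq[OF act_homeo[OF that(1)]])+
    then show ?thesis using that fg r(3)[OF that(1), of f g] by auto
  qed
  ultimately show ?thesis unfolding left_orders_def order_on_defs by auto
qed

lemma fixed_by_generators:
  assumes "S \<subseteq> carrier G" and "\<And>s. s \<in> S \<Longrightarrow> \<rho> s P = P" and "g \<in> generate G S"
  shows "\<rho> g P = P"
  using assms(3)
proof (induction rule: generate.induct)
  case (inv s)
  then have s: "s \<in> carrier G" "\<rho> s P = P" using assms by auto
  then show ?case by (simp add: act_inv bwd_eq_iff[OF act_homeo] del: act.hom_inv)
next
  case (eng g k)
  then have "g \<in> carrier G" "k \<in> carrier G" using generate_in_carrier assms(1) by blast+
  then show ?case using eng by simp
qed (use assms in auto)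

text \<open>
  The supremum of the orbit is invariant.
\<close>
lemma bounded_orbit_fixed_point:
  assumes bound: "\<And>g. g \<in> carrier G \<Longrightarrow> \<rho> g x \<le> y"
  shows "\<exists>P. (\<forall>g\<in>carrier G. \<rho> g x \<le> P \<and> \<rho> g P = P)"
proof -
  define P where "P = Sup ((\<lambda>g. \<rho> g x) ` carrier G)"
  have bdd: "bdd_above ((\<lambda>g. \<rho> g x) ` carrier G)" using bound by (rule bdd_aboveI2)
  have up: "\<rho> g x \<le> P" if "g \<in> carrier G" for g
    unfolding P_def using that bdd by (rule cSUP_upper)
  have le: "P \<le> \<rho> g P" if g: "g \<in> carrier G" for g
  proof -
    have "\<rho> k x \<le> \<rho> g P" if k: "k \<in> carrier G" for k
    proof -
      have "k = g \<otimes> (inv g \<otimes> k)" using g k by (simp add: m_assoc[symmetric])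
      then have "\<rho> k x = \<rho> g (\<rho> (inv g \<otimes> k) x)" using act_mult[OF g, of "inv g \<otimes> k" x] g k by simp
      also have "\<dots> \<le> \<rho> g P" using up[of "inv g \<otimes> k"] g k by (simp only: homeo_le[OF act_homeo[OF g]] m_closed inv_closed)
      finally show ?thesis .
    qed
    then show ?thesis unfolding P_def[of] by (intro cSUP_least) auto
  qed
  have "\<rho> g P = P" if g: "g \<in> carrier G" for g
    using le[OF g] le[OF inv_closed[OF g]]
    unfolding act_inv[OF g] by (simp add: le_bwd[OF act_homeo[OF g]])
  then show ?thesis using up by blast
qed

text \<open>
  Evaluating a word at a point visits only finitely many points, so the result depends only on the
  values of the generators from \<open>V\<close> on some ray \<open>{..K}\<close>.
\<close>
lemma local_dependence:
  assumes UV: "U \<union> V \<subseteq> carrier G" and g: "g \<in> generate G (U \<union> V)"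
  shows "\<exists>K. \<forall>\<rho>'. \<rho>' \<in> hom G line_group \<and> (\<forall>u\<in>U. \<rho>' u = \<rho> u) \<and> (\<forall>v\<in>V. \<forall>t\<le>K. \<rho>' v t = \<rho> v t) \<longrightarrow>
    \<rho>' g x = \<rho> g x"
  using g
proof (induction arbitrary: x rule: generate.induct)
  case one
  have "\<rho>' \<one> x = \<rho> \<one> x" if "\<rho>' \<in> hom G line_group" for \<rho>'
  proof -
    interpret \<rho>': line_action G \<rho>' using that by unfold_locales
    show ?thesis by simp
  qed
  then show ?case by blast
next
  case (incl g)
  then show ?case by (intro exI[of _ x]) auto
next
  case (inv g)
  then have g: "g \<in> carrier G" using UV by auto
  show ?case
  proof (intro exI[of _ "bwd (\<rho> g) x"] allI impI)
    fix \<rho>' assume *: "\<rho>' \<in> hom G line_group \<and> (\<forall>u\<in>U. \<rho>' u = \<rho> u) \<and>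
      (\<forall>v\<in>V. \<forall>t\<le>bwd (\<rho> g) x. \<rho>' v t = \<rho> v t)"
    interpret \<rho>': line_action G \<rho>' using * by unfold_locales auto
    have "\<rho>' g (bwd (\<rho> g) x) = \<rho> g (bwd (\<rho> g) x)" using * inv by auto
    then have "bwd (\<rho>' g) x = bwd (\<rho> g) x"
      by (simp add: bwd_eq_iff[OF \<rho>'.act_homeo[OF g]] homeo_bwd[OF act_homeo[OF g]])
    then show "\<rho>' (inv g) x = \<rho> (inv g) x" by (simp only: act_inv[OF g] \<rho>'.act_inv[OF g])
  qed
next
  case (eng g k)
  then have gk: "g \<in> carrier G" "k \<in> carrier G" using generate_in_carrier UV by blast+
  obtain K where K: "\<And>\<rho>'. \<rho>' \<in> hom G line_group \<Longrightarrow> (\<forall>u\<in>U. \<rho>' u = \<rho> u) \<Longrightarrow>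
    (\<forall>v\<in>V. \<forall>t\<le>K. \<rho>' v t = \<rho> v t) \<Longrightarrow> \<rho>' k x = \<rho> k x" using eng.IH(2)[of x] by blast
  obtain L where L: "\<And>\<rho>'. \<rho>' \<in> hom G line_group \<Longrightarrow> (\<forall>u\<in>U. \<rho>' u = \<rho> u) \<Longrightarrow>
    (\<forall>v\<in>V. \<forall>t\<le>L. \<rho>' v t = \<rho> v t) \<Longrightarrow> \<rho>' g (\<rho> k x) = \<rho> g (\<rho> k x)" using eng.IH(1)[of "\<rho> k x"] by blast
  show ?case
  proof (intro exI[of _ "max K L"] allI impI)
    fix \<rho>' assume *: "\<rho>' \<in> hom G line_group \<and> (\<forall>u\<in>U. \<rho>' u = \<rho> u) \<and>
      (\<forall>v\<in>V. \<forall>t\<le>max K L. \<rho>' v t = \<rho> v t)"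
    interpret \<rho>': line_action G \<rho>' using * by unfold_locales auto
    show "\<rho>' (g \<otimes> k) x = \<rho> (g \<otimes> k) x"
      unfolding act_mult[OF gk] \<rho>'.act_mult[OF gk] using K[of \<rho>'] L[of \<rho>'] * by auto
  qed
qed

text \<open>
  If \<open>u\<close> escapes under \<open>\<rho>'\<close>, then the elements \<open>u\<^sup>n g0\<close> are cofinal for a suitable \<open>g0\<close>. If it does not
  escape under \<open>\<rho>\<close>, then some point \<open>t\<close> far out is not moved up by \<open>u\<close>, and \<open>t\<close> bounds
  the images of \<open>x\<close> under all \<open>u\<^sup>n g0\<close>. Monotonicity carries this bound over to \<open>\<rho>'\<close>.
\<close>
lemma escapes_transfer:
  assumes "line_action G \<rho>'" and u: "u \<in> carrier G" and esc: "escapes (\<rho>' u)"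
    and mono: "\<And>f g. f \<in> carrier G \<Longrightarrow> g \<in> carrier G \<Longrightarrow> \<rho> f x < \<rho> g x \<Longrightarrow> \<rho>' f x \<le> \<rho>' g x"
    and unb: "\<And>y. \<exists>g\<in>carrier G. y < \<rho> g x" and unb': "\<And>y. \<exists>g\<in>carrier G. y < \<rho>' g x"
  shows "escapes (\<rho> u)"
proof (rule ccontr)
  interpret \<rho>': line_action G \<rho>' by fact
  assume non: "\<not> escapes (\<rho> u)"
  obtain x1 where x1: "\<And>t. x1 \<le> t \<Longrightarrow> t < \<rho>' u t" using esc by (auto simp: escapes_def)
  obtain g0 where g0: "g0 \<in> carrier G" "x1 < \<rho>' g0 x" using unb' by blast
  obtain t where t: "\<rho> g0 x \<le> t" "\<rho> u t \<le> t" using non by (auto simp: escapes_def not_less)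
  obtain g1 where g1: "g1 \<in> carrier G" "t < \<rho> g1 x" using unb by blast
  have stay: "(\<rho> u ^^ n) (\<rho> g0 x) \<le> t" for n
  proof (induction n)
    case (Suc n)
    then have "\<rho> u ((\<rho> u ^^ n) (\<rho> g0 x)) \<le> \<rho> u t" by (simp only: homeo_le[OF act_homeo[OF u]])
    then show ?case using t by simp
  qed (use t in simp)
  have bound: "(\<rho>' u ^^ n) (\<rho>' g0 x) \<le> \<rho>' g1 x" for n
  proof -
    have un: "u [^] n \<in> carrier G" "u [^] n \<otimes> g0 \<in> carrier G" using u g0 by auto
    have "\<rho> (u [^] n \<otimes> g0) x < \<rho> g1 x"
      using stay[of n] g1(2) unfolding act_mult[OF un(1) g0(1)] act_pow[OF u] by simp
    then have "\<rho>' (u [^] n \<otimes> g0) x \<le> \<rho>' g1 x" by (rule mono[OF un(2) g1(1)])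
    then show ?thesis unfolding \<rho>'.act_mult[OF un(1) g0(1)] \<rho>'.act_pow[OF u] .
  qed
  have "\<exists>n. \<rho>' g1 x < (\<rho>' u ^^ n) (\<rho>' g0 x)"
    by (rule orbit_passes[OF \<rho>'.act_homeo[OF u], where r = "\<rho>' g1 x + 1"]) (use x1 g0 in auto)
  then show False using bound by (meson not_le)
qed

end

lemma line_group_commutator_iff:
  assumes f: "line_homeo f" and g: "line_homeo g"
  shows "commutator line_group f g = h \<longleftrightarrow> (\<forall>x. f (g x) = h (g (f x)))"
proof -
  have "commutator line_group f g = (\<lambda>x. f (g (bwd f (bwd g x))))"
    by (simp add: commutator_def line_group_inv f g comp_def)
  moreover have "(\<lambda>x. f (g (bwd f (bwd g x)))) = h \<longleftrightarrow> (\<forall>x. f (g x) = h (g (f x)))"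
  proof
    assume eq: "(\<lambda>x. f (g (bwd f (bwd g x)))) = h"
    show "\<forall>x. f (g x) = h (g (f x))"
      unfolding eq[symmetric] by (simp add: bwd_homeo[OF f] bwd_homeo[OF g])
  next
    assume "\<forall>x. f (g x) = h (g (f x))"
    then show "(\<lambda>x. f (g (bwd f (bwd g x)))) = h"
      by (intro ext) (simp add: homeo_bwd[OF f] homeo_bwd[OF g])
  qed
  ultimately show ?thesis by simp
qed

text \<open>
  The order read off from the perturbed action \<open>\<rho>'\<close> is again \<open>r\<close>, so escaping elements of \<open>\<rho>'\<close> escape under
  \<open>\<rho>\<close>; the perturbation was chosen to violate this. If the \<open>\<rho>'\<close>-orbit of \<open>x0\<close> were bounded above, its
  supremum would be fixed by \<open>\<a>\<close>, \<open>\<b>\<close> and \<open>H\<close> under \<open>\<rho>'\<close>, hence also under \<open>\<rho>\<close>, whose orbit is unbounded.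
\<close>
theorem (in commutator_amalgam) no_isolated_left_order:
  assumes "countable (carrier G)" and r: "r \<in> left_orders G"
  shows "\<not> openin (LO G) {r}"
proof
  assume "openin (LO G) {r}"
  then obtain S where S: "finite S" "S \<subseteq> positive_elements G r" "LO_nbhd G S \<subseteq> {r}"
    unfolding openin_LO by auto
  have \<iota>h: "\<iota> h \<in> carrier G" using \<iota>_hom h(1) by (auto simp: hom_def)
  obtain \<rho> :: "'g \<Rightarrow> real \<Rightarrow> real" and x0 :: real where \<rho>: "\<rho> \<in> hom G line_group"
    and order: "\<And>f g. f \<in> carrier G \<Longrightarrow> g \<in> carrier G \<Longrightarrow> \<rho> f x0 < \<rho> g x0 \<longleftrightarrow> (f, g) \<in> r \<and> f \<noteq> g"
    and unbounded: "\<And>y. \<exists>g\<in>carrier G. y < \<rho> g x0"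
  proof (rule G.dynamical_realization[OF assms(1) r \<iota>h \<iota>_h_nontrivial], goal_cases)
    case (1 \<rho> x0)
    show ?case by (rule 1(1)[of \<rho> x0]) (rule 1(2-4); assumption)+
  qed
  interpret \<rho>: line_action G \<rho> using \<rho> by unfold_locales
  let ?V = "{\<a>, \<b>}"
  have UV: "\<iota> ` carrier H \<union> ?V \<subseteq> carrier G" using \<iota>_hom ab_closed by (auto simp: hom_def)
  define good where "good K s \<longleftrightarrow> (\<forall>\<rho>'. \<rho>' \<in> hom G line_group \<and> (\<forall>u\<in>\<iota> ` carrier H. \<rho>' u = \<rho> u) \<and>
      (\<forall>v\<in>?V. \<forall>t\<le>K. \<rho>' v t = \<rho> v t) \<longrightarrow> \<rho>' s x0 = \<rho> s x0)" for K s
  have good_mono: "good L s" if "good K s" "K \<le> L" for K L s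
    using that unfolding good_def by fastforce
  have "\<exists>K. good K s" if "s \<in> S" for s
    unfolding good_def using \<rho>.local_dependence[OF UV] S(2) generated that
    by (auto simp: positive_elements_def)
  then obtain k where k: "\<And>s. s \<in> S \<Longrightarrow> good (k s) s" by metis
  define K where "K = Max (insert 0 (k ` S))"
  have K: "good K s" if "s \<in> S" for s
    using good_mono[OF k[OF that]] S(1) that by (simp add: K_def)
  interpret rel: commutator_relation "\<rho> (\<iota> h)" "\<rho> \<a>" "\<rho> \<b>"
  proof
    show "line_homeo (\<rho> (\<iota> h))" "line_homeo (\<rho> \<a>)" "line_homeo (\<rho> \<b>)"
      using \<rho>.act_homeo \<iota>h ab_closed by auto
    then have "commutator line_group (\<rho> \<a>) (\<rho> \<b>) = \<rho> (\<iota> h)"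
      using hom_commutator[OF G.group_axioms group_line_group \<rho> ab_closed] commutator_ab by simp
    then show "\<rho> \<a> (\<rho> \<b> x) = \<rho> (\<iota> h) (\<rho> \<b> (\<rho> \<a> x))" for x
      using line_group_commutator_iff[OF \<rho>.act_homeo[OF ab_closed(1)] \<rho>.act_homeo[OF ab_closed(2)]] by blast
    \<comment> \<open>The element \<open>\<iota> h\<close> moves every point of the orbit of \<open>x0\<close>.\<close>
    show "\<exists>t>K. \<rho> (\<iota> h) t \<noteq> t" for K
    proof -
      obtain g where g: "g \<in> carrier G" "K < \<rho> g x0" using unbounded by blast
      have hg: "\<iota> h \<otimes>\<^bsub>G\<^esub> g \<in> carrier G" "\<iota> h \<otimes>\<^bsub>G\<^esub> g \<noteq> g"
        using g \<iota>h \<iota>_h_nontrivial by (auto simp: G.r_cancel_one)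
      have "\<rho> (\<iota> h \<otimes>\<^bsub>G\<^esub> g) x0 \<noteq> \<rho> g x0"
        using order[OF hg(1) g(1)] order[OF g(1) hg(1)] left_orderD(7)[OF r hg(1) g(1)] hg(2) by auto
      then show ?thesis using g unfolding \<rho>.act_mult[OF \<iota>h g(1)] by blast
    qed
  qed
  obtain \<alpha> \<beta> where \<alpha>: "line_homeo \<alpha>" and \<beta>: "line_homeo \<beta>"
    and comm: "\<forall>x. \<alpha> (\<beta> x) = \<rho> (\<iota> h) (\<beta> (\<alpha> x))"
    and agree: "\<forall>x\<le>K. \<alpha> x = \<rho> \<a> x \<and> \<beta> x = \<rho> \<b> x"
    and fixed: "\<forall>P. \<alpha> P = P \<and> \<beta> P = P \<longrightarrow> \<rho> \<a> P = P \<and> \<rho> \<b> P = P"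
    and drift: "changes_drift (\<rho> \<a>) \<alpha> \<or> changes_drift (\<rho> \<b>) \<beta>"
    using rel.flexible[unfolded flexible_def, THEN spec, of K] by (elim exE conjE) (rule that; assumption)
  have \<sigma>: "\<rho> \<circ> \<iota> \<in> hom H line_group" by (rule hom_compose[OF \<iota>_hom \<rho>])
  have "commutator line_group \<alpha> \<beta> = (\<rho> \<circ> \<iota>) h"
    using comm line_group_commutator_iff[OF \<alpha> \<beta>] by simp
  then obtain \<rho>' where \<rho>': "\<rho>' \<in> hom G line_group" and \<rho>'_\<iota>: "\<And>x. x \<in> carrier H \<Longrightarrow> \<rho>' (\<iota> x) = \<rho> (\<iota> x)"
    and \<rho>'_ab: "\<rho>' \<a> = \<alpha>" "\<rho>' \<b> = \<beta>"
    using universal[OF group_line_group \<sigma>, of \<alpha> \<beta>] \<alpha> \<beta> by auto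
  interpret \<rho>': line_action G \<rho>' using \<rho>' by unfold_locales
  define r' where "r' = {(f, g) \<in> carrier G \<times> carrier G. \<rho>' f x0 < \<rho>' g x0 \<or> \<rho>' f x0 = \<rho>' g x0 \<and> (f, g) \<in> r}"
  have r': "r' \<in> left_orders G" unfolding r'_def by (rule \<rho>'.orbit_order[OF r])
  have "S \<subseteq> positive_elements G r'"
  proof
    fix s assume s: "s \<in> S"
    then have s': "s \<in> carrier G" "(\<one>\<^bsub>G\<^esub>, s) \<in> r" "s \<noteq> \<one>\<^bsub>G\<^esub>" using S(2) by (auto simp: positive_elements_def)
    have "\<rho>' s x0 = \<rho> s x0"
      using K[OF s, unfolded good_def] \<rho>' \<rho>'_\<iota> \<rho>'_ab agree by auto
    moreover have "\<rho> \<one>\<^bsub>G\<^esub> x0 < \<rho> s x0" using order[of "\<one>\<^bsub>G\<^esub>" s] s' by simp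
    ultimately show "s \<in> positive_elements G r'"
      using s' by (simp add: positive_elements_def r'_def)
  qed
  then have "r' = r" using S(3) r' by (auto simp: LO_nbhd_def)
  then have mono: "\<rho>' f x0 \<le> \<rho>' g x0" if "f \<in> carrier G" "g \<in> carrier G" "\<rho> f x0 < \<rho> g x0" for f g
  proof -
    have "(f, g) \<in> r'" using order[OF that(1,2)] that(3) \<open>r' = r\<close> by simp
    then show ?thesis by (auto simp: r'_def)
  qed
  have unbounded': "\<exists>g\<in>carrier G. y < \<rho>' g x0" for y
  proof (rule ccontr)
    assume "\<not> ?thesis"
    then have "\<rho>' g x0 \<le> y" if "g \<in> carrier G" for g using that by (auto simp: not_less)
    then have "\<exists>P. \<forall>g\<in>carrier G. \<rho>' g x0 \<le> P \<and> \<rho>' g P = P"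
      by (rule \<rho>'.bounded_orbit_fixed_point)
    then obtain P where "\<forall>g\<in>carrier G. \<rho>' g x0 \<le> P \<and> \<rho>' g P = P" ..
    then have P: "\<rho>' g x0 \<le> P" "\<rho>' g P = P" if "g \<in> carrier G" for g using that by simp_all
    have "\<rho> s P = P" if s: "s \<in> \<iota> ` carrier H \<union> ?V" for s
    proof -
      have "\<rho> \<a> P = P \<and> \<rho> \<b> P = P"
        using fixed[THEN spec, of P] P(2)[OF ab_closed(1)] P(2)[OF ab_closed(2)] \<rho>'_ab by simp
      moreover have "\<rho> (\<iota> x) P = P" if "x \<in> carrier H" for x
        using P(2)[of "\<iota> x"] \<rho>'_\<iota>[OF that] that UV by auto
      ultimately show ?thesis using s by auto
    qed
    then have stays: "\<rho> g P = P" if "g \<in> carrier G" for g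
      using \<rho>.fixed_by_generators[OF UV] that generated by auto
    obtain g where g: "g \<in> carrier G" "P < \<rho> g x0" using unbounded by blast
    then have "\<rho> g P < \<rho> g x0" using stays by simp
    then have "P < x0" by (simp only: homeo_less[OF \<rho>.act_homeo[OF g(1)]])
    then show False using P(1)[OF G.one_closed] by simp
  qed
  have transfer: "escapes (\<rho> u)" if "u \<in> carrier G" "escapes (\<rho>' u)" for u
    by (rule \<rho>.escapes_transfer[OF \<rho>'.line_action_axioms that mono unbounded unbounded'])
  have "\<not> changes_drift (\<rho> u) (\<rho>' u)" if u: "u \<in> carrier G" for u
    using transfer[OF u] transfer[OF G.inv_closed[OF u]]
    unfolding changes_drift_def \<rho>.act_inv[OF u] \<rho>'.act_inv[OF u] by blast
  from this[OF ab_closed(1)] this[OF ab_closed(2)] show False using drift \<rho>'_ab by simp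
qed

theorem theorem3p5:
  fixes G :: "('g, 'm) monoid_scheme"
    and H :: "('h, 'n) monoid_scheme"
    and h :: 'h
    and a b :: 's
    and \<phi> :: "'h \<Rightarrow> ('s \<times> bool) list set"
  defines "F \<equiv> free_group {a, b}"
    and "c \<equiv> commutator (free_group {a, b}) (free_gen {a, b} a) (free_gen {a, b} b)"
  assumes "group G" and "countable (carrier G)" and "left_orderable G"
    and "group H" and "h \<in> carrier H" and "h \<noteq> \<one>\<^bsub>H\<^esub>"
    and "a \<noteq> b"
    and "\<phi> \<in> iso (subgroup_generated H {h}) (subgroup_generated F {c})" and "\<phi> h = c"
    and "G \<cong> amalgamated_product H F (generate H {h}) \<phi>"
  shows "\<not> (\<exists>r \<in> topspace (LO G). openin (LO G) {r})"
proof -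
  have "group (amalgamated_product H F (generate H {h}) \<phi>)"
    unfolding F_def by (rule group_amalgamated_product[OF \<open>group H\<close> group_free_group])
  then obtain \<psi> where \<psi>: "\<psi> \<in> iso (amalgamated_product H F (generate H {h}) \<phi>) G"
    using group.iso_sym[OF \<open>group G\<close>] assms(12) by (auto simp: is_iso_def)
  interpret commutator_amalgam G H h a b F c \<phi> \<psi>
    using assms(3,6-11) \<psi>
    by (simp add: commutator_amalgam_def commutator_amalgam_axioms_def F_def c_def iso_def)
  show ?thesis using no_isolated_left_order[OF assms(4)] by auto
qed

end
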